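(* Let $m=(m_1,m_2,m_3)\in(\mathbb{R}^+)^3$ with $m_1+m_2+m_3=1$, let $e_1,e_2,e_3\in\mathbb{R}$, and let $\delta_{ij}=1-\frac{e_ie_j}{m_im_j}$. Suppose $\delta_{12},\delta_{23},\delta_{31}>0$ and $\delta_{ij}^{1/3}+\delta_{jk}^{1/3}>\delta_{ki}^{1/3}$ for every cyclic permutation $(i,j,k)$ of $(1,2,3)$. Let $\tau>0$ and $k=(1,1,1)$ or $k=(-1,-1,-1)$. Then: (i) $\displaystyle\inf_{q\in X_{\tau,k}}f(q)=\Big(\sum_{(i,j)\in P}m_im_j\delta_{ij}^{2/3}\Big)\,3\cdot 2^{-1/3}\pi^{2/3}\tau^{1/3}$; (ii) the elliptic triangle solutions of the charged three-body problem (lying in $X_{\tau,k}$) attain the minimum of $f$ on $X_{\tau,k}$; (iii) every regular (i.e. $C^2$) minimizer of $f$ on $X_{\tau,k}$ is an elliptic triangle solution.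
   Context: $P=\{(1,2),(2,3),(3,1)\}$. The configuration space is $\hat{\mathcal X}=\{q=(q_1,q_2,q_3)\in(\mathbb{R}^2)^3:\sum_i m_iq_i=0,\ q_i\ne q_j\ \forall i\ne j\}$. For a closed curve $u:S^1\to\mathbb{R}^2\setminus\{0\}$, ${\rm ind}(u,0)$ is its winding number (degree) around the origin. For $k=(k_{12},k_{23},k_{31})\in\mathbb{Z}^3$, $\Omega_{\tau,k}=\{q\in C^\infty(\mathbb{R}/\tau\mathbb{Z},\hat{\mathcal X}):{\rm ind}(q_i-q_j,0)=k_{ij}\ \forall (i,j)\in P\}$, and $X_{\tau,k}$ is the $W^{1,2}$-completion of $\Omega_{\tau,k}$. The functional is $f(q)=\int_0^\tau\big(\tfrac12\sum_{i=1}^3m_i|\dot q_i(t)|^2+U(q(t))\big)dt$ with $U(q)=\sum_{i<j}m_im_j\delta_{ij}/|q_i-q_j|$. The charged three-body problem is $m_i\ddot q_i=\sum_{j\ne i}\frac{m_im_j\delta_{ij}}{|q_i-q_j|^3}(q_j-q_i)$. An elliptic triangle solution is a solution of the form $q_i(t)=r(t)R(\theta(t))a_i$, $i=1,2,3$, where $R(\varphi)$ is rotation by $\varphi$, $(a_1,a_2,a_3)$ is a non-collinear central configuration of the charged problem (distinct $a_i$ with $\lambda m_ia_i+\partial U/\partial q_i(a)=0$ for some $\lambda$), and $r(t)(\cos\theta(t),\sin\theta(t))$ is a (collision-free) elliptic Kepler orbit, here $\tau$-periodic. *)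

theory Defs
  imports "HOL-Complex_Analysis.Complex_Analysis"
begin

text \<open>Points of the plane are complex numbers; a configuration is a function
  nat \<Rightarrow> complex of which only the indices 1, 2, 3 are used. A path of
  configurations is q :: real \<Rightarrow> nat \<Rightarrow> complex, with q t i the position of body i.\<close>

definition bodies :: "nat set" where "bodies = {1,2,3}"

definition delta :: "(nat \<Rightarrow> real) \<Rightarrow> (nat \<Rightarrow> real) \<Rightarrow> nat \<Rightarrow> nat \<Rightarrow> real" where
  "delta m e i j = 1 - e i * e j / (m i * m j)"

text \<open>Potential U, with value \<infinity> at collisions (so that f is +\<infinity> on colliding paths).\<close>
definition U :: "(nat \<Rightarrow> real) \<Rightarrow> (nat \<Rightarrow> real) \<Rightarrow> (nat \<Rightarrow> complex) \<Rightarrow> ennreal" where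
  "U m e x = (if \<exists>i\<in>bodies. \<exists>j\<in>bodies. i \<noteq> j \<and> x i = x j then \<infinity>
     else ennreal (\<Sum>(i,j)\<in>{(1,2),(2,3),(3,1)}. m i * m j * delta m e i j / cmod (x i - x j)))"

definition action :: "(nat \<Rightarrow> real) \<Rightarrow> (nat \<Rightarrow> real) \<Rightarrow> real \<Rightarrow> (real \<Rightarrow> nat \<Rightarrow> complex) \<Rightarrow> ennreal" where
  "action m e \<tau> q = (\<integral>\<^sup>+ t \<in> {0..\<tau>}.
      ennreal ((1/2) * (\<Sum>i\<in>bodies. m i * (cmod (vector_derivative (\<lambda>s. q s i) (at t)))\<^sup>2))
      + U m e (q t) \<partial>lborel)"

definition periodic_path :: "real \<Rightarrow> (real \<Rightarrow> 'a) \<Rightarrow> bool" where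
  "periodic_path \<tau> u \<longleftrightarrow> (\<forall>t. u (t + \<tau>) = u t)"

definition smooth_fun :: "(real \<Rightarrow> complex) \<Rightarrow> bool" where
  "smooth_fun u \<longleftrightarrow> (\<exists>D :: nat \<Rightarrow> real \<Rightarrow> complex. D 0 = u \<and>
      (\<forall>n t. (D n has_vector_derivative D (Suc n) t) (at t)))"

definition C2_fun :: "(real \<Rightarrow> complex) \<Rightarrow> bool" where
  "C2_fun u \<longleftrightarrow> (\<exists>v a. (\<forall>t. (u has_vector_derivative v t) (at t)) \<and>
      (\<forall>t. (v has_vector_derivative a t) (at t)) \<and> continuous_on UNIV a)"

definition ind0 :: "real \<Rightarrow> (real \<Rightarrow> complex) \<Rightarrow> complex" where
  "ind0 \<tau> u = winding_number (\<lambda>s. u (\<tau> * s)) 0"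

definition kidx :: "int \<times> int \<times> int \<Rightarrow> nat \<Rightarrow> nat \<Rightarrow> int" where
  "kidx k i j = (if (i,j) = (1,2) then fst k else if (i,j) = (2,3) then fst (snd k) else snd (snd k))"

definition Omega :: "(nat \<Rightarrow> real) \<Rightarrow> real \<Rightarrow> int \<times> int \<times> int \<Rightarrow> (real \<Rightarrow> nat \<Rightarrow> complex) set" where
  "Omega m \<tau> k = {q. (\<forall>i\<in>bodies. smooth_fun (\<lambda>t. q t i) \<and> periodic_path \<tau> (\<lambda>t. q t i))
     \<and> (\<forall>t. (\<Sum>i\<in>bodies. of_real (m i) * q t i) = 0)
     \<and> (\<forall>t. \<forall>i\<in>bodies. \<forall>j\<in>bodies. i \<noteq> j \<longrightarrow> q t i \<noteq> q t j)
     \<and> (\<forall>(i,j)\<in>{(1,2),(2,3),(3,1)}. ind0 \<tau> (\<lambda>t. q t i - q t j) = of_int (kidx k i j))}"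

definition W12 :: "real \<Rightarrow> (real \<Rightarrow> nat \<Rightarrow> complex) \<Rightarrow> bool" where
  "W12 \<tau> q \<longleftrightarrow> (\<forall>i\<in>bodies. periodic_path \<tau> (\<lambda>t. q t i) \<and>
     (\<exists>v. v absolutely_integrable_on {0..\<tau>} \<and> (\<lambda>t. (cmod (v t))\<^sup>2) integrable_on {0..\<tau>} \<and>
          (\<forall>t\<in>{0..\<tau>}. q t i = q 0 i + integral {0..t} v)))"

definition W12_dist2 :: "real \<Rightarrow> (real \<Rightarrow> nat \<Rightarrow> complex) \<Rightarrow> (real \<Rightarrow> nat \<Rightarrow> complex) \<Rightarrow> ennreal" where
  "W12_dist2 \<tau> p q = (\<integral>\<^sup>+ t \<in> {0..\<tau>}. ennreal (\<Sum>i\<in>bodies.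
      (cmod (p t i - q t i))\<^sup>2 +
      (cmod (vector_derivative (\<lambda>s. p s i) (at t) - vector_derivative (\<lambda>s. q s i) (at t)))\<^sup>2) \<partial>lborel)"

definition Xspace :: "(nat \<Rightarrow> real) \<Rightarrow> real \<Rightarrow> int \<times> int \<times> int \<Rightarrow> (real \<Rightarrow> nat \<Rightarrow> complex) set" where
  "Xspace m \<tau> k = {q. W12 \<tau> q \<and> (\<exists>p. (\<forall>n. p n \<in> Omega m \<tau> k) \<and>
      ((\<lambda>n. W12_dist2 \<tau> (p n) q) \<longlonglongrightarrow> 0))}"

definition charged_solution :: "(nat \<Rightarrow> real) \<Rightarrow> (nat \<Rightarrow> real) \<Rightarrow> (real \<Rightarrow> nat \<Rightarrow> complex) \<Rightarrow> bool" where
  "charged_solution m e q \<longleftrightarrow>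
     (\<forall>t. \<forall>i\<in>bodies. \<forall>j\<in>bodies. i \<noteq> j \<longrightarrow> q t i \<noteq> q t j) \<and>
     (\<forall>i\<in>bodies. \<exists>v a. (\<forall>t. ((\<lambda>s. q s i) has_vector_derivative v t) (at t)) \<and>
        (\<forall>t. (v has_vector_derivative a t) (at t)) \<and>
        (\<forall>t. of_real (m i) * a t = (\<Sum>j\<in>bodies - {i}.
            of_real (m i * m j * delta m e i j / (cmod (q t i - q t j)) ^ 3) * (q t j - q t i))))"

text \<open>Non-collinear central configuration of the charged problem:
  \<lambda> m_i a_i + \<partial>U/\<partial>q_i(a) = 0, where \<partial>U/\<partial>q_i(a) = - \<Sum>_{j\<noteq>i} m_i m_j \<delta>_ij (a_i - a_j)/|a_i - a_j|^3.\<close>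
definition noncollinear_cc :: "(nat \<Rightarrow> real) \<Rightarrow> (nat \<Rightarrow> real) \<Rightarrow> (nat \<Rightarrow> complex) \<Rightarrow> bool" where
  "noncollinear_cc m e a \<longleftrightarrow>
     (\<forall>i\<in>bodies. \<forall>j\<in>bodies. i \<noteq> j \<longrightarrow> a i \<noteq> a j) \<and>
     Im ((a 2 - a 1) * cnj (a 3 - a 1)) \<noteq> 0 \<and>
     (\<exists>lam::real. \<forall>i\<in>bodies. of_real (lam * m i) * a i
        - (\<Sum>j\<in>bodies - {i}. of_real (m i * m j * delta m e i j / (cmod (a i - a j)) ^ 3) * (a i - a j)) = 0)"

definition elliptic_kepler :: "real \<Rightarrow> (real \<Rightarrow> complex) \<Rightarrow> bool" where
  "elliptic_kepler \<tau> z \<longleftrightarrow> periodic_path \<tau> z \<and> (\<forall>t. z t \<noteq> 0) \<and>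
     (\<exists>\<mu>>0. \<exists>v a. (\<forall>t. (z has_vector_derivative v t) (at t)) \<and>
        (\<forall>t. (v has_vector_derivative a t) (at t)) \<and>
        (\<forall>t. a t = - of_real (\<mu> / (cmod (z t)) ^ 3) * z t))"

definition elliptic_triangle :: "(nat \<Rightarrow> real) \<Rightarrow> (nat \<Rightarrow> real) \<Rightarrow> real \<Rightarrow> (real \<Rightarrow> nat \<Rightarrow> complex) \<Rightarrow> bool" where
  "elliptic_triangle m e \<tau> q \<longleftrightarrow> charged_solution m e q \<and>
     (\<exists>a z. noncollinear_cc m e a \<and> elliptic_kepler \<tau> z \<and>
        (\<forall>t. \<forall>i\<in>bodies. q t i = z t * a i))"

end

(* Gordon's inequality is proved in regularised time. If u winds an odd number of times around the
   origin during one period, write u = z^2 with z antiperiodic and let dt = |u| ds, so that a period has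
   the length S, the integral of 1/|u| dt, in s. Wirtinger's inequality for the antiperiodic z then reads
   int |u'|^2 dt / 2 >= 2 pi^2 tau / S^2, and the action int |u'|^2/2 + delta/|u| dt is at least
   2 pi^2 tau / S^2 + delta S, which AM-GM bounds below by the constant of the theorem. Equality makes z a
   harmonic oscillation in s, i.e. u a Kepler orbit. A loop through the origin satisfies the same bound,
   since sqrt |u| vanishes at both ends of a period.

   As the masses add up to one, the action of the three bodies is the sum of the Kepler actions of the
   three mutual differences, weighted by m_i m_j. Three Kepler orbits u_12, u_23, u_31 with sum zero satisfy
   sum delta_ij u_ij / |u_ij|^3 = 0. The strict triangle inequalities exclude collinear positions, so the
   ratios delta_ij / |u_ij|^3 agree and the shape of the triangle is constant. *)

theory Submission
  imports Defs
begin

section \<open>Periodic functions and a weighted Wirtinger inequality\<close>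


text \<open>An element of \<open>Xspace\<close> is a limit of smooth loops. It may collide, and a
  collision destroys the winding number, so Wirtinger's inequality is proved along the smooth
  approximations and passed to the limit as a bound on the kinetic energy alone. At a collision the
  integrals of 1/|u| along the approximations need not converge, which forces the regularised
  radius.

  The equality case is needed only for collision-free C^1 loops: a C^2 minimiser has finite action,
  and a collision of a C^1 path would make the integral of 1/|u| diverge logarithmically.

  An odd winding number makes the square root z antiperiodic. Its coordinates then have zeros, which
  gives the Dirichlet constant pi / S. Antiperiodicity fixes the frequency of a Kepler orbit only up
  to an odd factor; the index 1 or -1 singles out the lowest frequency, the only one with minimal
  action.

  The infimum is reached by a rigidly rotating triangle whose sides are proportional to the cube
  roots of the \<delta>_ij; the triangle inequalities that exclude collinear positions also provide
  this triangle.\<close>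

lemma antiderivative_exists:
  fixes f :: "real \<Rightarrow> 'a::euclidean_space"
  assumes "continuous_on UNIV f"
  obtains F where "\<And>t. (F has_vector_derivative f t) (at t)"
proof -
  have "\<exists>F. \<forall>x::real. -\<infinity> < ereal x \<longrightarrow> ereal x < \<infinity> \<longrightarrow> (F has_vector_derivative f x) (at x)"
    by (rule einterval_antiderivative) (use assms in \<open>auto simp: continuous_on_eq_continuous_at\<close>)
  then show thesis using that by auto
qed

lemma constant_if_vector_derivative_zero:
  fixes f :: "real \<Rightarrow> 'a::real_normed_vector"
  assumes "\<And>t. (f has_vector_derivative 0) (at t)"
  shows "f s = f t"
proof -
  obtain c where "\<And>x. f x = c"
    by (rule has_vector_derivative_zero_constant[of UNIV f]) (use assms in auto)
  then show ?thesis by simp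
qed

lemma has_vector_derivative_inner:
  fixes f g :: "real \<Rightarrow> 'a::real_inner"
  assumes "(f has_vector_derivative f') (at t within S)" "(g has_vector_derivative g') (at t within S)"
  shows "((\<lambda>t. f t \<bullet> g t) has_vector_derivative (f t \<bullet> g' + f' \<bullet> g t)) (at t within S)"
  by (rule bounded_bilinear.has_vector_derivative[OF bounded_bilinear_inner assms])

lemma has_vector_derivative_shift:
  fixes f :: "real \<Rightarrow> 'a::real_normed_vector"
  assumes "(f has_vector_derivative f') (at (t + c))"
  shows "((\<lambda>t. f (t + c)) has_vector_derivative f') (at t)"
proof -
  have "((\<lambda>t. t + c) has_real_derivative 1) (at t)"
    by (auto intro!: derivative_eq_intros)
  then have "((\<lambda>t. t + c) has_vector_derivative 1) (at t)"
    by (simp add: has_real_derivative_iff_has_vector_derivative)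
  from vector_diff_chain_at[OF this] assms show ?thesis by (auto simp: o_def)
qed

lemma integral_period_shift:
  fixes f :: "real \<Rightarrow> 'a::euclidean_space"
  assumes "continuous_on UNIV f" "\<And>t. f (t + \<tau>) = f t" "\<tau> \<ge> 0"
  shows "integral {a..a+\<tau>} f = integral {0..\<tau>} f"
proof -
  obtain F where F: "\<And>t. (F has_vector_derivative f t) (at t)"
    using antiderivative_exists assms(1) by blast
  have ftc: "integral {a..a+\<tau>} f = F (a + \<tau>) - F a" for a
    by (rule integral_unique, rule fundamental_theorem_of_calculus)
      (use F assms(3) in \<open>auto intro: has_vector_derivative_at_within\<close>)
  have "((\<lambda>a. F (a + \<tau>) - F a) has_vector_derivative 0) (at t)" for t
    using has_vector_derivative_diff[OF has_vector_derivative_shift[OF F, of \<tau> t] F[of t]] assms(2) by simp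
  then have "F (a + \<tau>) - F a = F (0 + \<tau>) - F 0"
    by (rule constant_if_vector_derivative_zero)
  then show ?thesis using ftc[of a] ftc[of 0] by simp
qed

lemma periodic_integer_shift:
  fixes f :: "real \<Rightarrow> 'a" and \<tau> :: real
  assumes "\<And>t. f (t + \<tau>) = f t"
  shows "f (t + of_int n * \<tau>) = f t"
proof -
  have nat: "f (t + of_nat n * \<tau>) = f t" for n :: nat and t
  proof (induction n)
    case (Suc n)
    have "f (t + of_nat (Suc n) * \<tau>) = f ((t + of_nat n * \<tau>) + \<tau>)" by (simp add: algebra_simps)
    with Suc assms show ?case by metis
  qed simp
  show ?thesis
  proof (cases "n \<ge> 0")
    case True
    then show ?thesis using nat[of t "nat n"] by simp
  next
    case False
    then show ?thesis using nat[of "t + of_int n * \<tau>" "nat (-n)"] by simp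
  qed
qed

lemma periodic_representative:
  fixes t \<tau> :: real
  assumes "\<tau> > 0"
  obtains n :: int where "t + of_int n * \<tau> \<in> {0..<\<tau>}"
proof -
  have "t + of_int (- \<lfloor>t / \<tau>\<rfloor>) * \<tau> \<in> {0..<\<tau>}"
    using assms floor_divide_lower[of \<tau> t] floor_divide_upper[of \<tau> t] by (auto simp: algebra_simps)
  then show thesis using that by blast
qed

text \<open>In the time s with ds = dt / \<rho> the function C = \<kappa> cot(\<kappa> s) solves the
  Riccati equation C' = - (\<kappa>^2 + C^2). Hence x'^2 - \<kappa>^2 x^2 = (x' - C x)^2 + (C x^2)',
  and dropping the square leaves the boundary terms. They are kept because loops near a collision do
  not vanish at the ends.\<close>

lemma weighted_wirtinger_boundary:
  fixes x x' \<rho> s :: "real \<Rightarrow> real"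
  assumes "a \<le> b"
    and x: "\<And>t. t \<in> {a..b} \<Longrightarrow> (x has_vector_derivative x' t) (at t within {a..b})"
    and x': "continuous_on {a..b} x'"
    and \<rho>: "continuous_on {a..b} \<rho>" "\<And>t. t \<in> {a..b} \<Longrightarrow> \<rho> t > 0"
    and s: "\<And>t. t \<in> {a..b} \<Longrightarrow> (s has_vector_derivative 1 / \<rho> t) (at t within {a..b})"
    and \<kappa>: "\<And>t. t \<in> {a..b} \<Longrightarrow> \<kappa> * s t \<in> {0<..<pi}"
  shows "integral {a..b} (\<lambda>t. \<rho> t * (x' t)\<^sup>2) \<ge> \<kappa>\<^sup>2 * integral {a..b} (\<lambda>t. (x t)\<^sup>2 / \<rho> t)
           + \<kappa> * cot (\<kappa> * s b) * (x b)\<^sup>2 - \<kappa> * cot (\<kappa> * s a) * (x a)\<^sup>2"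
proof -
  define C where "C t = \<kappa> * cot (\<kappa> * s t)" for t
  have sin: "sin (\<kappa> * s t) > 0" if "t \<in> {a..b}" for t
    using \<kappa>[OF that] by (auto intro: sin_gt_zero)
  have C: "(C has_real_derivative - (\<kappa>\<^sup>2 + (C t)\<^sup>2) / \<rho> t) (at t within {a..b})" if t: "t \<in> {a..b}" for t
  proof -
    have s': "(s has_real_derivative 1 / \<rho> t) (at t within {a..b})"
      using s[OF t] by (simp add: has_real_derivative_iff_has_vector_derivative)
    have "inverse ((sin (\<kappa> * s t))\<^sup>2) = 1 + (cot (\<kappa> * s t))\<^sup>2"
      using sin[OF t] sin_cos_squared_add[of "\<kappa> * s t"]
      by (simp add: cot_def field_simps power2_eq_square)
    then have e: "- (\<kappa>\<^sup>2 + (C t)\<^sup>2) / \<rho> t = \<kappa> * (- inverse ((sin (\<kappa> * s t))\<^sup>2) * (\<kappa> * (1 / \<rho> t)))"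
      using \<rho>(2)[OF t] by (simp add: C_def field_simps power2_eq_square)
    show ?thesis unfolding e unfolding C_def
      by (intro DERIV_cmult DERIV_chain2[of cot] DERIV_cot s') (use sin[OF t] in auto)
  qed
  define g where "g t = 2 * C t * x t * x' t - (\<kappa>\<^sup>2 + (C t)\<^sup>2) * (x t)\<^sup>2 / \<rho> t" for t
  have g: "((\<lambda>t. C t * (x t)\<^sup>2) has_vector_derivative g t) (at t within {a..b})" if t: "t \<in> {a..b}" for t
  proof -
    have "(x has_real_derivative x' t) (at t within {a..b})"
      using x[OF t] by (simp add: has_real_derivative_iff_has_vector_derivative)
    with C[OF t] have "((\<lambda>t. C t * (x t)\<^sup>2) has_real_derivative g t) (at t within {a..b})"
      unfolding g_def by (auto intro!: derivative_eq_intros simp: diff_divide_distrib add_divide_distrib algebra_simps)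
    then show ?thesis by (simp add: has_real_derivative_iff_has_vector_derivative)
  qed
  have cx: "continuous_on {a..b} x"
    unfolding continuous_on_eq_continuous_within using has_vector_derivative_continuous[OF x] by blast
  have cC: "continuous_on {a..b} C"
    unfolding continuous_on_eq_continuous_within using DERIV_continuous[OF C] by blast
  note ci = continuous_intros cx cC x' \<rho>(1)
  have G: "integral {a..b} g = C b * (x b)\<^sup>2 - C a * (x a)\<^sup>2"
    by (rule integral_unique, rule fundamental_theorem_of_calculus) (use g assms(1) in auto)
  have ig: "g integrable_on {a..b}"
    unfolding g_def by (intro integrable_continuous_real ci) (use \<rho>(2) in force)
  have iq: "(\<lambda>t. (x t)\<^sup>2 / \<rho> t) integrable_on {a..b}"
    by (intro integrable_continuous_real ci) (use \<rho>(2) in force)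
  have le: "\<kappa>\<^sup>2 * ((x t)\<^sup>2 / \<rho> t) + g t \<le> \<rho> t * (x' t)\<^sup>2" if "t \<in> {a..b}" for t
  proof -
    have "\<rho> t * (x' t)\<^sup>2 - (\<kappa>\<^sup>2 * ((x t)\<^sup>2 / \<rho> t) + g t) = (\<rho> t * x' t - C t * x t)\<^sup>2 / \<rho> t"
      using \<rho>(2)[OF that] by (simp add: g_def field_simps power2_eq_square)
    also have "\<dots> \<ge> 0" using \<rho>(2)[OF that] by simp
    finally show ?thesis by simp
  qed
  have "\<kappa>\<^sup>2 * integral {a..b} (\<lambda>t. (x t)\<^sup>2 / \<rho> t) + integral {a..b} g
        = integral {a..b} (\<lambda>t. \<kappa>\<^sup>2 * ((x t)\<^sup>2 / \<rho> t) + g t)"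
    by (simp only: integral_add[OF integrable_on_mult_right[OF iq] ig] integral_mult_right)
  also have "\<dots> \<le> integral {a..b} (\<lambda>t. \<rho> t * (x' t)\<^sup>2)"
    by (intro integral_le integrable_add ig integrable_on_mult_right iq integrable_continuous_real ci le)
  finally show ?thesis using G by (simp add: C_def)
qed

text \<open>With the sharp \<kappa> = pi / S the cotangent would have poles at the ends. The
  constant is therefore multiplied by z < 1 first, and z tends to 1 at the end.\<close>

lemma weighted_wirtinger:
  fixes x x' \<rho> :: "real \<Rightarrow> real"
  assumes "a < b"
    and x: "\<And>t. t \<in> {a..b} \<Longrightarrow> (x has_vector_derivative x' t) (at t within {a..b})"
    and x': "continuous_on {a..b} x'"
    and \<rho>: "continuous_on {a..b} \<rho>" "\<And>t. t \<in> {a..b} \<Longrightarrow> \<rho> t > 0"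
    and x0: "x a = 0" "x b = 0"
    and S: "S = integral {a..b} (\<lambda>t. 1 / \<rho> t)" "S > 0"
  shows "(pi / S)\<^sup>2 * integral {a..b} (\<lambda>t. (x t)\<^sup>2 / \<rho> t) \<le> integral {a..b} (\<lambda>t. \<rho> t * (x' t)\<^sup>2)"
proof (rule field_le_mult_one_interval)
  fix z :: real assume z: "0 < z" "z < 1"
  define \<kappa> where "\<kappa> = sqrt z * (pi / S)"
  have k: "\<kappa> > 0" "\<kappa> * S < pi" "\<kappa>\<^sup>2 = z * (pi / S)\<^sup>2"
    using z S(2) by (auto simp: \<kappa>_def power_mult_distrib power_divide)
  \<comment> \<open>The shift centres the range: \<kappa> s runs from \<kappa> \<sigma> to pi -
    \<kappa> \<sigma> and avoids both poles of the cotangent.\<close>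
  define \<sigma> where "\<sigma> = (pi / \<kappa> - S) / 2"
  have \<sigma>: "\<sigma> > 0" "\<kappa> * (S + \<sigma>) < pi" using k by (auto simp: \<sigma>_def field_simps)
  define s where "s t = integral {a..t} (\<lambda>t. 1 / \<rho> t) + \<sigma>" for t
  have c: "continuous_on {a..b} (\<lambda>t. 1 / \<rho> t)"
    by (intro continuous_intros \<rho>(1)) (use \<rho>(2) in force)
  have s: "(s has_vector_derivative 1 / \<rho> t) (at t within {a..b})" if "t \<in> {a..b}" for t
    unfolding s_def using integral_has_vector_derivative[OF c that]
      by (auto intro!: derivative_eq_intros)
  have sb: "0 \<le> integral {a..t} (\<lambda>t. 1 / \<rho> t)" "integral {a..t} (\<lambda>t. 1 / \<rho> t) \<le> S"
    if "t \<in> {a..b}" for t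
  proof -
    have i: "(\<lambda>t. 1 / \<rho> t) integrable_on {a..t}"
      using that by (intro integrable_continuous_real continuous_on_subset[OF c]) auto
    show "0 \<le> integral {a..t} (\<lambda>t. 1 / \<rho> t)"
      by (intro integral_nonneg i) (use \<rho>(2) that in \<open>force intro: less_imp_le\<close>)
    show "integral {a..t} (\<lambda>t. 1 / \<rho> t) \<le> S"
      unfolding S by (intro integral_subset_le i integrable_continuous_real c)
       (use \<rho>(2) that in \<open>force intro: less_imp_le\<close>)+
  qed
  have \<kappa>s: "\<kappa> * s t \<in> {0<..<pi}" if "t \<in> {a..b}" for t
  proof -
    have "0 < s t" "s t \<le> S + \<sigma>" using sb[OF that] \<sigma> by (auto simp: s_def)
    then have "0 < \<kappa> * s t" "\<kappa> * s t \<le> \<kappa> * (S + \<sigma>)" using k by auto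
    then show ?thesis using \<sigma> by auto
  qed
  have "\<kappa>\<^sup>2 * integral {a..b} (\<lambda>t. (x t)\<^sup>2 / \<rho> t) \<le> integral {a..b} (\<lambda>t. \<rho> t * (x' t)\<^sup>2)"
    using weighted_wirtinger_boundary[OF _ x x' \<rho> s \<kappa>s] assms(1) x0 by simp
  then show "z * ((pi / S)\<^sup>2 * integral {a..b} (\<lambda>t. (x t)\<^sup>2 / \<rho> t)) \<le> integral {a..b} (\<lambda>t. \<rho> t * (x' t)\<^sup>2)"
    using k(3) by (simp add: mult.assoc)
qed


lemma has_vector_derivative_imp_continuous_UNIV:
  fixes f :: "real \<Rightarrow> 'a::real_normed_vector"
  assumes "\<And>t. (f has_vector_derivative f' t) (at t)"
  shows "continuous_on S f"
  using has_vector_derivative_continuous[OF assms] by (simp add: continuous_at_imp_continuous_on)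

text \<open>An antiperiodic function changes sign, so it has a zero \<open>a\<close> and vanishes at
  both ends of \<open>{a..a+\<tau>}\<close>. The integrands are periodic, which moves the integrals
  back to \<open>{0..\<tau>}\<close>.\<close>

lemma antiperiodic_real_wirtinger:
  fixes x x' \<rho> :: "real \<Rightarrow> real"
  assumes \<tau>: "\<tau> > 0"
    and x: "\<And>t. (x has_vector_derivative x' t) (at t)" "continuous_on UNIV x'"
    and ax: "\<And>t. x (t + \<tau>) = - x t" "\<And>t. x' (t + \<tau>) = - x' t"
    and \<rho>: "continuous_on UNIV \<rho>" "\<And>t. \<rho> t > 0" "\<And>t. \<rho> (t + \<tau>) = \<rho> t"
    and S: "S = integral {0..\<tau>} (\<lambda>t. 1 / \<rho> t)" "S > 0"
  shows "(pi / S)\<^sup>2 * integral {0..\<tau>} (\<lambda>t. (x t)\<^sup>2 / \<rho> t) \<le> integral {0..\<tau>} (\<lambda>t. \<rho> t * (x' t)\<^sup>2)"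
proof -
  have cx: "continuous_on A x" for A by (rule has_vector_derivative_imp_continuous_UNIV[OF x(1)])
  have "\<exists>a. 0 \<le> a \<and> a \<le> \<tau> \<and> x a = 0"
  proof (cases "x 0 \<le> 0")
    case True
    then show ?thesis using IVT'[of x 0 0 \<tau>] ax(1)[of 0] \<tau> cx by simp
  next
    case False
    then show ?thesis using IVT2'[of x \<tau> 0 0] ax(1)[of 0] \<tau> cx by simp
  qed
  then obtain a where a: "x a = 0" by blast
  have \<rho>0: "\<rho> t \<noteq> 0" for t using \<rho>(2)[of t] by simp
  have sh: "integral {a..a+\<tau>} f = integral {0..\<tau>} f"
    if "continuous_on UNIV f" "\<And>t. f (t + \<tau>) = f t" for f :: "real \<Rightarrow> real"
    using integral_period_shift[OF that] \<tau> by simp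
  have "(pi / S)\<^sup>2 * integral {a..a+\<tau>} (\<lambda>t. (x t)\<^sup>2 / \<rho> t) \<le> integral {a..a+\<tau>} (\<lambda>t. \<rho> t * (x' t)\<^sup>2)"
  proof (rule weighted_wirtinger)
    show "S = integral {a..a+\<tau>} (\<lambda>t. 1 / \<rho> t)"
      unfolding S(1) by (rule sh[symmetric]) (auto intro!: continuous_intros \<rho>(1) simp: \<rho>0 \<rho>(3))
  qed (use \<tau> a ax(1)[of a] \<rho>(2) S(2) in
        \<open>auto intro: has_vector_derivative_at_within x(1) continuous_on_subset[OF x(2)] continuous_on_subset[OF \<rho>(1)]\<close>)
  moreover have "integral {a..a+\<tau>} (\<lambda>t. (x t)\<^sup>2 / \<rho> t) = integral {0..\<tau>} (\<lambda>t. (x t)\<^sup>2 / \<rho> t)"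
    by (rule sh) (auto intro!: continuous_intros \<rho>(1) cx simp: \<rho>0 \<rho>(3) ax)
  moreover have "integral {a..a+\<tau>} (\<lambda>t. \<rho> t * (x' t)\<^sup>2) = integral {0..\<tau>} (\<lambda>t. \<rho> t * (x' t)\<^sup>2)"
    by (rule sh) (auto intro!: continuous_intros \<rho>(1) x(2) simp: \<rho>0 \<rho>(3) ax)
  ultimately show ?thesis by simp
qed

text \<open>The two coordinates of \<open>z\<close> vanish at different times in general, so each
  one is treated on its own interval of length \<tau>.\<close>

lemma antiperiodic_wirtinger:
  fixes z z' :: "real \<Rightarrow> complex" and \<rho> :: "real \<Rightarrow> real"
  assumes \<tau>: "\<tau> > 0"
    and z: "\<And>t. (z has_vector_derivative z' t) (at t)" "continuous_on UNIV z'"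
    and az: "\<And>t. z (t + \<tau>) = - z t" "\<And>t. z' (t + \<tau>) = - z' t"
    and \<rho>: "continuous_on UNIV \<rho>" "\<And>t. \<rho> t > 0" "\<And>t. \<rho> (t + \<tau>) = \<rho> t"
    and S: "S = integral {0..\<tau>} (\<lambda>t. 1 / \<rho> t)" "S > 0"
  shows "(pi / S)\<^sup>2 * integral {0..\<tau>} (\<lambda>t. (cmod (z t))\<^sup>2 / \<rho> t) \<le> integral {0..\<tau>} (\<lambda>t. \<rho> t * (cmod (z' t))\<^sup>2)"
proof -
  have \<rho>0: "\<rho> t \<noteq> 0" for t using \<rho>(2)[of t] by simp
  have cz: "continuous_on UNIV z" by (rule has_vector_derivative_imp_continuous_UNIV[OF z(1)])
  have *: "(\<lambda>t. (f t)\<^sup>2 / \<rho> t) integrable_on {0..\<tau>}" "(\<lambda>t. \<rho> t * (f t)\<^sup>2) integrable_on {0..\<tau>}"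
    if "continuous_on UNIV f" for f :: "real \<Rightarrow> real"
    by (intro integrable_continuous_real continuous_intros continuous_on_subset[OF that]
        continuous_on_subset[OF \<rho>(1)]; simp add: \<rho>0)+
  have re: "(pi / S)\<^sup>2 * integral {0..\<tau>} (\<lambda>t. (Re (z t))\<^sup>2 / \<rho> t) \<le> integral {0..\<tau>} (\<lambda>t. \<rho> t * (Re (z' t))\<^sup>2)"
    by (rule antiperiodic_real_wirtinger[OF \<tau> _ _ _ _ \<rho> S])
      (auto intro!: bounded_linear.has_vector_derivative[OF bounded_linear_Re] continuous_intros z simp: az)
  have im: "(pi / S)\<^sup>2 * integral {0..\<tau>} (\<lambda>t. (Im (z t))\<^sup>2 / \<rho> t) \<le> integral {0..\<tau>} (\<lambda>t. \<rho> t * (Im (z' t))\<^sup>2)"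
    by (rule antiperiodic_real_wirtinger[OF \<tau> _ _ _ _ \<rho> S])
      (auto intro!: bounded_linear.has_vector_derivative[OF bounded_linear_Im] continuous_intros z simp: az)
  have "integral {0..\<tau>} (\<lambda>t. (cmod (z t))\<^sup>2 / \<rho> t)
      = integral {0..\<tau>} (\<lambda>t. (Re (z t))\<^sup>2 / \<rho> t) + integral {0..\<tau>} (\<lambda>t. (Im (z t))\<^sup>2 / \<rho> t)"
    by (subst integral_add[symmetric])
      (auto intro!: * continuous_intros cz simp: cmod_power2 add_divide_distrib)
  moreover have "integral {0..\<tau>} (\<lambda>t. \<rho> t * (cmod (z' t))\<^sup>2)
      = integral {0..\<tau>} (\<lambda>t. \<rho> t * (Re (z' t))\<^sup>2) + integral {0..\<tau>} (\<lambda>t. \<rho> t * (Im (z' t))\<^sup>2)"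
    by (subst integral_add[symmetric])
      (auto intro!: * continuous_intros z simp: cmod_power2 distrib_left)
  ultimately show ?thesis using re im by (simp add: distrib_left)
qed

lemma antiperiodic_antiderivative_exists:
  fixes f :: "real \<Rightarrow> 'a::euclidean_space"
  assumes "continuous_on UNIV f" "\<And>t. f (t + \<tau>) = - f t"
  obtains F where "\<And>t. (F has_vector_derivative f t) (at t)" "\<And>t. F (t + \<tau>) = - F t"
proof -
  obtain F where F: "\<And>t. (F has_vector_derivative f t) (at t)"
    using antiderivative_exists assms(1) by blast
  have "((\<lambda>t. F (t + \<tau>) + F t) has_vector_derivative 0) (at t)" for t
    using has_vector_derivative_add[OF has_vector_derivative_shift[OF F, of \<tau> t] F[of t]] assms(2) by simp
  then have c: "F (t + \<tau>) + F t = F (0 + \<tau>) + F 0" for t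
    by (rule constant_if_vector_derivative_zero)
  \<comment> \<open>Half of the constant F(t + \<tau>) + F(t) is the one shift that makes F
    antiperiodic.\<close>
  define c where "c = (1/2) *\<^sub>R (F (0 + \<tau>) + F 0)"
  have "c + c = F (0 + \<tau>) + F 0" unfolding c_def by (simp flip: scaleR_left.add)
  with c have Fc: "F (t + \<tau>) + F t = c + c" for t by metis
  define H where "H t = F t - c" for t
  have "H (t + \<tau>) = - H t" for t
    using Fc[of t] unfolding H_def by (simp add: algebra_simps add_eq_0_iff eq_diff_eq)
  moreover have "(H has_vector_derivative f t) (at t)" for t
    unfolding H_def using F[of t] by (auto intro!: derivative_eq_intros)
  ultimately show thesis using that by blast
qed

lemma continuous_nonneg_periodic_integral_zero:
  fixes f :: "real \<Rightarrow> real"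
  assumes "\<tau> > 0" "continuous_on UNIV f" "\<And>t. f (t + \<tau>) = f t" "\<And>t. f t \<ge> 0" "integral {0..\<tau>} f = 0"
  shows "f t = 0"
proof -
  have "integral {t..t+\<tau>} f = 0"
    using integral_period_shift[OF assms(2,3)] assms(1,5) by simp
  then show ?thesis
    using integral_eq_0_iff[of t "t+\<tau>" f] assms continuous_on_subset[OF assms(2)] by auto
qed

text \<open>Du Bois-Reymond: the first variation of the nonnegative quadratic form vanishes at \<open>z\<close>; it is
  tested with the antiperiodic \<open>y\<close> whose derivative is \<open>\<rho> z' + H\<close>, where \<open>H' = \<kappa>\<^sup>2 z / \<rho>\<close>.\<close>
lemma antiperiodic_wirtinger_equality:
  fixes z z' :: "real \<Rightarrow> complex" and \<rho> :: "real \<Rightarrow> real"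
  assumes \<tau>: "\<tau> > 0"
    and z: "\<And>t. (z has_vector_derivative z' t) (at t)" "continuous_on UNIV z'"
    and az: "\<And>t. z (t + \<tau>) = - z t" "\<And>t. z' (t + \<tau>) = - z' t"
    and \<rho>: "continuous_on UNIV \<rho>" "\<And>t. \<rho> t > 0" "\<And>t. \<rho> (t + \<tau>) = \<rho> t"
    and S: "S = integral {0..\<tau>} (\<lambda>t. 1 / \<rho> t)" "S > 0"
    and eq: "integral {0..\<tau>} (\<lambda>t. \<rho> t * (cmod (z' t))\<^sup>2) = (pi / S)\<^sup>2 * integral {0..\<tau>} (\<lambda>t. (cmod (z t))\<^sup>2 / \<rho> t)"
  shows "((\<lambda>t. \<rho> t *\<^sub>R z' t) has_vector_derivative - ((pi / S)\<^sup>2 / \<rho> t) *\<^sub>R z t) (at t)"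
proof -
  define \<kappa> where "\<kappa> = pi / S"
  have \<rho>0: "\<rho> t \<noteq> 0" for t using \<rho>(2)[of t] by simp
  have cz: "continuous_on UNIV z" by (rule has_vector_derivative_imp_continuous_UNIV[OF z(1)])
  note ci = continuous_intros cz z(2) \<rho>(1)
  obtain H where H: "\<And>t. (H has_vector_derivative (\<kappa>\<^sup>2 / \<rho> t) *\<^sub>R z t) (at t)" "\<And>t. H (t + \<tau>) = - H t"
    by (rule antiperiodic_antiderivative_exists[of "\<lambda>t. (\<kappa>\<^sup>2 / \<rho> t) *\<^sub>R z t" \<tau>])
      (auto intro!: ci simp: \<rho>0 \<rho>(3) az)
  have cH: "continuous_on UNIV H" by (rule has_vector_derivative_imp_continuous_UNIV[OF H(1)])
  define G where "G t = \<rho> t *\<^sub>R z' t + H t" for t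
  have cG: "continuous_on UNIV G" unfolding G_def by (intro ci cH)
  have aG: "G (t + \<tau>) = - G t" for t by (simp add: G_def H(2) az \<rho>(3))
  obtain y where y: "\<And>t. (y has_vector_derivative G t) (at t)" "\<And>t. y (t + \<tau>) = - y t"
    using antiperiodic_antiderivative_exists[OF cG aG] by blast
  have cy: "continuous_on UNIV y" by (rule has_vector_derivative_imp_continuous_UNIV[OF y(1)])
  have int: "f integrable_on {0..\<tau>}" if "continuous_on UNIV f" for f :: "real \<Rightarrow> real"
    by (intro integrable_continuous_real continuous_on_subset[OF that]) simp
  define A where "A t = \<rho> t * (z' t \<bullet> G t) - \<kappa>\<^sup>2 * ((z t \<bullet> y t) / \<rho> t)" for t
  define Q where "Q t = \<rho> t * (cmod (G t))\<^sup>2 - \<kappa>\<^sup>2 * ((cmod (y t))\<^sup>2 / \<rho> t)" for t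
  define P where "P t = \<rho> t * (cmod (z' t))\<^sup>2 - \<kappa>\<^sup>2 * ((cmod (z t))\<^sup>2 / \<rho> t)" for t
  have cA: "continuous_on UNIV A" unfolding A_def by (intro ci cG cy) (simp add: \<rho>0)
  have cQ: "continuous_on UNIV Q" unfolding Q_def by (intro ci cG cy) (simp add: \<rho>0)
  have cP: "continuous_on UNIV P" unfolding P_def by (intro ci) (simp add: \<rho>0)
  have split: "integral {0..\<tau>} (\<lambda>t. \<rho> t * (cmod (v t))\<^sup>2 - \<kappa>\<^sup>2 * ((cmod (w t))\<^sup>2 / \<rho> t))
     = integral {0..\<tau>} (\<lambda>t. \<rho> t * (cmod (v t))\<^sup>2) - \<kappa>\<^sup>2 * integral {0..\<tau>} (\<lambda>t. (cmod (w t))\<^sup>2 / \<rho> t)"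
    if "continuous_on UNIV v" "continuous_on UNIV w" for v w :: "real \<Rightarrow> complex"
    using that by (subst integral_diff) (auto intro!: int continuous_intros \<rho>(1) simp: \<rho>0 simp del: times_divide_eq_right)
  have P0: "integral {0..\<tau>} P = 0"
    unfolding P_def split[OF z(2) cz] using eq by (simp add: \<kappa>_def)
  have var: "0 \<le> 2 * \<epsilon> * integral {0..\<tau>} A + \<epsilon>\<^sup>2 * integral {0..\<tau>} Q" for \<epsilon> :: real
  proof -
    define Z where "Z t = z t + \<epsilon> *\<^sub>R y t" for t
    define Z' where "Z' t = z' t + \<epsilon> *\<^sub>R G t" for t
    have c: "continuous_on UNIV Z" "continuous_on UNIV Z'"
      unfolding Z_def Z'_def by (intro ci cG cy)+
    have zd: "(Z has_vector_derivative Z' t) (at t)" for t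
      unfolding Z_def Z'_def using z(1)[of t] y(1)[of t] by (auto intro!: derivative_eq_intros)
    have aZ: "Z (t + \<tau>) = - Z t" "Z' (t + \<tau>) = - Z' t" for t
      by (simp_all add: Z_def Z'_def az y aG)
    have "0 \<le> integral {0..\<tau>} (\<lambda>t. \<rho> t * (cmod (Z' t))\<^sup>2 - \<kappa>\<^sup>2 * ((cmod (Z t))\<^sup>2 / \<rho> t))"
      unfolding split[OF c(2,1)] using antiperiodic_wirtinger[OF \<tau> zd c(2) aZ \<rho> S]
      by (simp add: \<kappa>_def)
    also have "(\<lambda>t. \<rho> t * (cmod (Z' t))\<^sup>2 - \<kappa>\<^sup>2 * ((cmod (Z t))\<^sup>2 / \<rho> t))
        = (\<lambda>t. P t + (2 * \<epsilon> * A t + \<epsilon>\<^sup>2 * Q t))"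
      unfolding P_def Q_def A_def Z_def Z'_def power2_norm_eq_inner
      by (rule ext) (use \<rho>0 in \<open>simp add: inner_add_left inner_add_right inner_commute field_simps power2_eq_square\<close>)
    also have "integral {0..\<tau>} \<dots> = 2 * \<epsilon> * integral {0..\<tau>} A + \<epsilon>\<^sup>2 * integral {0..\<tau>} Q"
      by (simp add: integral_add int cP cA cQ continuous_intros P0)
    finally show ?thesis .
  qed
  \<comment> \<open>A quadratic polynomial in \<epsilon> without constant term stays nonnegative
    only if its linear coefficient vanishes. The witness - a / q uses a q above the modulus of the
    quadratic coefficient.\<close>
  have A0: "integral {0..\<tau>} A = 0"
  proof (rule ccontr)
    assume ne: "integral {0..\<tau>} A \<noteq> 0"
    define a where "a = integral {0..\<tau>} A"
    define q where "q = \<bar>integral {0..\<tau>} Q\<bar> + 1"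
    have q: "q > 0" by (simp add: q_def)
    have "0 \<le> 2 * (- a / q) * a + (- a / q)\<^sup>2 * integral {0..\<tau>} Q"
      using var[of "- a / q"] by (simp add: a_def)
    also have "\<dots> \<le> 2 * (- a / q) * a + (- a / q)\<^sup>2 * q"
      by (intro add_left_mono mult_left_mono) (auto simp: q_def)
    also have "\<dots> = - a\<^sup>2 / q" using q by (simp add: field_simps power2_eq_square)
    also have "\<dots> < 0" using ne q by (simp add: a_def)
    finally show False by simp
  qed
  \<comment> \<open>This integrand is the derivative of the periodic inner product of H and y, so it
    integrates to zero; adding it turns A into |G|^2.\<close>
  have "integral {0..\<tau>} (\<lambda>t. H t \<bullet> G t + ((\<kappa>\<^sup>2 / \<rho> t) *\<^sub>R z t) \<bullet> y t) = H \<tau> \<bullet> y \<tau> - H 0 \<bullet> y 0"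
    by (rule integral_unique, rule fundamental_theorem_of_calculus)
      (use \<tau> has_vector_derivative_at_within[OF has_vector_derivative_inner[OF H(1) y(1)]] in auto)
  also have "\<dots> = 0" using H(2)[of 0] y(2)[of 0] by simp
  finally have "integral {0..\<tau>} (\<lambda>t. A t + (H t \<bullet> G t + ((\<kappa>\<^sup>2 / \<rho> t) *\<^sub>R z t) \<bullet> y t)) = 0"
    using A0 by (subst integral_add) (auto intro!: int ci cA cH cG cy simp: \<rho>0)
  also have "(\<lambda>t. A t + (H t \<bullet> G t + ((\<kappa>\<^sup>2 / \<rho> t) *\<^sub>R z t) \<bullet> y t)) = (\<lambda>t. G t \<bullet> G t)"
    by (simp add: A_def G_def fun_eq_iff inner_add_left inner_add_right algebra_simps)
  finally have "G t \<bullet> G t = 0" for t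
    by (intro continuous_nonneg_periodic_integral_zero[OF \<tau>, of "\<lambda>t. G t \<bullet> G t"])
      (auto intro!: ci cG simp: aG)
  then have "\<rho> t *\<^sub>R z' t = - H t" for t by (simp add: G_def add_eq_0_iff2)
  then show ?thesis using has_vector_derivative_minus[OF H(1)[of t]] by (simp add: \<kappa>_def)
qed

section \<open>Gordon's inequality for regular loops\<close>


lemma ind0_exp:
  assumes g: "continuous_on UNIV g" and u: "\<And>t. u t = exp (g t)"
  shows "ind0 \<tau> u = (g \<tau> - g 0) / (2 * of_real pi * \<i>)"
proof -
  have "path (\<lambda>s. g (\<tau> * s))" unfolding path_def
    by (intro continuous_on_compose2[OF g]) (auto intro!: continuous_intros)
  from winding_number_compose_exp[OF this] show ?thesis
    by (simp add: ind0_def o_def u pathfinish_def pathstart_def)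
qed

lemma continuous_logarithm_real:
  fixes u :: "real \<Rightarrow> complex"
  assumes "continuous_on UNIV u" "\<And>t. u t \<noteq> 0"
  obtains g where "continuous_on UNIV g" "\<And>t. u t = exp (g t)"
  using continuous_logarithm_on_contractible[OF assms(1)] assms(2) by (metis UNIV_I contractible_UNIV)

text \<open>With a continuous logarithm g of u the root is exp(g / 2). From any starting time g
  grows by 2 pi i k over a period, so the root is multiplied by exp(i pi k), which is -1 for odd
  k.\<close>

lemma antiperiodic_sqrt:
  fixes u :: "real \<Rightarrow> complex"
  assumes u: "continuous_on UNIV u" "\<And>t. u t \<noteq> 0" "\<And>t. u (t + \<tau>) = u t"
    and k: "ind0 \<tau> u = of_int k" "odd k"
  obtains z where "continuous_on UNIV z" "\<And>t. (z t)\<^sup>2 = u t" "\<And>t. z (t + \<tau>) = - z t"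
proof -
  obtain g where g: "continuous_on UNIV g" "\<And>t. u t = exp (g t)"
    using continuous_logarithm_real u by blast
  define h where "h t = (g (t + \<tau>) - g t) / (2 * of_real pi * \<i>)" for t
  have ch: "continuous_on UNIV h" unfolding h_def
    by (intro continuous_intros g(1) continuous_on_compose2[OF g(1)]) auto
  have "h t \<in> \<int>" for t
  proof -
    have "exp (g (t + \<tau>)) = exp (g t)" using u(3)[of t] g(2) by simp
    then obtain n :: int where "g (t + \<tau>) = g t + (of_int (2 * n) * pi) * \<i>"
      unfolding exp_eq by blast
    then have "h t = of_int n" by (simp add: h_def field_simps)
    then show ?thesis by simp
  qed
  \<comment> \<open>Values in the integers that differ are at least 1 apart, so the continuous
    \<open>h\<close> is constant; at 0 it is the winding number.\<close>
  then have "1 \<le> cmod (h t - h s)" if "h t \<noteq> h s" for s t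
    using that by (metis Ints_cases Ints_diff Ints_nonzero_abs_ge1 Ints_of_int norm_of_int of_int_0 of_int_eq_iff
        right_minus_eq)
  then have "h constant_on UNIV"
    by (intro continuous_discrete_range_constant[OF _ ch]) (auto intro!: exI[of _ 1])
  moreover have "h 0 = of_int k"
    using ind0_exp[OF g, of \<tau>] k(1) by (simp add: h_def)
  ultimately have hk: "h t = of_int k" for t by (auto simp: constant_on_def)
  define z where "z t = exp (g t / 2)" for t
  have "z (t + \<tau>) = - z t" for t
  proof -
    have "g (t + \<tau>) = g t + of_int k * (2 * of_real pi * \<i>)"
      using hk[of t] by (simp add: h_def field_simps)
    then have "z (t + \<tau>) = z t * exp (of_int k * (of_real pi * \<i>))"
      by (simp add: z_def add_divide_distrib exp_add)
    also have "exp (of_int k * (of_real pi * \<i>)) = -1"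
    proof -
      obtain n where "k = 2 * n + 1" using k(2) by (elim oddE)
      then show ?thesis using exp_integer_2pi_plus1[of "of_int n"] by (simp add: mult_ac)
    qed
    finally show ?thesis by simp
  qed
  moreover have "(z t)\<^sup>2 = u t" for t
    by (simp add: z_def g(2) flip: exp_double)
  moreover have "continuous_on UNIV z" unfolding z_def by (intro continuous_intros g(1)) simp
  ultimately show thesis using that by blast
qed

lemma has_vector_derivative_iff_quotient:
  fixes f :: "real \<Rightarrow> 'a::real_normed_vector"
  shows "(f has_vector_derivative f') (at t) \<longleftrightarrow> ((\<lambda>y. (f y - f t) /\<^sub>R (y - t)) \<longlongrightarrow> f') (at t)"
proof -
  have "norm (f y - f t - (y - t) *\<^sub>R f') / norm (y - t) = norm ((f y - f t) /\<^sub>R (y - t) - f')" if "y \<noteq> t" for y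
  proof -
    have "(f y - f t) /\<^sub>R (y - t) - f' = (f y - f t - (y - t) *\<^sub>R f') /\<^sub>R (y - t)"
      using that by (simp add: scaleR_diff_right)
    then show ?thesis by (simp add: divide_inverse mult.commute)
  qed
  then have "((\<lambda>y. norm (f y - f t - (y - t) *\<^sub>R f') / norm (y - t)) \<longlongrightarrow> 0) (at t)
      \<longleftrightarrow> ((\<lambda>y. norm ((f y - f t) /\<^sub>R (y - t) - f')) \<longlongrightarrow> 0) (at t)"
    by (intro filterlim_cong) (auto simp: eventually_at_filter)
  then show ?thesis
    by (simp add: has_vector_derivative_def has_derivative_iff_norm bounded_linear_scaleR_left
        tendsto_norm_zero_iff LIM_zero_iff)
qed

text \<open>Continuity of z is enough: the difference of two values of u is the difference of the
  values of z times their sum, and the sum tends to 2 z(t), which is nonzero.\<close>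

lemma has_vector_derivative_sqrt:
  fixes z u :: "real \<Rightarrow> complex"
  assumes z: "continuous_on UNIV z" "\<And>t. (z t)\<^sup>2 = u t" and nz: "z t \<noteq> 0"
    and u: "(u has_vector_derivative u') (at t)"
  shows "(z has_vector_derivative u' / (2 * z t)) (at t)"
proof -
  have iz: "z \<midarrow>t\<rightarrow> z t" using z(1) by (simp add: continuous_on_eq_continuous_at isCont_def)
  have "((\<lambda>y. (u y - u t) /\<^sub>R (y - t)) \<longlongrightarrow> u') (at t)"
    using u by (simp add: has_vector_derivative_iff_quotient)
  then have "((\<lambda>y. ((u y - u t) /\<^sub>R (y - t)) / (z y + z t)) \<longlongrightarrow> u' / (z t + z t)) (at t)"
    by (intro tendsto_intros iz) (use nz in auto)
  moreover have "eventually (\<lambda>y. z y + z t \<noteq> 0) (at t)"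
    by (rule tendsto_imp_eventually_ne[OF tendsto_add[OF iz tendsto_const]]) (use nz in auto)
  then have "eventually (\<lambda>y. ((u y - u t) /\<^sub>R (y - t)) / (z y + z t) = (z y - z t) /\<^sub>R (y - t)) (at t)"
  proof eventually_elim
    case (elim y)
    have "u y - u t = (z y - z t) * (z y + z t)"
      by (simp add: power2_eq_square algebra_simps flip: z(2))
    then show ?case using elim by (simp add: scaleR_conv_of_real)
  qed
  ultimately have "((\<lambda>y. (z y - z t) /\<^sub>R (y - t)) \<longlongrightarrow> u' / (z t + z t)) (at t)"
    by (rule Lim_transform_eventually)
  then show ?thesis by (simp add: has_vector_derivative_iff_quotient flip: mult_2)
qed

section \<open>Minimising the two-term lower bound, and Gordon's inequality\<close>

text \<open>The minimum over S > 0 of 2 pi^2 \<tau> / S^2 + \<delta> S, written in the shape of the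
  constant of the theorem.\<close>

definition gordon_bound :: "real \<Rightarrow> real \<Rightarrow> real" where
  "gordon_bound \<tau> \<delta> = \<delta> powr (2/3) * 3 * 2 powr (-1/3) * pi powr (2/3) * \<tau> powr (1/3)"

text \<open>The minimum is attained at the p with \<delta> p^3 = 4 pi^2 \<tau> and equals (3/2)
  \<delta> p. The distance to it has a double zero at S = p and no other positive zero, which gives
  the inequality and its equality case together.\<close>

lemma gordon_bound_le:
  fixes S :: real
  assumes "\<tau> > 0" "\<delta> > 0" "S > 0"
  shows "gordon_bound \<tau> \<delta> \<le> 2 * pi\<^sup>2 * \<tau> / S\<^sup>2 + \<delta> * S"
    and "2 * pi\<^sup>2 * \<tau> / S\<^sup>2 + \<delta> * S = gordon_bound \<tau> \<delta> \<longleftrightarrow> \<delta> * S ^ 3 = 4 * pi\<^sup>2 * \<tau>"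
proof -
  define p where "p = (4 * pi\<^sup>2 * \<tau> / \<delta>) powr (1/3)"
  have p: "p > 0" using assms by (simp add: p_def)
  have p3: "\<delta> * p ^ 3 = 4 * pi\<^sup>2 * \<tau>"
  proof -
    have "p ^ 3 = p powr 3" using p by simp
    also have "\<dots> = 4 * pi\<^sup>2 * \<tau> / \<delta>" using assms by (simp add: p_def powr_powr)
    finally show ?thesis using assms by simp
  qed
  \<comment> \<open>Cubing removes the fractional powers; both sides are nonnegative.\<close>
  have "gordon_bound \<tau> \<delta> = (3/2) * \<delta> * p"
  proof (rule power_eq_imp_eq_base[of _ 3])
    have cube: "(x powr (a/3)) ^ 3 = x powr a" if "x > 0" for x a :: real
    proof -
      have "(x powr (a/3)) ^ 3 = (x powr (a/3)) powr 3" using that by simp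
      also have "\<dots> = x powr a" using that by (simp add: powr_powr)
      finally show ?thesis .
    qed
    have "(gordon_bound \<tau> \<delta>) ^ 3 = \<delta>\<^sup>2 * 27 * (1/2) * pi\<^sup>2 * \<tau>"
    proof -
      have "((2::real) powr (-1/3)) ^ 3 = 2 powr (-1)" by (rule cube) simp
      then have "((2::real) powr (-1/3)) ^ 3 = 1/2" by (simp only: powr_minus_divide) simp
      moreover have "(\<delta> powr (2/3)) ^ 3 = \<delta>\<^sup>2" "(pi powr (2/3)) ^ 3 = pi\<^sup>2" "(\<tau> powr (1/3)) ^ 3 = \<tau>"
        using assms cube[of \<delta> 2] cube[of pi 2] cube[of \<tau> 1] by auto
      ultimately show ?thesis by (simp only: gordon_bound_def power_mult_distrib) simp
    qed
    also have "\<dots> = ((3/2) * \<delta> * p) ^ 3"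
      using p3 by (simp add: power_mult_distrib power3_eq_cube power2_eq_square)
    finally show "(gordon_bound \<tau> \<delta>) ^ 3 = ((3/2) * \<delta> * p) ^ 3" .
  qed (use assms p in \<open>auto simp: gordon_bound_def\<close>)
  moreover have "2 * pi\<^sup>2 * \<tau> / S\<^sup>2 + \<delta> * S - (3/2) * \<delta> * p = \<delta> / (2 * S\<^sup>2) * ((p - S)\<^sup>2 * (p + 2 * S))"
  proof -
    have "2 * pi\<^sup>2 * \<tau> = \<delta> * p ^ 3 / 2" using p3 by simp
    then show ?thesis using assms by (simp add: field_simps power2_eq_square power3_eq_cube)
  qed
  ultimately have diff: "2 * pi\<^sup>2 * \<tau> / S\<^sup>2 + \<delta> * S - gordon_bound \<tau> \<delta> = \<delta> / (2 * S\<^sup>2) * ((p - S)\<^sup>2 * (p + 2 * S))"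
    by simp
  have "\<delta> / (2 * S\<^sup>2) * ((p - S)\<^sup>2 * (p + 2 * S)) \<ge> 0"
    using assms p by (intro mult_nonneg_nonneg) auto
  then show "gordon_bound \<tau> \<delta> \<le> 2 * pi\<^sup>2 * \<tau> / S\<^sup>2 + \<delta> * S" using diff by simp
  have "2 * pi\<^sup>2 * \<tau> / S\<^sup>2 + \<delta> * S = gordon_bound \<tau> \<delta> \<longleftrightarrow> p = S"
    using diff assms p by auto
  also have "\<dots> \<longleftrightarrow> \<delta> * S ^ 3 = \<delta> * p ^ 3"
    using assms p power_eq_iff_eq_base[of 3 S p] by auto
  finally show "2 * pi\<^sup>2 * \<tau> / S\<^sup>2 + \<delta> * S = gordon_bound \<tau> \<delta> \<longleftrightarrow> \<delta> * S ^ 3 = 4 * pi\<^sup>2 * \<tau>"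
    by (simp add: p3)
qed

locale plane_loop =
  fixes \<tau> :: real and u u' :: "real \<Rightarrow> complex"
  assumes tau: "\<tau> > 0"
    and deriv: "(u has_vector_derivative u' t) (at t)"
    and cont': "continuous_on UNIV u'"
    and per: "u (t + \<tau>) = u t"
    and nz: "u t \<noteq> 0"
begin

definition kin :: real where "kin = integral {0..\<tau>} (\<lambda>t. (cmod (u' t))\<^sup>2 / 2)"
text \<open>The length of a period in the regularised time, not the arc length of the curve. Times
  \<delta> it is the potential part of the Kepler action.\<close>

definition len :: real where "len = integral {0..\<tau>} (\<lambda>t. 1 / cmod (u t))"

lemma cont: "continuous_on S u"
  by (rule has_vector_derivative_imp_continuous_UNIV[OF deriv])

lemma per': "u' (t + \<tau>) = u' t"
proof -
  have "((\<lambda>t. u (t + \<tau>)) has_vector_derivative u' (t + \<tau>)) (at t)"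
    by (rule has_vector_derivative_shift[OF deriv])
  then show ?thesis using deriv[of t] by (simp add: per vector_derivative_unique_at)
qed

lemma len_pos: "len > 0"
proof -
  have c: "continuous_on {0..\<tau>} (\<lambda>t. 1 / cmod (u t))"
    by (intro continuous_intros cont) (simp add: nz)
  have "len \<noteq> 0"
    unfolding len_def using integral_eq_0_iff[OF c] tau nz by auto
  moreover have "len \<ge> 0" unfolding len_def
    by (intro integral_nonneg integrable_continuous_real c) auto
  ultimately show ?thesis by simp
qed

context
  fixes z :: "real \<Rightarrow> complex"
  assumes z: "continuous_on UNIV z" "\<And>t. (z t)\<^sup>2 = u t" "\<And>t. z (t + \<tau>) = - z t"
begin

lemma z_nz: "z t \<noteq> 0"
  using nz[of t] z(2)[of t] by auto

lemma z_deriv: "(z has_vector_derivative u' t / (2 * z t)) (at t)"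
  by (rule has_vector_derivative_sqrt[OF z(1,2) z_nz deriv])

lemma norm_z: "(cmod (z t))\<^sup>2 = cmod (u t)"
  by (simp flip: z(2) add: norm_power)

text \<open>For \<rho> = |u| = |z|^2 the weighted integrand |z|^2 / \<rho> is 1 and \<rho> |z'|^2 is
  |u'|^2 / 4, so the two sides of Wirtinger's inequality become (pi / len)^2 \<tau> and half of
  \<open>kin\<close>.\<close>

lemma lift_wirtinger:
  "2 * pi\<^sup>2 * \<tau> / len\<^sup>2 \<le> kin"
  "kin = 2 * pi\<^sup>2 * \<tau> / len\<^sup>2 \<Longrightarrow>
    ((\<lambda>t. cmod (u t) *\<^sub>R (u' t / (2 * z t))) has_vector_derivative - ((pi / len)\<^sup>2 / cmod (u t)) *\<^sub>R z t) (at t)"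
proof -
  let ?z' = "\<lambda>t. u' t / (2 * z t)"
  have c: "continuous_on UNIV ?z'" by (intro continuous_intros cont' z(1)) (simp add: z_nz)
  have a: "z (t + \<tau>) = - z t" "?z' (t + \<tau>) = - ?z' t" for t by (simp_all add: z(3) per')
  have \<rho>: "continuous_on UNIV (\<lambda>t. cmod (u t))" "cmod (u t) > 0" "cmod (u (t + \<tau>)) = cmod (u t)" for t
    by (auto intro!: continuous_intros cont simp: nz per)
  have L: "integral {0..\<tau>} (\<lambda>t. (cmod (z t))\<^sup>2 / cmod (u t)) = \<tau>"
    using tau by (simp add: norm_z nz)
  have "cmod (u t) * (cmod (?z' t))\<^sup>2 = (1/2) * ((cmod (u' t))\<^sup>2 / 2)" for t
    using nz[of t] by (simp add: norm_divide norm_mult power_divide power_mult_distrib norm_z)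
  then have R: "integral {0..\<tau>} (\<lambda>t. cmod (u t) * (cmod (?z' t))\<^sup>2) = (1/2) * kin"
    by (simp only: kin_def integral_mult_right)
  show "2 * pi\<^sup>2 * \<tau> / len\<^sup>2 \<le> kin"
    using antiperiodic_wirtinger[OF tau z_deriv c a \<rho> len_def len_pos] unfolding L R
    by (simp add: power_divide mult_ac)
  assume "kin = 2 * pi\<^sup>2 * \<tau> / len\<^sup>2"
  then show "((\<lambda>t. cmod (u t) *\<^sub>R ?z' t) has_vector_derivative - ((pi / len)\<^sup>2 / cmod (u t)) *\<^sub>R z t) (at t)"
    by (intro antiperiodic_wirtinger_equality[OF tau z_deriv c a \<rho> len_def len_pos])
      (simp only: L R, simp add: power_divide mult_ac)
qed

end

lemma gordon_kinetic:
  assumes "ind0 \<tau> u = of_int k" "odd k"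
  shows "2 * pi\<^sup>2 * \<tau> / len\<^sup>2 \<le> kin"
  using antiperiodic_sqrt[OF cont nz per assms] lift_wirtinger(1) by metis

lemma gordon:
  assumes "ind0 \<tau> u = of_int k" "odd k" "\<delta> > 0"
  shows "gordon_bound \<tau> \<delta> \<le> kin + \<delta> * len"
  using gordon_bound_le(1)[OF tau assms(3) len_pos] gordon_kinetic[OF assms(1,2)] by simp

end


section \<open>Kepler orbits as harmonic oscillators in regularised time\<close>

lemma has_vector_derivative_quotient:
  fixes f g :: "real \<Rightarrow> 'a::real_normed_field"
  assumes "(f has_vector_derivative f') (at t)" "(g has_vector_derivative g') (at t)" "g t \<noteq> 0"
  shows "((\<lambda>t. f t / g t) has_vector_derivative (f' * g t - f t * g') / (g t)\<^sup>2) (at t)"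
  using has_derivative_divide'[OF assms(1,2)[unfolded has_vector_derivative_def] assms(3)]
  unfolding has_vector_derivative_def
  by (rule has_derivative_eq_rhs) (simp add: fun_eq_iff scaleR_conv_of_real power2_eq_square algebra_simps)

context plane_loop
begin

context
  fixes z :: "real \<Rightarrow> complex"
  assumes z: "continuous_on UNIV z" "\<And>t. (z t)\<^sup>2 = u t" "\<And>t. z (t + \<tau>) = - z t"
begin

text \<open>The derivative of the square root \<open>z\<close> of \<open>u\<close> in the regularised time \<open>dt = \<bar>u\<bar> ds\<close>.\<close>
definition zs :: "real \<Rightarrow> complex" where "zs t = cmod (u t) *\<^sub>R (u' t / (2 * z t))"

lemma norm_u_eq: "of_real (cmod (u t)) = z t * cnj (z t)" "cmod (u t) = z t \<bullet> z t" "cmod (u t) > 0"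
proof -
  show "of_real (cmod (u t)) = z t * cnj (z t)"
    using norm_z[OF z, of t] by (metis complex_norm_square)
  show "cmod (u t) = z t \<bullet> z t" using norm_z[OF z, of t] by (simp add: power2_norm_eq_inner)
  show "cmod (u t) > 0" using nz by simp
qed

lemma zs_eq: "zs t = cnj (z t) * u' t / 2" "u' t = 2 * zs t / cnj (z t)"
  using z_nz[OF z, of t] by (simp_all add: zs_def scaleR_conv_of_real norm_u_eq(1))

lemma z_deriv': "(z has_vector_derivative zs t /\<^sub>R cmod (u t)) (at t)"
  using z_deriv[OF z, of t] norm_u_eq(3)[of t] by (simp add: zs_def)

lemma zs_norm: "(cmod (zs t))\<^sup>2 = cmod (u t) * ((cmod (u' t))\<^sup>2 / 4)"
  by (simp add: zs_eq(1) norm_mult norm_divide power_divide power_mult_distrib norm_z[OF z])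

lemma zs_antiperiodic: "zs (t + \<tau>) = - zs t"
  by (simp add: zs_eq(1) z(3) per')

text \<open>An oscillator equation for z in regularised time is Newton's equation for u: it has
  attraction \<delta> exactly when 2 (|zs|^2 - c |u|) = \<delta>. The strength is thus read off from
  the energy of the oscillator.\<close>

lemma u'_deriv:
  assumes "(zs has_vector_derivative (c / cmod (u t)) *\<^sub>R z t) (at t)"
  shows "(u' has_vector_derivative (2 * (c * cmod (u t) - (cmod (zs t))\<^sup>2) / cmod (u t) ^ 3) *\<^sub>R u t) (at t)"
proof -
  have cz: "((\<lambda>t. cnj (z t)) has_vector_derivative cnj (zs t /\<^sub>R cmod (u t))) (at t)"
    by (rule bounded_linear.has_vector_derivative[OF bounded_linear_cnj z_deriv'])
  have "cnj (z t) \<noteq> 0" using z_nz[OF z] by simp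
  have "((\<lambda>t. 2 * zs t / cnj (z t)) has_vector_derivative
     2 * (((c / cmod (u t)) *\<^sub>R z t) * cnj (z t) - zs t * cnj (zs t /\<^sub>R cmod (u t))) / (cnj (z t))\<^sup>2) (at t)"
    using has_vector_derivative_quotient[OF has_vector_derivative_mult_right[OF assms, of 2] cz \<open>cnj (z t) \<noteq> 0\<close>]
    by (simp add: algebra_simps)
  also have "2 * (((c / cmod (u t)) *\<^sub>R z t) * cnj (z t) - zs t * cnj (zs t /\<^sub>R cmod (u t))) / (cnj (z t))\<^sup>2
     = (2 * (c * cmod (u t) - (cmod (zs t))\<^sup>2) / cmod (u t) ^ 3) *\<^sub>R u t"
  proof -
    define r where "r = complex_of_real (cmod (u t))"
    have r: "r = z t * cnj (z t)" "r \<noteq> 0" using norm_u_eq(1)[of t] nz by (auto simp: r_def)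
    have n: "(complex_of_real (cmod (zs t)))\<^sup>2 = zs t * cnj (zs t)"
      using complex_norm_square[of "zs t"] by simp
    have "((c / cmod (u t)) *\<^sub>R z t) * cnj (z t) - zs t * cnj (zs t /\<^sub>R cmod (u t)) = (c * r - (cmod (zs t))\<^sup>2) / r"
      using r(2) by (simp add: scaleR_conv_of_real r(1)[symmetric] flip: r_def complex_norm_square)
         (simp add: field_simps r n flip: r_def)
    moreover have "1 / (cnj (z t))\<^sup>2 = u t / r\<^sup>2"
      using r z_nz[OF z, of t] by (simp add: r(1) z(2)[symmetric] power_mult_distrib)
    ultimately have "2 * (((c / cmod (u t)) *\<^sub>R z t) * cnj (z t) - zs t * cnj (zs t /\<^sub>R cmod (u t))) / (cnj (z t))\<^sup>2
        = 2 * ((c * r - (cmod (zs t))\<^sup>2) / r) * (u t / r\<^sup>2)"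
      by (metis (no_types, lifting) times_divide_eq_right mult.right_neutral)
    also have "\<dots> = (2 * (c * cmod (u t) - (cmod (zs t))\<^sup>2) / cmod (u t) ^ 3) *\<^sub>R u t"
      by (simp add: scaleR_conv_of_real r_def power2_eq_square power3_eq_cube)
    finally show ?thesis .
  qed
  also have "(\<lambda>t. 2 * zs t / cnj (z t)) = u'" using zs_eq(2) by auto
  finally show ?thesis .
qed

text \<open>Converse of \<open>u'_deriv\<close>. The coefficient (|zs|^2 - \<delta>/2) / |u| equals
  half of the Kepler energy |u'|^2/2 - \<delta>/|u|, which later turns out to be constant, so that
  the equation for z becomes linear.\<close>

lemma zs_deriv_of_kepler:
  assumes "(u' has_vector_derivative - (\<delta> / cmod (u t) ^ 3) *\<^sub>R u t) (at t)"
  shows "(zs has_vector_derivative ((((cmod (zs t))\<^sup>2 - \<delta> / 2) / cmod (u t)) / cmod (u t)) *\<^sub>R z t) (at t)"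
proof -
  have cz: "((\<lambda>t. cnj (z t)) has_vector_derivative cnj (zs t /\<^sub>R cmod (u t))) (at t)"
    by (rule bounded_linear.has_vector_derivative[OF bounded_linear_cnj z_deriv'])
  have d: "((\<lambda>t. cnj (z t) * u' t / 2) has_vector_derivative
     (cnj (z t) * (- (\<delta> / cmod (u t) ^ 3) *\<^sub>R u t) + cnj (zs t /\<^sub>R cmod (u t)) * u' t) / 2) (at t)"
    using has_vector_derivative_mult[OF cz assms] by (rule has_vector_derivative_divide)
  have fe: "(\<lambda>t. cnj (z t) * u' t / 2) = zs" by (rule ext) (simp add: zs_eq(1))
  define r where "r = complex_of_real (cmod (u t))"
  have r: "r = z t * cnj (z t)" "r \<noteq> 0" using norm_u_eq(1)[of t] nz by (auto simp: r_def)
  have c0: "cnj (z t) \<noteq> 0" using z_nz[OF z] by simp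
  have "(cnj (z t) * (- (\<delta> / cmod (u t) ^ 3) *\<^sub>R u t) + cnj (zs t /\<^sub>R cmod (u t)) * u' t) / 2
      = (cnj (z t) * (- (of_real \<delta> / r ^ 3) * (z t)\<^sup>2) + cnj (zs t) / r * (2 * zs t / cnj (z t))) / 2"
  proof -
    have "- (\<delta> / cmod (u t) ^ 3) *\<^sub>R u t = - (of_real \<delta> / r ^ 3) * (z t)\<^sup>2"
      by (simp add: scaleR_conv_of_real r_def z(2))
    moreover have "cnj (zs t /\<^sub>R cmod (u t)) = cnj (zs t) / r"
      by (simp add: scaleR_conv_of_real r_def divide_inverse mult.commute)
    ultimately show ?thesis by (simp only: zs_eq(2)[of t])
  qed
  also have "\<dots> = - (\<delta> / 2 / r ^ 3) * (cnj (z t) * z t) * z t + (zs t * cnj (zs t)) / (r * cnj (z t))"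
    using c0 r(2) by (simp add: field_simps power2_eq_square)
  also have "\<dots> = - (\<delta> / 2 / r ^ 3) * r * z t + (zs t * cnj (zs t)) * z t / (r * r)"
  proof -
    have "cnj (z t) * z t = r" by (simp add: r(1))
    moreover have "x / (r * cnj (z t)) = x * z t / (r * (cnj (z t) * z t))" for x
      using z_nz[OF z, of t] by simp
    ultimately show ?thesis by simp
  qed
  also have "\<dots> = ((((cmod (zs t))\<^sup>2 - \<delta> / 2) / cmod (u t)) / cmod (u t)) *\<^sub>R z t"
    using r(2) complex_norm_square[of "zs t"]
    by (simp add: scaleR_conv_of_real field_simps power2_eq_square power3_eq_cube flip: r_def)
  finally show ?thesis using d unfolding fe by (simp only:)
qed

text \<open>The two derivatives differ by the factor B. Hence |zs|^2 - B |u| is conserved when B is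
  constant; B may vary here because its constancy for Kepler orbits is deduced from these
  formulas.\<close>

lemma zs_energy_constant:
  assumes "\<And>t. (zs has_vector_derivative ((B t) / cmod (u t)) *\<^sub>R z t) (at t)"
  shows "((\<lambda>t. (cmod (zs t))\<^sup>2) has_real_derivative B t * (2 * (z t \<bullet> zs t) / cmod (u t))) (at t)"
    and "((\<lambda>t. cmod (u t)) has_real_derivative 2 * (z t \<bullet> zs t) / cmod (u t)) (at t)"
  using has_vector_derivative_inner[OF assms[of t] assms[of t]] has_vector_derivative_inner[OF z_deriv'[of t] z_deriv'[of t]]
  by (simp_all add: has_real_derivative_iff_has_vector_derivative power2_norm_eq_inner norm_u_eq(2)[abs_def] inner_commute
      divide_inverse algebra_simps)

end

text \<open>Equality must hold both in Wirtinger's inequality and in the minimisation over S. The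
  first gives the oscillator equation with \<kappa> = pi / len; the second, \<delta> len^3 = 4 pi^2
  \<tau>, gives the conserved oscillator energy E the value \<delta> / 2 that
  \<open>u'_deriv\<close> asks for.\<close>

lemma gordon_equality:
  assumes "ind0 \<tau> u = of_int k" "odd k" "\<delta> > 0" "kin + \<delta> * len = gordon_bound \<tau> \<delta>"
  shows "(u' has_vector_derivative - (\<delta> / cmod (u t) ^ 3) *\<^sub>R u t) (at t)"
proof -
  obtain z where z: "continuous_on UNIV z" "\<And>t. (z t)\<^sup>2 = u t" "\<And>t. z (t + \<tau>) = - z t"
    using antiperiodic_sqrt[OF cont nz per assms(1,2)] by blast
  have kin: "kin = 2 * pi\<^sup>2 * \<tau> / len\<^sup>2"
    using gordon_bound_le(1)[OF tau assms(3) len_pos] gordon_kinetic[OF assms(1,2)] assms(4) by linarith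
  then have len: "\<delta> * len ^ 3 = 4 * pi\<^sup>2 * \<tau>"
    using gordon_bound_le(2)[OF tau assms(3) len_pos] assms(4) by simp
  define \<kappa> where "\<kappa> = pi / len"
  have d: "(zs z has_vector_derivative (- \<kappa>\<^sup>2 / cmod (u t)) *\<^sub>R z t) (at t)" for t
    using lift_wirtinger(2)[OF z kin, of t] by (simp add: zs_def[OF z, abs_def] \<kappa>_def)
  define E where "E t = (cmod (zs z t))\<^sup>2 + \<kappa>\<^sup>2 * cmod (u t)" for t
  have "(E has_real_derivative 0) (at t)" for t
    unfolding E_def using DERIV_add[OF zs_energy_constant(1)[OF z d] DERIV_cmult[OF zs_energy_constant(2)[OF z d], of "\<kappa>\<^sup>2"]]
    by simp
  then have E: "E t = E 0" for t
    by (intro constant_if_vector_derivative_zero) (simp add: has_real_derivative_iff_has_vector_derivative)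
  \<comment> \<open>Divided by |u|, the conservation law contains only quantities with known
    integrals: \<open>len\<close> on the left, \<tau> and \<open>kin\<close> on the right.\<close>
  have e: "E 0 * (1 / cmod (u t)) = \<kappa>\<^sup>2 + (1/2) * ((cmod (u' t))\<^sup>2 / 2)" for t
  proof -
    have "E 0 = cmod (u t) * ((cmod (u' t))\<^sup>2 / 4) + \<kappa>\<^sup>2 * cmod (u t)"
      using E[of t] by (simp add: E_def zs_norm[OF z])
    then show ?thesis using nz[of t] by (simp add: field_simps)
  qed
  have "E 0 * len = integral {0..\<tau>} (\<lambda>t. \<kappa>\<^sup>2 + (1/2) * ((cmod (u' t))\<^sup>2 / 2))"
    unfolding len_def by (simp only: e[symmetric] integral_mult_right)
  also have "\<dots> = \<kappa>\<^sup>2 * \<tau> + (1/2) * kin"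
    unfolding kin_def using tau
    by (subst integral_add) (auto intro!: integrable_continuous_real continuous_intros continuous_on_subset[OF cont'])
  also have "\<dots> = 2 * pi\<^sup>2 * \<tau> / len\<^sup>2" by (simp add: kin \<kappa>_def power_divide)
  finally have "2 * E 0 * len ^ 3 = \<delta> * len ^ 3"
    using len len_pos by (simp add: field_simps power2_eq_square power3_eq_cube)
  then have "2 * E t = \<delta>" using len_pos E[of t] by simp
  then have "2 * (- \<kappa>\<^sup>2 * cmod (u t) - (cmod (zs z t))\<^sup>2) = - \<delta>" by (simp add: E_def)
  then have "2 * (- \<kappa>\<^sup>2 * cmod (u t) - (cmod (zs z t))\<^sup>2) / cmod (u t) ^ 3 = - (\<delta> / cmod (u t) ^ 3)"
    by (simp only: minus_divide_left)
  with u'_deriv[OF z d, of t] show ?thesis by (simp only:)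
qed

text \<open>In the regularised time a Kepler orbit is a harmonic oscillation, so that its square root is
  \<open>P e\<^sup>i\<^sup>\<kappa>\<^sup>s - Q e\<^sup>-\<^sup>i\<^sup>\<kappa>\<^sup>s\<close> up to a constant factor, and the winding number is determined by the larger
  of \<open>\<bar>P\<bar>\<close> and \<open>\<bar>Q\<bar>\<close>.\<close>
lemma ind0_oscillator:
  fixes s :: "real \<Rightarrow> real" and \<kappa> :: real
  assumes s: "continuous_on UNIV s" "s 0 = 0" and \<kappa>: "\<kappa> \<noteq> 0"
    and u: "\<And>t. u t = ((P * exp (\<i> * (\<kappa> * s t)) - Q * exp (- (\<i> * (\<kappa> * s t)))) / (2 * \<i> * \<kappa>))\<^sup>2"
    and e: "exp (\<i> * (\<kappa> * s \<tau>)) = -1"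
    and PQ: "cmod Q < cmod P"
  shows "ind0 \<tau> u = \<kappa> * s \<tau> / pi"
proof -
  have P: "P \<noteq> 0" using PQ by auto
  \<comment> \<open>The factor that remains of the oscillation after P exp(i \<kappa> s) is taken
    out. As |Q / P| < 1 it stays in the right half plane, where the principal logarithm is
    continuous.\<close>
  define w where "w t = 1 - (Q / P) * exp (- (2 * \<i> * (\<kappa> * s t)))" for t
  have "Re ((Q / P) * exp (- (2 * \<i> * (\<kappa> * s t)))) < 1" for t
  proof -
    have "cmod (exp (- (2 * \<i> * (\<kappa> * s t)))) = 1" by (simp add: norm_exp_eq_Re)
    then have "cmod ((Q / P) * exp (- (2 * \<i> * (\<kappa> * s t)))) < 1"
      using PQ P by (simp add: norm_mult norm_divide)
    then show ?thesis using complex_Re_le_cmod by (rule le_less_trans[rotated])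
  qed
  then have w: "Re (w t) > 0" for t by (simp add: w_def)
  then have w0: "w t \<noteq> 0" "w t \<notin> \<real>\<^sub>\<le>\<^sub>0" for t
    by (metis less_irrefl zero_complex.sel(1)) (use w[of t] in \<open>auto simp: complex_nonpos_Reals_iff\<close>)
  define g where "g t = 2 * \<i> * (\<kappa> * s t) + 2 * Ln (P / (2 * \<i> * \<kappa>)) + 2 * Ln (w t)" for t
  have cg: "continuous_on UNIV g"
    unfolding g_def w_def by (intro continuous_intros s(1)) (use w0(2) in \<open>auto simp: w_def\<close>)
  have ug: "u t = exp (g t)" for t
  proof -
    define a where "a = \<i> * (\<kappa> * s t)"
    have "exp (g t) = (exp a * (P / (2 * \<i> * \<kappa>)) * w t)\<^sup>2"
      using P \<kappa> w0(1)[of t] unfolding g_def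
      by (simp add: a_def exp_add exp_double power_mult_distrib power_divide mult.assoc)
    also have "exp a * (P / (2 * \<i> * \<kappa>)) * w t = (P * exp a - Q * exp (- a)) / (2 * \<i> * \<kappa>)"
    proof -
      have wa: "w t = 1 - Q / P * exp (- (2 * a))" by (simp add: w_def a_def mult.assoc)
      have "exp a * exp (- (2 * a)) = exp (- a)" by (simp flip: exp_add)
      then have "exp a * P * w t = P * exp a - Q * exp (- a)"
        using P wa by (simp add: right_diff_distrib)
      then show ?thesis by simp
    qed
    finally show ?thesis using u[of t] by (simp add: a_def)
  qed
  \<comment> \<open>The factor w returns to its initial value after a period, so only the linear
    term 2 i \<kappa> s contributes to the winding number.\<close>
  have "exp (2 * (\<i> * (\<kappa> * s \<tau>))) = 1" unfolding exp_double e by simp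
  then have "exp (- (2 * \<i> * (\<kappa> * s \<tau>))) = 1" by (simp add: exp_minus mult.assoc)
  then have "w \<tau> = w 0" by (simp add: w_def s(2))
  then show ?thesis using ind0_exp[OF cg ug] by (simp add: g_def s(2))
qed

text \<open>The assumption on the exponential says only that \<kappa> len is an odd multiple of pi.
  The winding number is \<kappa> len / pi or its negative, so index 1 or -1 leaves pi itself. If |P|
  = |Q| the oscillation would pass through the origin.\<close>

lemma oscillator_half_period:
  fixes \<kappa> :: real
  assumes k: "k = 1 \<or> k = -1" and ind: "ind0 \<tau> u = of_int k"
    and s: "continuous_on UNIV s" "s 0 = 0" "s \<tau> = len" and \<kappa>: "\<kappa> > 0"
    and u: "\<And>t. u t = ((P * exp (\<i> * (\<kappa> * s t)) - Q * exp (- (\<i> * (\<kappa> * s t)))) / (2 * \<i> * \<kappa>))\<^sup>2"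
    and e: "exp (\<i> * (\<kappa> * s \<tau>)) = -1"
  shows "\<kappa> * len = pi"
proof -
  consider "cmod Q < cmod P" | "cmod P < cmod Q" | "cmod P = cmod Q" by linarith
  then show ?thesis
  proof cases
    case 1
    have "of_int k = complex_of_real (\<kappa> * s \<tau> / pi)"
      using ind0_oscillator[OF s(1,2) _ u e 1] \<kappa> ind by simp
    then have "of_int k = \<kappa> * len / pi"
      by (metis of_real_eq_iff of_real_of_int_eq s(3))
    then show ?thesis using k \<kappa> len_pos by (auto simp: field_simps)
       (metis mult_pos_pos neg_0_less_iff_less pi_gt_zero less_asym)
  next
    case 2
    \<comment> \<open>Exchanging P and Q and replacing \<kappa> by - \<kappa> leaves u unchanged and
      reduces to the first case with reversed orientation.\<close>
    have "u t = ((Q * exp (\<i> * ((- \<kappa>) * s t)) - P * exp (- (\<i> * ((- \<kappa>) * s t)))) / (2 * \<i> * (- \<kappa>)))\<^sup>2" for t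
      unfolding u[of t] by (simp add: power_divide power2_commute)
    moreover have "exp (\<i> * ((- \<kappa>) * s \<tau>)) = -1"
      using e by (simp add: exp_minus)
    ultimately have "of_int k = complex_of_real (- \<kappa> * s \<tau> / pi)"
      using ind0_oscillator[OF s(1,2), of "- \<kappa>" Q P] 2 \<kappa> ind by simp
    then have "of_int k = - \<kappa> * len / pi"
      by (metis of_real_eq_iff of_real_of_int_eq s(3))
    then show ?thesis using k \<kappa> len_pos by (auto simp: field_simps)
       (metis mult_pos_pos neg_0_less_iff_less pi_gt_zero less_asym)
  next
    case 3
    have P: "P \<noteq> 0" using 3 u[of 0] nz[of 0] by auto
    then have "cmod (Q / P) = 1" using 3 by (metis divide_self norm_divide norm_eq_zero)
    then obtain \<alpha> where \<alpha>: "0 \<le> \<alpha>" "\<alpha> < 2 * pi" "Q / P = exp (\<i> * \<alpha>)"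
      using Arg2pi[of "Q / P"] that[of "Arg2pi (Q / P)"] by (simp add: is_Arg_def)
    have "exp (\<i> * (\<kappa> * len)) = exp (\<i> * pi)" using e by (simp add: s(3))
    then obtain n :: int where "\<i> * (\<kappa> * len) = \<i> * pi + of_int (2 * n) * pi * \<i>"
      unfolding exp_eq by blast
    then have n: "\<kappa> * len = pi + of_int n * (2 * pi)"
      by (auto simp: complex_eq_iff)
    have "\<kappa> * len \<ge> pi"
    proof -
      have "0 < pi * (1 + 2 * of_int n)" using mult_pos_pos[OF \<kappa> len_pos] n by (simp add: algebra_simps)
      then have "n \<ge> 0" by (simp add: zero_less_mult_iff)
      then show ?thesis using n by simp
    qed
    \<comment> \<open>Because \<alpha> < 2 pi and \<kappa> len is at least pi, the phase \<alpha> /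
      2, at which the two exponential terms cancel, is reached within a period.\<close>
    then have "\<alpha> / (2 * \<kappa>) \<le> s \<tau>" using \<alpha>(2) \<kappa> s(3) by (simp add: field_simps)
    then obtain t where t: "s t = \<alpha> / (2 * \<kappa>)"
      using IVT'[of s 0 "\<alpha> / (2 * \<kappa>)" \<tau>] s \<alpha>(1) \<kappa> tau continuous_on_subset[OF s(1)] by auto
    define \<phi> where "\<phi> = \<kappa> * complex_of_real (s t)"
    have "complex_of_real \<alpha> = 2 * \<phi>" using \<kappa> by (simp add: \<phi>_def t)
    then have "Q / P * exp (- (\<i> * \<phi>)) = exp (\<i> * \<phi>)"
      using \<alpha>(3) by (simp flip: exp_add)
    then have "Q * exp (- (\<i> * \<phi>)) = P * exp (\<i> * \<phi>)" using P by (simp add: field_simps)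
    then have "u t = 0" unfolding u[of t] by (simp flip: \<phi>_def)
    then show ?thesis using nz by simp
  qed
qed

text \<open>Converse of \<open>gordon_equality\<close>. The virial identity links \<open>kin\<close>
  to \<open>len\<close>, conservation of energy makes z an oscillator, and
  \<open>oscillator_half_period\<close> supplies the missing relation \<kappa> len = pi, which
  amounts to \<delta> len^3 = 4 pi^2 \<tau>.\<close>

lemma kepler_gordon:
  assumes k: "k = 1 \<or> k = -1" and ind: "ind0 \<tau> u = of_int k" and \<delta>: "\<delta> > 0"
    and kepler: "\<And>t. (u' has_vector_derivative - (\<delta> / cmod (u t) ^ 3) *\<^sub>R u t) (at t)"
  shows "kin + \<delta> * len = gordon_bound \<tau> \<delta>"
proof -
  have "odd k" using k by auto
  then obtain z where z: "continuous_on UNIV z" "\<And>t. (z t)\<^sup>2 = u t" "\<And>t. z (t + \<tau>) = - z t"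
    using antiperiodic_sqrt[OF cont nz per ind] by blast
  have int: "f integrable_on {0..\<tau>}" if "continuous_on UNIV f" for f :: "real \<Rightarrow> real"
    by (intro integrable_continuous_real continuous_on_subset[OF that]) simp
  \<comment> \<open>The integrand is the derivative of the inner product of u and u', which is
    periodic.\<close>
  have virial: "2 * kin = \<delta> * len"
  proof -
    have "u t \<bullet> (- (\<delta> / cmod (u t) ^ 3) *\<^sub>R u t) + u' t \<bullet> u' t = 2 * ((cmod (u' t))\<^sup>2 / 2) - \<delta> * (1 / cmod (u t))" for t
      using nz[of t] by (simp add: dot_square_norm power2_eq_square power3_eq_cube)
    then have "((\<lambda>t. u t \<bullet> u' t) has_vector_derivative 2 * ((cmod (u' t))\<^sup>2 / 2) - \<delta> * (1 / cmod (u t))) (at t)" for t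
      using has_vector_derivative_inner[OF deriv kepler, of t] by simp
    from has_vector_derivative_at_within[OF this]
    have "integral {0..\<tau>} (\<lambda>t. 2 * ((cmod (u' t))\<^sup>2 / 2) - \<delta> * (1 / cmod (u t))) = u \<tau> \<bullet> u' \<tau> - u 0 \<bullet> u' 0"
      using tau by (intro integral_unique fundamental_theorem_of_calculus) auto
    also have "\<dots> = 0" using per[of 0] per'[of 0] by simp
    also have "integral {0..\<tau>} (\<lambda>t. 2 * ((cmod (u' t))\<^sup>2 / 2) - \<delta> * (1 / cmod (u t))) = 2 * kin - \<delta> * len"
      unfolding kin_def len_def
      by (subst integral_diff, intro int continuous_intros cont' cont, simp,
          intro int continuous_intros cont' cont) (auto simp: nz simp del: times_divide_eq_right)
    finally show ?thesis by simp
  qed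
  define B where "B t = ((cmod (zs z t))\<^sup>2 - \<delta> / 2) / cmod (u t)" for t
  have zs: "(zs z has_vector_derivative (B t / cmod (u t)) *\<^sub>R z t) (at t)" for t
    using zs_deriv_of_kepler[OF z kepler, of t] by (simp add: B_def)
  have "(B has_real_derivative 0) (at t)" for t
  proof -
    let ?c = "2 * (z t \<bullet> zs z t) / cmod (u t)"
    have "(B has_real_derivative ((B t * ?c) * cmod (u t) - ((cmod (zs z t))\<^sup>2 - \<delta> / 2) * ?c) / (cmod (u t) * cmod (u t))) (at t)"
      unfolding B_def[abs_def]
      by (rule DERIV_divide[OF _ zs_energy_constant(2)[OF z zs]])
        (use DERIV_diff[OF zs_energy_constant(1)[OF z zs] DERIV_const] nz in \<open>auto simp: B_def\<close>)
    also have "(B t * ?c) * cmod (u t) - ((cmod (zs z t))\<^sup>2 - \<delta> / 2) * ?c = 0"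
      using nz[of t] by (simp add: B_def)
    finally show ?thesis by simp
  qed
  then have B: "B t = B 0" for t
    by (intro constant_if_vector_derivative_zero) (simp add: has_real_derivative_iff_has_vector_derivative)
  \<comment> \<open>Averaging the constant B over a period gives kin / 2 - \<delta> len / 2 = -
    \<delta> len / 4 for \<tau> B, by the virial identity. So B is negative and this is its
    frequency.\<close>
  define \<kappa> where "\<kappa> = sqrt (\<delta> * len / (4 * \<tau>))"
  have \<kappa>: "\<kappa> > 0" "\<kappa>\<^sup>2 = \<delta> * len / (4 * \<tau>)" using \<delta> len_pos tau by (auto simp: \<kappa>_def)
  have B0: "B 0 = - \<kappa>\<^sup>2"
  proof -
    have e: "B 0 = (1/2) * ((cmod (u' t))\<^sup>2 / 2) - (\<delta> / 2) * (1 / cmod (u t))" for t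
    proof -
      have "B t = (1/2) * ((cmod (u' t))\<^sup>2 / 2) - (\<delta> / 2) * (1 / cmod (u t))"
        unfolding B_def zs_norm[OF z] using nz[of t] by (simp add: field_simps)
      then show ?thesis using B[of t] by simp
    qed
    have "B 0 * \<tau> = integral {0..\<tau>} (\<lambda>t. B 0)" using tau by simp
    also have "\<dots> = integral {0..\<tau>} (\<lambda>t. (1/2) * ((cmod (u' t))\<^sup>2 / 2) - (\<delta> / 2) * (1 / cmod (u t)))"
      by (simp only: e[symmetric])
    also have "\<dots> = (1/2) * kin - (\<delta> / 2) * len"
      unfolding kin_def len_def
      by (subst integral_diff, intro int continuous_intros cont' cont, simp,
          intro int continuous_intros cont' cont) (auto simp: nz simp del: times_divide_eq_right)
    also have "\<dots> = (- \<kappa>\<^sup>2) * \<tau>" using virial tau by (simp add: \<kappa>(2))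
    finally show ?thesis using tau by (metis mult_right_cancel less_irrefl)
  qed
  obtain s0 where s0: "\<And>t. (s0 has_vector_derivative 1 / cmod (u t)) (at t)"
    by (rule antiderivative_exists[of "\<lambda>t. 1 / cmod (u t)"]) (auto intro!: continuous_intros cont simp: nz)
  define s where "s t = s0 t - s0 0" for t
  have s: "(s has_vector_derivative 1 / cmod (u t)) (at t)" for t
    unfolding s_def using s0[of t] by (auto intro!: derivative_eq_intros)
  have cs: "continuous_on UNIV s" by (rule has_vector_derivative_imp_continuous_UNIV[OF s])
  have s00: "s 0 = 0" by (simp add: s_def)
  have s\<tau>: "s \<tau> = len"
  proof -
    have "len = s \<tau> - s 0" unfolding len_def
      using tau has_vector_derivative_at_within[OF s]
      by (intro integral_unique fundamental_theorem_of_calculus) auto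
    then show ?thesis by (simp add: s00)
  qed
  \<comment> \<open>For c = \<kappa> and c = - \<kappa> the combination zs + i c z evolves by the
    factor exp(i c s). These two first integrals are P and Q.\<close>
  have osc: "(zs z t + \<i> * c * z t) * exp (- (\<i> * (c * s t))) = zs z 0 + \<i> * c * z 0" if c: "c\<^sup>2 = \<kappa>\<^sup>2" for c :: real and t
  proof -
    let ?r = "\<lambda>t. complex_of_real (cmod (u t))"
    define f where "f t = (zs z t + \<i> * c * z t) * exp (- (\<i> * (c * s t)))" for t
    have ds: "((\<lambda>t. complex_of_real (s t)) has_vector_derivative 1 / ?r t) (at t)" for t
      using bounded_linear.has_vector_derivative[OF bounded_linear_of_real[where 'a=complex] s[of t]] by simp
    have dexp: "((\<lambda>t. exp (- (\<i> * (c * s t)))) has_vector_derivative (- (\<i> * (c * (1 / ?r t)))) * exp (- (\<i> * (c * s t)))) (at t)" for t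
    proof -
      have "((\<lambda>t. - (\<i> * (c * s t))) has_vector_derivative (- (\<i> * (c * (1 / ?r t))))) (at t)"
        using has_vector_derivative_minus[OF has_vector_derivative_mult_right[OF has_vector_derivative_mult_right[OF ds[of t], of c], of \<i>]]
        by simp
      from field_vector_diff_chain_at[OF this DERIV_exp] show ?thesis by (simp add: o_def mult.commute)
    qed
    have dz: "((\<lambda>t. zs z t + \<i> * c * z t) has_vector_derivative - (\<kappa>\<^sup>2) * z t / ?r t + \<i> * c * (zs z t / ?r t)) (at t)" for t
      using has_vector_derivative_add[OF zs[of t] has_vector_derivative_mult_right[OF z_deriv'[OF z, of t], of "\<i> * c"]]
      unfolding B[of t] B0 by (simp add: scaleR_conv_of_real divide_inverse mult_ac)
    have "(f has_vector_derivative 0) (at t)" for t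
    proof -
      have "of_real c * of_real c = complex_of_real \<kappa> * of_real \<kappa>"
        using c by (simp add: power2_eq_square flip: of_real_mult)
      then have "(zs z t + \<i> * c * z t) * ((- (\<i> * (c * (1 / ?r t)))) * exp (- (\<i> * (c * s t)))) +
          (- (\<kappa>\<^sup>2) * z t / ?r t + \<i> * c * (zs z t / ?r t)) * exp (- (\<i> * (c * s t))) = 0"
        using nz[of t] by (simp add: field_simps power2_eq_square)
      with has_vector_derivative_mult[OF dz[of t] dexp[of t]] show ?thesis by (simp add: f_def[abs_def])
    qed
    then have "f t = f 0" by (rule constant_if_vector_derivative_zero)
    then show ?thesis by (simp add: f_def s00)
  qed
  define P where "P = zs z 0 + \<i> * \<kappa> * z 0"
  define Q where "Q = zs z 0 - \<i> * \<kappa> * z 0"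
  have PQ: "zs z t + \<i> * \<kappa> * z t = P * exp (\<i> * (\<kappa> * s t))" "zs z t - \<i> * \<kappa> * z t = Q * exp (- (\<i> * (\<kappa> * s t)))" for t
    using osc[of \<kappa> t] osc[of "-\<kappa>" t] by (auto simp: P_def Q_def exp_minus field_simps)
  have zPQ: "z t = (P * exp (\<i> * (\<kappa> * s t)) - Q * exp (- (\<i> * (\<kappa> * s t)))) / (2 * \<i> * \<kappa>)" for t
    unfolding PQ[symmetric] using \<kappa>(1) by simp
  have e: "exp (\<i> * (\<kappa> * s \<tau>)) = -1"
  proof -
    have "zs z \<tau> = - zs z 0" "z \<tau> = - z 0" using zs_antiperiodic[OF z, of 0] z(3)[of 0] by auto
    then have "P * exp (\<i> * (\<kappa> * s \<tau>)) = - P" "Q * exp (- (\<i> * (\<kappa> * s \<tau>))) = - Q"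
      using PQ[of \<tau>] by (auto simp: P_def Q_def)
    moreover have "P \<noteq> 0 \<or> Q \<noteq> 0" using zPQ[of 0] z_nz[OF z, of 0] by auto
    ultimately show ?thesis
      by (metis exp_minus inverse_minus_eq inverse_1 inverse_inverse_eq mult_cancel_left mult.right_neutral mult_minus_right)
  qed
  have "\<kappa> * len = pi"
    by (rule oscillator_half_period[OF k ind cs s00 s\<tau> \<kappa>(1) _ e, of P Q]) (simp only: z(2)[symmetric] zPQ[symmetric])
  then have "\<kappa>\<^sup>2 * len\<^sup>2 = pi\<^sup>2" by (metis power_mult_distrib)
  moreover have "\<delta> * len = 4 * \<tau> * \<kappa>\<^sup>2" using tau by (simp add: \<kappa>(2))
  then have "\<delta> * len ^ 3 = 4 * \<tau> * (\<kappa>\<^sup>2 * len\<^sup>2)"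
    by (simp add: power3_eq_cube power2_eq_square)
  ultimately have len3: "\<delta> * len ^ 3 = 4 * pi\<^sup>2 * \<tau>" by simp
  have "kin * len\<^sup>2 = \<delta> * len ^ 3 / 2" using virial by (simp add: power3_eq_cube power2_eq_square)
  then have "kin = 2 * pi\<^sup>2 * \<tau> / len\<^sup>2" using len_pos by (simp add: len3 field_simps)
  moreover have "2 * pi\<^sup>2 * \<tau> / len\<^sup>2 + \<delta> * len = gordon_bound \<tau> \<delta>"
    using gordon_bound_le(2)[OF tau \<delta> len_pos] len3 by simp
  ultimately show ?thesis by simp
qed

end

section \<open>Loops through the origin and weak limits\<close>


lemma set_nn_integral_eq_integral:
  fixes f :: "real \<Rightarrow> real"
  assumes "continuous_on {a..b} f" "\<And>t. t \<in> {a..b} \<Longrightarrow> 0 \<le> f t"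
  shows "(\<integral>\<^sup>+t\<in>{a..b}. ennreal (f t) \<partial>lborel) = ennreal (integral {a..b} f)"
proof -
  have "(\<integral>\<^sup>+t. ennreal (indicator {a..b} t * f t) \<partial>lborel) = ennreal (integral {a..b} f)"
    by (rule nn_integral_has_integral_lebesgue)
      (use assms(2) integrable_integral[OF integrable_continuous_real[OF assms(1)]] in auto)
  moreover have "(\<integral>\<^sup>+t. ennreal (indicator {a..b} t * f t) \<partial>lborel) = (\<integral>\<^sup>+t\<in>{a..b}. ennreal (f t) \<partial>lborel)"
    by (intro nn_integral_cong) (auto split: split_indicator)
  ultimately show ?thesis by simp
qed

text \<open>On a loop through the origin the weighted inequality is applied to \<open>x = \<surd>r\<close>, \<open>\<rho> = r\<close> with the
  regularised radius \<open>r = \<surd>(\<bar>v\<bar>\<^sup>2 + \<epsilon>\<^sup>2)\<close>.\<close>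
lemma collision_wirtinger:
  fixes v v' :: "real \<Rightarrow> complex"
  assumes \<tau>: "\<tau> > 0"
    and v: "\<And>t. (v has_vector_derivative v' t) (at t)" "continuous_on UNIV v'"
    and per: "\<And>t. v (t + \<tau>) = v t" "\<And>t. v' (t + \<tau>) = v' t"
    and \<epsilon>: "\<epsilon> > 0"
    and S: "integral {0..\<tau>} (\<lambda>t. 1 / sqrt ((cmod (v t))\<^sup>2 + \<epsilon>\<^sup>2)) \<le> S"
    and \<kappa>: "\<kappa> > 0" "\<kappa> * S < pi"
  shows "\<kappa>\<^sup>2 * \<tau> - 2 * (\<kappa> / sin ((pi - \<kappa> * S) / 2)) * sqrt ((cmod (v t0))\<^sup>2 + \<epsilon>\<^sup>2)
           \<le> integral {0..\<tau>} (\<lambda>t. (cmod (v' t))\<^sup>2) / 4"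
proof -
  define r where "r t = sqrt ((cmod (v t))\<^sup>2 + \<epsilon>\<^sup>2)" for t
  have r: "r t > 0" "(r t)\<^sup>2 = (cmod (v t))\<^sup>2 + \<epsilon>\<^sup>2" for t
    using \<epsilon> by (auto simp: r_def add_nonneg_pos)
  have perr: "r (t + \<tau>) = r t" for t by (simp add: r_def per)
  have cv: "continuous_on A v" for A by (rule has_vector_derivative_imp_continuous_UNIV[OF v(1)])
  have cr: "continuous_on A r" for A unfolding r_def by (intro continuous_intros cv)
  have rd: "(r has_real_derivative (v t \<bullet> v' t) / r t) (at t)" for t
  proof -
    have d: "((\<lambda>t. v t \<bullet> v t + \<epsilon>\<^sup>2) has_real_derivative 2 * (v t \<bullet> v' t)) (at t)"
      using has_vector_derivative_add[OF has_vector_derivative_inner[OF v(1)[of t] v(1)[of t]] has_vector_derivative_const[of "\<epsilon>\<^sup>2"]]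
      by (simp add: has_real_derivative_iff_has_vector_derivative inner_commute)
    have eq: "r = (\<lambda>t. sqrt (v t \<bullet> v t + \<epsilon>\<^sup>2))"
      by (simp add: r_def fun_eq_iff power2_norm_eq_inner)
    have "v t \<bullet> v t + \<epsilon>\<^sup>2 > 0" using \<epsilon> by (simp add: add_nonneg_pos)
    from DERIV_chain2[OF DERIV_real_sqrt[OF this] d]
    have "(r has_real_derivative inverse (r t) / 2 * (2 * (v t \<bullet> v' t))) (at t)"
      unfolding eq .
    moreover have "inverse (r t) / 2 * (2 * (v t \<bullet> v' t)) = (v t \<bullet> v' t) / r t"
      using r(1)[of t] by (simp add: field_simps)
    ultimately show ?thesis by (simp only:)
  qed
  define x where "x t = sqrt (r t)" for t
  define x' where "x' t = ((v t \<bullet> v' t) / r t) / (2 * x t)" for t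
  have x2: "(x t)\<^sup>2 = r t" "x t > 0" for t using r(1)[of t] by (auto simp: x_def)
  have xd: "(x has_real_derivative x' t) (at t)" for t
  proof -
    have "(x has_real_derivative inverse (sqrt (r t)) / 2 * ((v t \<bullet> v' t) / r t)) (at t)"
      using DERIV_chain2[OF DERIV_real_sqrt[OF r(1)[of t]] rd] unfolding x_def[abs_def] .
    moreover have "inverse (sqrt (r t)) / 2 * ((v t \<bullet> v' t) / r t) = x' t"
      unfolding x'_def x_def using r(1)[of t] by (simp add: field_simps)
    ultimately show ?thesis by (simp only:)
  qed
  have cx: "continuous_on A x" for A unfolding x_def by (intro continuous_intros cr)
  have cx': "continuous_on A x'" for A unfolding x'_def
    by (intro continuous_intros cv cx cr continuous_on_subset[OF v(2)] subset_UNIV)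
      (use x2(2) r(1) in \<open>simp_all add: less_imp_neq[THEN not_sym]\<close>)
  have c1: "continuous_on A (\<lambda>t. 1 / r t)" for A
    by (intro continuous_intros cr) (use r(1) in \<open>simp add: less_imp_neq[THEN not_sym]\<close>)
  define S0 where "S0 = integral {0..\<tau>} (\<lambda>t. 1 / r t)"
  have S0: "0 \<le> S0" "S0 \<le> S" using S r(1) c1
    by (auto simp: S0_def r_def less_imp_le intro!: integral_nonneg integrable_continuous_real)
  \<comment> \<open>With this starting phase \<kappa> s runs from y to pi - y. The cotangents at the
    two ends are opposite, and both boundary terms are multiples of the same value r(t0).\<close>
  define y where "y = (pi - \<kappa> * S0) / 2"
  have y: "(pi - \<kappa> * S) / 2 \<le> y" "y \<le> pi / 2" "0 < (pi - \<kappa> * S) / 2"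
    using S0 \<kappa> by (auto simp: y_def)
  define s where "s t = integral {t0..t} (\<lambda>t. 1 / r t) + y / \<kappa>" for t
  have sh: "integral {t0..t0+\<tau>} f = integral {0..\<tau>} f"
    if "continuous_on UNIV f" "\<And>t. f (t + \<tau>) = f t" for f :: "real \<Rightarrow> real"
    using integral_period_shift[OF that] \<tau> by simp
  have s0: "\<kappa> * s t0 = y" using \<kappa> by (simp add: s_def)
  have s1: "\<kappa> * s (t0 + \<tau>) = pi - y"
  proof -
    have "integral {t0..t0+\<tau>} (\<lambda>t. 1 / r t) = S0" unfolding S0_def by (rule sh) (auto simp: c1 perr)
    then have "\<kappa> * s (t0 + \<tau>) = \<kappa> * S0 + y" using \<kappa> by (simp add: s_def distrib_left)
    then show ?thesis by (simp add: y_def field_simps)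
  qed
  have sd: "(s has_vector_derivative 1 / r t) (at t within {t0..t0+\<tau>})" if "t \<in> {t0..t0+\<tau>}" for t
    unfolding s_def using integral_has_vector_derivative[OF c1 that] by (auto intro!: derivative_eq_intros)
  have s_mono: "s t \<le> s t'" if "t0 \<le> t" "t \<le> t'" for t t'
    unfolding s_def using that r(1)
    by (intro add_right_mono integral_subset_le integrable_continuous_real c1) (auto intro: less_imp_le)
  have \<kappa>s: "\<kappa> * s t \<in> {0<..<pi}" if "t \<in> {t0..t0+\<tau>}" for t
  proof -
    have "\<kappa> * s t0 \<le> \<kappa> * s t" "\<kappa> * s t \<le> \<kappa> * s (t0 + \<tau>)"
      using that s_mono \<kappa>(1) by auto
    then show ?thesis using s0 s1 y by auto
  qed
  have "\<kappa>\<^sup>2 * integral {t0..t0+\<tau>} (\<lambda>t. (x t)\<^sup>2 / r t) + \<kappa> * cot (\<kappa> * s (t0+\<tau>)) * (x (t0+\<tau>))\<^sup>2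
      - \<kappa> * cot (\<kappa> * s t0) * (x t0)\<^sup>2 \<le> integral {t0..t0+\<tau>} (\<lambda>t. r t * (x' t)\<^sup>2)"
    by (rule weighted_wirtinger_boundary[OF _ _ cx' cr r(1) sd \<kappa>s])
      (use \<tau> xd in \<open>auto simp: has_real_derivative_iff_has_vector_derivative intro: has_vector_derivative_at_within\<close>)
  also have "cot (\<kappa> * s (t0+\<tau>)) = - cot y" unfolding s1 by (simp add: cot_def)
  also have "integral {t0..t0+\<tau>} (\<lambda>t. (x t)\<^sup>2 / r t) = \<tau>"
    using \<tau> r(1) by (simp add: x2 less_imp_neq[THEN not_sym])
  finally have "\<kappa>\<^sup>2 * \<tau> - 2 * \<kappa> * cot y * r t0 \<le> integral {t0..t0+\<tau>} (\<lambda>t. r t * (x' t)\<^sup>2)"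
    by (simp add: x2 perr s0)
  \<comment> \<open>Only the radial part of the velocity enters x', and r dominates |v|, so it is at
    most |v'|.\<close>
  also have "\<dots> \<le> integral {t0..t0+\<tau>} (\<lambda>t. (cmod (v' t))\<^sup>2 / 4)"
  proof (intro integral_le integrable_continuous_real continuous_intros cr cx' continuous_on_subset[OF v(2)])
    fix t
    have "\<bar>v t \<bullet> v' t\<bar> \<le> cmod (v t) * cmod (v' t)" by (rule Cauchy_Schwarz_ineq2)
    also have "\<dots> \<le> r t * cmod (v' t)"
      by (intro mult_right_mono) (auto simp: r_def intro!: real_le_rsqrt)
    finally have "\<bar>(v t \<bullet> v' t) / r t\<bar> \<le> cmod (v' t)" using r(1)[of t] by (simp add: divide_le_eq mult.commute)
    then have "((v t \<bullet> v' t) / r t)\<^sup>2 \<le> (cmod (v' t))\<^sup>2" by (simp add: abs_le_square_iff[symmetric])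
    moreover have "r t * (x' t)\<^sup>2 = ((v t \<bullet> v' t) / r t)\<^sup>2 / 4"
      using r(1)[of t] by (simp add: x'_def power_divide power_mult_distrib x2)
    ultimately show "r t * (x' t)\<^sup>2 \<le> (cmod (v' t))\<^sup>2 / 4" by simp
  qed auto
  also have "\<dots> = integral {0..\<tau>} (\<lambda>t. (cmod (v' t))\<^sup>2 / 4)"
    by (rule sh) (auto simp: per intro!: continuous_intros v(2))
  also have "\<dots> = integral {0..\<tau>} (\<lambda>t. (cmod (v' t))\<^sup>2) / 4" by simp
  finally have main: "\<kappa>\<^sup>2 * \<tau> - 2 * \<kappa> * cot y * r t0 \<le> integral {0..\<tau>} (\<lambda>t. (cmod (v' t))\<^sup>2) / 4" .
  \<comment> \<open>cot y is replaced by a bound in terms of \<kappa> and S alone, so that the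
    boundary loss is controlled uniformly along a sequence of loops.\<close>
  have sin: "0 < sin ((pi - \<kappa> * S) / 2)" "sin ((pi - \<kappa> * S) / 2) \<le> sin y"
    using y pi_gt_zero by (auto intro!: sin_gt_zero sin_monotone_2pi_le)
  have "cot y \<le> 1 / sin y" using sin by (simp add: cot_def divide_right_mono)
  also have "\<dots> \<le> 1 / sin ((pi - \<kappa> * S) / 2)" using sin by (intro divide_left_mono) auto
  finally have "2 * \<kappa> * r t0 * cot y \<le> 2 * \<kappa> * r t0 * (1 / sin ((pi - \<kappa> * S) / 2))"
    using \<kappa> r(1)[of t0] by (intro mult_left_mono) auto
  with main show ?thesis by (simp add: r_def mult_ac)
qed

section \<open>Measurable velocities and the passage to the limit\<close>

text \<open>\<open>action\<close> and \<open>W12_dist2\<close> evaluate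
  \<open>vector_derivative\<close> at every time, also where the path is not differentiable.
  Splitting their integrals requires measurability, so a Borel function with the same values on the
  interval is constructed.\<close>

lemma vector_derivative_borel:
  fixes f :: "real \<Rightarrow> complex"
  assumes "continuous_on {a..b} f" "a < b"
  obtains g where "g \<in> borel_measurable borel" "\<And>t. t \<in> {a..b} \<Longrightarrow> g t = vector_derivative f (at t)"
proof -
  define F where "F t = f (max a (min b t))" for t
  have cF: "continuous_on UNIV F" unfolding F_def
    by (rule continuous_on_compose2[OF assms(1)]) (use assms(2) in \<open>auto intro!: continuous_intros\<close>)
  define q where "q h t = (F (t + h) - F t) /\<^sub>R h" for h t
  have cq: "continuous_on UNIV (q h)" for h unfolding q_def
    by (intro continuous_intros cF continuous_on_compose2[OF cF]) auto
  \<comment> \<open>Differentiability at t is the Cauchy condition for the difference quotients. For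
    fixed tolerances it cuts out an intersection of closed sets, closed although h and k range over
    uncountably many values; so D is a Borel set.\<close>
  define C where "C n m = (\<Inter>h\<in>{h. h \<noteq> 0 \<and> \<bar>h\<bar> < 1 / Suc m}. \<Inter>k\<in>{k. k \<noteq> 0 \<and> \<bar>k\<bar> < 1 / Suc m}.
      {t. norm (q h t - q k t) \<le> 1 / Suc n})" for n m :: nat
  have closed: "closed (C n m)" for n m
    unfolding C_def by (intro closed_INT ballI closed_Collect_le continuous_intros cq)
  define D where "D = (\<Inter>n. \<Union>m. C n m)"
  have D: "D \<in> sets borel" unfolding D_def
    using closed by (intro sets.countable_INT'' sets.countable_UN' borel_closed) auto
  have q_lim: "(F has_vector_derivative d) (at t) \<longleftrightarrow> ((\<lambda>h. q h t) \<longlongrightarrow> d) (at 0)" for d t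
    unfolding has_vector_derivative_iff_quotient q_def
    using LIM_offset_zero_iff[of t "\<lambda>y. (F y - F t) /\<^sub>R (y - t)" d] by simp
  have seq: "filterlim (\<lambda>n. 1 / real (Suc n)) (at 0) sequentially"
    by (auto simp: filterlim_at lim_1_over_n LIMSEQ_Suc intro!: LIMSEQ_Suc[OF lim_1_over_n, simplified])
  have DI: "t \<in> D" if "(F has_vector_derivative d) (at t)" for d t
  proof -
    have "\<exists>m. t \<in> C n m" for n
    proof -
      have "\<forall>\<^sub>F h in at 0. dist (q h t) d < 1 / (2 * Suc n)"
        using that unfolding q_lim by (rule tendstoD) simp
      then obtain e where e: "e > 0" "\<And>h. h \<noteq> 0 \<Longrightarrow> \<bar>h\<bar> < e \<Longrightarrow> dist (q h t) d < 1 / (2 * Suc n)"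
        unfolding eventually_at by auto
      obtain m where m: "1 / Suc m < e" using nat_approx_posE[OF e(1)] by blast
      have "norm (q h t - q k t) \<le> 1 / Suc n"
        if "h \<noteq> 0" "\<bar>h\<bar> < 1 / Suc m" "k \<noteq> 0" "\<bar>k\<bar> < 1 / Suc m" for h k
      proof -
        have "dist (q h t) (q k t) < 1 / (2 * Suc n) + 1 / (2 * Suc n)"
          using that m by (intro dist_triangle_less_add[of _ d] e(2)) auto
        then show ?thesis by (simp add: dist_norm field_simps)
      qed
      then show ?thesis by (auto simp: C_def)
    qed
    then show ?thesis by (auto simp: D_def)
  qed
  have DD: "(F has_vector_derivative lim (\<lambda>n. q (1 / Suc n) t)) (at t)" if "t \<in> D" for t
  proof -
    have crit: "\<exists>m. \<forall>h k. h \<noteq> 0 \<longrightarrow> \<bar>h\<bar> < 1 / Suc m \<longrightarrow> k \<noteq> 0 \<longrightarrow> \<bar>k\<bar> < 1 / Suc m \<longrightarrow> norm (q h t - q k t) \<le> 1 / Suc n" for n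
    proof -
      obtain m where "t \<in> C n m" using \<open>t \<in> D\<close> by (auto simp: D_def)
      then show ?thesis by (intro exI[of _ m]) (auto simp: C_def)
    qed
    have "Cauchy (\<lambda>n. q (1 / Suc n) t)"
    proof (rule metric_CauchyI)
      fix e :: real assume "e > 0"
      then obtain n where n: "1 / Suc n < e" using nat_approx_posE by blast
      obtain m where m: "\<And>h k. h \<noteq> 0 \<Longrightarrow> \<bar>h\<bar> < 1 / Suc m \<Longrightarrow> k \<noteq> 0 \<Longrightarrow> \<bar>k\<bar> < 1 / Suc m \<Longrightarrow> norm (q h t - q k t) \<le> 1 / Suc n"
        using crit[of n] by blast
      have small: "\<bar>1 / real (Suc i)\<bar> < 1 / Suc m" if "i \<ge> Suc m" for i
        using that by (simp add: frac_less2)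
      show "\<exists>M. \<forall>i\<ge>M. \<forall>j\<ge>M. dist (q (1 / Suc i) t) (q (1 / Suc j) t) < e"
      proof (intro exI[of _ "Suc m"] allI impI)
        fix i j assume ij: "i \<ge> Suc m" "j \<ge> Suc m"
        have "norm (q (1 / Suc i) t - q (1 / Suc j) t) \<le> 1 / Suc n"
          by (rule m[OF _ small[OF ij(1)] _ small[OF ij(2)]]) simp_all
        then show "dist (q (1 / Suc i) t) (q (1 / Suc j) t) < e" using n by (simp add: dist_norm)
      qed
    qed
    then have lim: "(\<lambda>n. q (1 / Suc n) t) \<longlonglongrightarrow> lim (\<lambda>n. q (1 / Suc n) t)"
      by (simp add: Cauchy_convergent_iff convergent_LIMSEQ_iff)
    define d where "d = lim (\<lambda>n. q (1 / Suc n) t)"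
    have "((\<lambda>h. q h t) \<longlongrightarrow> d) (at 0)"
    proof (rule tendstoI)
      fix e :: real assume "e > 0"
      then obtain n where n: "1 / Suc n < e" using nat_approx_posE by blast
      obtain m where m: "\<And>h k. h \<noteq> 0 \<Longrightarrow> \<bar>h\<bar> < 1 / Suc m \<Longrightarrow> k \<noteq> 0 \<Longrightarrow> \<bar>k\<bar> < 1 / Suc m \<Longrightarrow> norm (q h t - q k t) \<le> 1 / Suc n"
        using crit[of n] by blast
      have "dist (q h t) d < e" if h: "h \<noteq> 0" "\<bar>h\<bar> < 1 / Suc m" for h
      proof -
        have "(\<lambda>i. norm (q h t - q (1 / Suc i) t)) \<longlonglongrightarrow> norm (q h t - d)"
          using lim unfolding d_def by (intro tendsto_intros)
        moreover have "\<forall>\<^sub>F i in sequentially. norm (q h t - q (1 / Suc i) t) \<le> 1 / Suc n"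
          using eventually_gt_at_top[of m]
          by eventually_elim (rule m, use h in \<open>auto simp: frac_less2\<close>)
        ultimately have "norm (q h t - d) \<le> 1 / Suc n"
          by (intro tendsto_upperbound) auto
        then show ?thesis using n by (simp add: dist_norm)
      qed
      then show "\<forall>\<^sub>F h in at 0. dist (q h t) d < e"
        unfolding eventually_at by (intro exI[of _ "1 / Suc m"]) auto
    qed
    then show ?thesis unfolding q_lim d_def .
  qed
  have agree: "(F has_vector_derivative d) (at t) \<longleftrightarrow> (f has_vector_derivative d) (at t)" if "t \<in> {a<..<b}" for t d
    by (rule has_vector_derivative_cong_ev)
      (use that eventually_nhds_in_open[of "{a<..<b}" t] in
        \<open>auto simp: F_def elim!: eventually_mono\<close>)
  \<comment> \<open>At the end points the clamped F may have a different derivative, so the value of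
    f is taken directly. Where no derivative exists, \<open>vector_derivative\<close> has the fixed
    value \<open>SOME d. False\<close>.\<close>
  define g where "g t = (if t = a then vector_derivative f (at a) else if t = b then vector_derivative f (at b)
     else if t \<in> D then lim (\<lambda>n. q (1 / Suc n) t) else (SOME d. False))" for t
  have [measurable]: "q h \<in> borel_measurable borel" for h
    by (rule borel_measurable_continuous_onI[OF cq])
  have "g \<in> borel_measurable borel"
    unfolding g_def using D by (intro measurable_If_set measurable_If) (auto simp: pred_def)
  moreover have "g t = vector_derivative f (at t)" if "t \<in> {a..b}" for t
  proof (cases "t = a \<or> t = b")
    case True
    then show ?thesis by (auto simp: g_def)
  next
    case False
    with that have t: "t \<in> {a<..<b}" by auto
    show ?thesis
    proof (cases "t \<in> D")
      case True
      then show ?thesis using DD[OF True] False vector_derivative_at agree[OF t]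
        by (metis g_def)
    next
      case not: False
      then have "\<not> (f has_vector_derivative d) (at t)" for d using DI agree[OF t] by blast
      then show ?thesis using False not by (simp add: g_def vector_derivative_def)
    qed
  qed
  ultimately show thesis using that by blast
qed


lemma ennreal_le_of_lt:
  fixes X :: ennreal
  assumes "\<And>\<beta>. 0 \<le> \<beta> \<Longrightarrow> \<beta> < B \<Longrightarrow> ennreal \<beta> \<le> X"
  shows "ennreal B \<le> X"
proof (cases "B \<le> 0")
  case True
  then show ?thesis by (simp add: ennreal_neg)
next
  case False
  show ?thesis
  proof (cases X)
    case (real x)
    have "B \<le> x"
    proof (rule dense_le_bounded[of 0])
      show "0 < B" using False by simp
      show "\<beta> \<le> x" if "0 < \<beta>" "\<beta> < B" for \<beta>
        using assms[of \<beta>] that real by simp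
    qed
    then show ?thesis using real by simp
  qed simp
qed

text \<open>Young's inequality in place of the triangle inequality of L2: it needs no square roots
  in \<open>ennreal\<close>, and \<eta> can be made small afterwards.\<close>

lemma L2_bound:
  fixes v w :: "real \<Rightarrow> complex"
  assumes [measurable]: "v \<in> borel_measurable borel" "w \<in> borel_measurable borel" "A \<in> sets borel"
    and \<eta>: "\<eta> > 0"
  shows "(\<integral>\<^sup>+t\<in>A. ennreal ((cmod (v t))\<^sup>2) \<partial>lborel) \<le> ennreal (1 + \<eta>) * (\<integral>\<^sup>+t\<in>A. ennreal ((cmod (w t))\<^sup>2) \<partial>lborel)
    + ennreal (1 + 1 / \<eta>) * (\<integral>\<^sup>+t\<in>A. ennreal ((cmod (v t - w t))\<^sup>2) \<partial>lborel)"
proof -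
  have pt: "(cmod a)\<^sup>2 \<le> (1 + \<eta>) * (cmod b)\<^sup>2 + (1 + 1 / \<eta>) * (cmod (a - b))\<^sup>2" for a b
  proof -
    define x where "x = cmod b"
    define y where "y = cmod (a - b)"
    have "cmod a \<le> x + y" unfolding x_def y_def using norm_triangle_ineq[of b "a - b"] by simp
    then have "(cmod a)\<^sup>2 \<le> (x + y)\<^sup>2" by (intro power_mono) auto
    moreover have "(x + y)\<^sup>2 + (\<eta> * x - y)\<^sup>2 / \<eta> = (1 + \<eta>) * x\<^sup>2 + (1 + 1 / \<eta>) * y\<^sup>2"
      using \<eta> by (simp add: field_simps power2_eq_square)
    moreover have "(\<eta> * x - y)\<^sup>2 / \<eta> \<ge> 0" using \<eta> by simp
    ultimately show ?thesis unfolding x_def y_def by linarith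
  qed
  have "(\<integral>\<^sup>+t\<in>A. ennreal ((cmod (v t))\<^sup>2) \<partial>lborel)
     \<le> (\<integral>\<^sup>+t. ennreal (1 + \<eta>) * (ennreal ((cmod (w t))\<^sup>2) * indicator A t)
         + ennreal (1 + 1 / \<eta>) * (ennreal ((cmod (v t - w t))\<^sup>2) * indicator A t) \<partial>lborel)"
  proof (rule nn_integral_mono)
    fix t
    have "ennreal ((cmod (v t))\<^sup>2) \<le> ennreal ((1 + \<eta>) * (cmod (w t))\<^sup>2 + (1 + 1 / \<eta>) * (cmod (v t - w t))\<^sup>2)"
      by (intro ennreal_leI pt)
    also have "\<dots> = ennreal (1 + \<eta>) * ennreal ((cmod (w t))\<^sup>2) + ennreal (1 + 1 / \<eta>) * ennreal ((cmod (v t - w t))\<^sup>2)"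
      using \<eta> by (simp add: ennreal_plus ennreal_mult)
    finally show "ennreal ((cmod (v t))\<^sup>2) * indicator A t \<le> ennreal (1 + \<eta>) * (ennreal ((cmod (w t))\<^sup>2) * indicator A t)
         + ennreal (1 + 1 / \<eta>) * (ennreal ((cmod (v t - w t))\<^sup>2) * indicator A t)"
      by (auto split: split_indicator)
  qed
  also have "\<dots> = ennreal (1 + \<eta>) * (\<integral>\<^sup>+t\<in>A. ennreal ((cmod (w t))\<^sup>2) \<partial>lborel)
    + ennreal (1 + 1 / \<eta>) * (\<integral>\<^sup>+t\<in>A. ennreal ((cmod (v t - w t))\<^sup>2) \<partial>lborel)"
    by (subst nn_integral_add) (auto simp: nn_integral_cmult)
  finally show ?thesis .
qed

text \<open>In \<open>L2_bound\<close> the index n goes to infinity for fixed \<eta>, and then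
  \<eta> goes to 0.\<close>

lemma L2_lower_limit:
  fixes v :: "nat \<Rightarrow> real \<Rightarrow> complex" and w :: "real \<Rightarrow> complex"
  assumes meas: "\<And>n. v n \<in> borel_measurable borel" "w \<in> borel_measurable borel" "A \<in> sets borel"
    and lim: "(\<lambda>n. \<integral>\<^sup>+t\<in>A. ennreal ((cmod (v n t - w t))\<^sup>2) \<partial>lborel) \<longlonglongrightarrow> 0"
    and ev: "\<forall>\<^sub>F n in sequentially. ennreal \<beta> \<le> (\<integral>\<^sup>+t\<in>A. ennreal ((cmod (v n t))\<^sup>2) \<partial>lborel)"
  shows "ennreal \<beta> \<le> (\<integral>\<^sup>+t\<in>A. ennreal ((cmod (w t))\<^sup>2) \<partial>lborel)"
proof -
  define W where "W = (\<integral>\<^sup>+t\<in>A. ennreal ((cmod (w t))\<^sup>2) \<partial>lborel)"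
  have le: "ennreal \<beta> \<le> ennreal (1 + \<eta>) * W" if \<eta>: "\<eta> > 0" for \<eta>
  proof -
    have "(\<lambda>n. ennreal (1 + \<eta>) * W + ennreal (1 + 1 / \<eta>) * (\<integral>\<^sup>+t\<in>A. ennreal ((cmod (v n t - w t))\<^sup>2) \<partial>lborel))
       \<longlonglongrightarrow> ennreal (1 + \<eta>) * W + ennreal (1 + 1 / \<eta>) * 0"
      by (intro tendsto_add ennreal_tendsto_cmult tendsto_const lim) simp
    moreover have "\<forall>\<^sub>F n in sequentially. ennreal \<beta> \<le> ennreal (1 + \<eta>) * W
        + ennreal (1 + 1 / \<eta>) * (\<integral>\<^sup>+t\<in>A. ennreal ((cmod (v n t - w t))\<^sup>2) \<partial>lborel)"
      using ev by eventually_elim (use L2_bound[OF meas(1) meas(2,3) \<eta>] in \<open>auto simp: W_def intro: order_trans\<close>)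
    ultimately show ?thesis
      by (intro tendsto_lowerbound[where F = sequentially]) auto
  qed
  have "ennreal \<beta> \<le> W"
  proof (cases W)
    case (real x)
    have "\<beta> \<le> x"
    proof (rule field_le_epsilon)
      fix e :: real assume e: "e > 0"
      define \<eta> where "\<eta> = e / (x + 1)"
      have \<eta>: "\<eta> > 0" "\<eta> * x \<le> e" using e real by (auto simp: \<eta>_def field_simps)
      have "ennreal \<beta> \<le> ennreal ((1 + \<eta>) * x)" using le[OF \<eta>(1)] real \<eta>(1) by (simp add: ennreal_mult)
      then have "\<beta> \<le> (1 + \<eta>) * x" using real \<eta>(1) by (simp add: ennreal_le_iff)
      then show "\<beta> \<le> x + e" using \<eta>(2) by (simp add: algebra_simps)
    qed
    then show ?thesis using real by (simp add: ennreal_leI)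
  qed simp
  then show ?thesis by (simp add: W_def)
qed

lemma uniform_limit_inverse_length:
  fixes f :: "nat \<Rightarrow> real \<Rightarrow> real"
  assumes ul: "uniform_limit {a..b} f g sequentially" and c: "\<And>n. continuous_on {a..b} (f n)"
    and nz: "\<And>n t. t \<in> {a..b} \<Longrightarrow> f n t \<noteq> 0" and b: "b0 > 0" "\<And>t. t \<in> {a..b} \<Longrightarrow> b0 \<le> g t"
  shows "(\<lambda>n. integral {a..b} (\<lambda>t. 1 / f n t)) \<longlonglongrightarrow> integral {a..b} (\<lambda>t. 1 / g t)"
proof -
  have u: "uniform_limit {a..b} (\<lambda>n t. inverse (f n t)) (inverse \<circ> g) sequentially"
    by (rule uniform_lim_inverse[OF ul _ b(1)]) (use b in force)
  have c': "continuous_on {a..b} (\<lambda>t. inverse (f n t))" for n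
    by (intro continuous_intros c) (use nz in auto)
  obtain I J where I: "\<And>n. ((\<lambda>t. inverse (f n t)) has_integral I n) {a..b}"
      and J: "((inverse \<circ> g) has_integral J) {a..b}" and lim: "I \<longlonglongrightarrow> J"
    using uniform_limit_integral[OF u c' sequentially_bot] by blast
  have "integral {a..b} (\<lambda>t. 1 / f n t) = I n" for n
    using integral_unique[OF I[of n]] by (simp add: inverse_eq_divide)
  moreover have "integral {a..b} (\<lambda>t. 1 / g t) = J"
    using integral_unique[OF J] by (simp add: inverse_eq_divide o_def)
  ultimately show ?thesis using lim by simp
qed

lemma plane_loop_kin: "plane_loop.kin \<tau> u' = integral {0..\<tau>} (\<lambda>t. (cmod (u' t))\<^sup>2) / 2"
  if "plane_loop \<tau> u u'"
  using plane_loop.kin_def[OF that] by simp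

text \<open>Wirtinger's inequality for the limit loop, expressed by the velocities of the
  approximations: they eventually exceed every \<beta> below the sharp value. If u has no zero, the
  lengths \<open>len\<close> of the approximations converge to S. If it has one, the integrals of 1
  / |v n| need not converge, but those with the radius sqrt(|v n|^2 + \<epsilon>^2) do, and their
  limit is at most S.\<close>

lemma gordon_limit_kinetic:
  fixes v v' :: "nat \<Rightarrow> real \<Rightarrow> complex" and u :: "real \<Rightarrow> complex"
  assumes loops: "\<And>n. plane_loop \<tau> (v n) (v' n)"
    and ind: "\<And>n. ind0 \<tau> (v n) = of_int k" and odd: "odd k"
    and ul: "uniform_limit {0..\<tau>} v u sequentially" and cu: "continuous_on UNIV u"
    and S: "(\<integral>\<^sup>+t\<in>{0..\<tau>}. (if u t = 0 then \<infinity> else ennreal (1 / cmod (u t))) \<partial>lborel) = ennreal S" "S \<ge> 0"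
    and \<beta>: "\<beta> < 4 * pi\<^sup>2 * \<tau> / S\<^sup>2" and \<beta>0: "\<beta> \<ge> 0"
  shows "\<forall>\<^sub>F n in sequentially. \<beta> \<le> integral {0..\<tau>} (\<lambda>t. (cmod (v' n t))\<^sup>2)"
proof (cases "\<exists>t0\<in>{0..\<tau>}. u t0 = 0")
  case False
  interpret v: plane_loop \<tau> "v n" "v' n" for n by (rule loops)
  have \<tau>: "\<tau> > 0" by (rule v.tau)
  have cn: "continuous_on {0..\<tau>} (\<lambda>t. cmod (u t))" by (intro continuous_intros continuous_on_subset[OF cu]) auto
  have nzu: "u t \<noteq> 0" if "t \<in> {0..\<tau>}" for t using False that by blast
  obtain tm where tm: "tm \<in> {0..\<tau>}" "\<And>t. t \<in> {0..\<tau>} \<Longrightarrow> cmod (u tm) \<le> cmod (u t)"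
    using continuous_attains_inf[of "{0..\<tau>}", OF _ _ cn] \<tau> by auto
  have b: "cmod (u tm) > 0" using False tm by auto
  have lim: "(\<lambda>n. v.len n) \<longlonglongrightarrow> integral {0..\<tau>} (\<lambda>t. 1 / cmod (u t))"
    unfolding v.len_def
    by (rule uniform_limit_inverse_length[OF uniform_limit_norm[OF ul] _ _ b tm(2)])
      (auto intro!: continuous_intros v.cont simp: v.nz)
  have "ennreal S = (\<integral>\<^sup>+t\<in>{0..\<tau>}. ennreal (1 / cmod (u t)) \<partial>lborel)"
    unfolding S(1)[symmetric] using False by (intro nn_integral_cong) (auto split: split_indicator)
  also have "\<dots> = ennreal (integral {0..\<tau>} (\<lambda>t. 1 / cmod (u t)))"
    by (rule set_nn_integral_eq_integral) (use nzu cn in \<open>auto intro!: continuous_intros\<close>)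
  finally have Seq: "S = integral {0..\<tau>} (\<lambda>t. 1 / cmod (u t))"
    using S(2) by (subst (asm) ennreal_inj) (auto intro!: integral_nonneg integrable_continuous_real continuous_intros cn simp: nzu)
  have "S \<noteq> 0"
  proof -
    have "continuous_on {0..\<tau>} (\<lambda>t. 1 / cmod (u t))" by (intro continuous_intros cn) (simp add: nzu)
    from integral_eq_0_iff[OF this] show ?thesis using \<tau> nzu[of 0] unfolding Seq by auto
  qed
  then have "(\<lambda>n. 4 * pi\<^sup>2 * \<tau> / (v.len n)\<^sup>2) \<longlonglongrightarrow> 4 * pi\<^sup>2 * \<tau> / S\<^sup>2"
    using lim unfolding Seq by (intro tendsto_intros) auto
  then have "\<forall>\<^sub>F n in sequentially. \<beta> < 4 * pi\<^sup>2 * \<tau> / (v.len n)\<^sup>2"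
    using \<beta> by (rule order_tendstoD(1))
  then show ?thesis
  proof eventually_elim
    case (elim n)
    then show ?case using v.gordon_kinetic[OF ind odd, of n] plane_loop_kin[OF loops, of n] by simp
  qed
next
  case True
  interpret v: plane_loop \<tau> "v n" "v' n" for n by (rule loops)
  have \<tau>: "\<tau> > 0" by (rule v.tau)
  from True obtain t0 where t0: "t0 \<in> {0..\<tau>}" "u t0 = 0" by blast
  define r where "r \<epsilon> x = sqrt ((cmod x)\<^sup>2 + \<epsilon>\<^sup>2)" for \<epsilon> :: real and x :: complex
  have r_pos: "r \<epsilon> x > 0" "\<epsilon> \<le> r \<epsilon> x" "cmod x \<le> r \<epsilon> x" if "\<epsilon> > 0" for \<epsilon> x
    using that by (auto simp: r_def add_nonneg_pos intro!: real_le_rsqrt)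
  have r_cont: "continuous_on A (\<lambda>t. r \<epsilon> (f t))" if "continuous_on A f" for A \<epsilon> and f :: "real \<Rightarrow> complex"
    unfolding r_def by (intro continuous_intros that)
  have r_lip: "dist (r \<epsilon> x) (r \<epsilon> y) \<le> dist x y" for \<epsilon> x y
  proof -
    have "r \<epsilon> z = norm (Complex (cmod z) \<epsilon>)" for z by (simp add: r_def cmod_def)
    then have "dist (r \<epsilon> x) (r \<epsilon> y) \<le> norm (Complex (cmod x) \<epsilon> - Complex (cmod y) \<epsilon>)"
      by (simp add: dist_real_def norm_triangle_ineq3)
    also have "\<dots> = \<bar>cmod x - cmod y\<bar>" by (simp add: cmod_def)
    also have "\<dots> \<le> dist x y" by (simp add: dist_norm norm_triangle_ineq3)
    finally show ?thesis .
  qed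
  have Seps: "(\<lambda>n. integral {0..\<tau>} (\<lambda>t. 1 / r \<epsilon> (v n t))) \<longlonglongrightarrow> integral {0..\<tau>} (\<lambda>t. 1 / r \<epsilon> (u t))" if "\<epsilon> > 0" for \<epsilon>
  proof (rule uniform_limit_inverse_length[OF _ _ _ that])
    show "uniform_limit {0..\<tau>} (\<lambda>n t. r \<epsilon> (v n t)) (\<lambda>t. r \<epsilon> (u t)) sequentially"
      by (rule metric_uniform_limit_imp_uniform_limit[OF ul]) (use r_lip in auto)
    show "continuous_on {0..\<tau>} (\<lambda>t. r \<epsilon> (v n t))" for n by (rule r_cont[OF v.cont])
    show "r \<epsilon> (v n t) \<noteq> 0" for n t using r_pos(1)[OF that, of "v n t"] by simp
    show "\<epsilon> \<le> r \<epsilon> (u t)" for t by (rule r_pos(2)[OF that])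
  qed
  have c1: "continuous_on {0..\<tau>} (\<lambda>t. 1 / r \<epsilon> (u t))" if "\<epsilon> > 0" for \<epsilon>
    by (intro continuous_intros r_cont continuous_on_subset[OF cu]) (use r_pos(1)[OF that] in \<open>auto simp: less_imp_neq[THEN not_sym]\<close>)
  have S_eps_le: "integral {0..\<tau>} (\<lambda>t. 1 / r \<epsilon> (u t)) \<le> S" if "\<epsilon> > 0" for \<epsilon>
  proof -
    have "ennreal (integral {0..\<tau>} (\<lambda>t. 1 / r \<epsilon> (u t))) = (\<integral>\<^sup>+t\<in>{0..\<tau>}. ennreal (1 / r \<epsilon> (u t)) \<partial>lborel)"
      by (rule set_nn_integral_eq_integral[symmetric, OF c1[OF that]]) (use r_pos(1)[OF that] in \<open>auto intro: less_imp_le\<close>)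
    also have "\<dots> \<le> ennreal S" unfolding S(1)[symmetric]
    proof (intro nn_integral_mono mult_right_mono)
      fix t
      show "ennreal (1 / r \<epsilon> (u t)) \<le> (if u t = 0 then \<infinity> else ennreal (1 / cmod (u t)))"
        using r_pos[OF that, of "u t"] by (auto intro!: ennreal_leI divide_left_mono)
    qed simp
    finally show ?thesis using S(2) by (simp add: ennreal_le_iff)
  qed
  have "S > 0"
  proof -
    have "integral {0..\<tau>} (\<lambda>t. 1 / r 1 (u t)) \<noteq> 0"
      using integral_eq_0_iff[OF c1[of 1]] r_pos(1)[of 1] \<tau> by (auto simp: less_imp_le less_imp_neq[THEN not_sym])
    moreover have "integral {0..\<tau>} (\<lambda>t. 1 / r 1 (u t)) \<ge> 0"
      using r_pos(1)[of 1] by (intro integral_nonneg integrable_continuous_real c1) (auto intro: less_imp_le)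
    ultimately show ?thesis using S_eps_le[of 1] by simp
  qed
  have "\<beta> / (4 * \<tau>) < (pi / S)\<^sup>2" using \<beta> \<tau> \<open>S > 0\<close> by (simp add: field_simps)
  then obtain x where x: "\<beta> / (4 * \<tau>) < x" "x < (pi / S)\<^sup>2" using dense by blast
  have x0: "x > 0" using x(1) \<beta>0 \<tau> by (meson divide_nonneg_pos le_less_trans mult_pos_pos zero_less_numeral)
  \<comment> \<open>\<kappa> lies below pi / S while 4 \<kappa>^2 \<tau> still exceeds \<beta>; the
    excess pays for the boundary term of the collision inequality.\<close>
  define \<kappa> where "\<kappa> = sqrt x"
  have \<kappa>: "\<kappa> > 0" "\<beta> < 4 * \<kappa>\<^sup>2 * \<tau>" "\<kappa> < pi / S"
  proof -
    show "\<kappa> > 0" "\<beta> < 4 * \<kappa>\<^sup>2 * \<tau>" using x x0 \<tau> by (auto simp: \<kappa>_def field_simps)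
    show "\<kappa> < pi / S" unfolding \<kappa>_def using x(2) \<open>S > 0\<close> by (intro real_less_lsqrt) auto
  qed
  then have "S < pi / \<kappa>" using \<open>S > 0\<close> by (simp add: field_simps)
  \<comment> \<open>Room above S: the regularised lengths of the approximations tend to a limit of
    at most S, so they are eventually below \<open>S'\<close>.\<close>
  then obtain S' where S': "S < S'" "S' < pi / \<kappa>" using dense by blast
  then have \<kappa>S': "\<kappa> * S' < pi" using \<kappa>(1) by (simp add: field_simps)
  define K where "K = \<kappa> / sin ((pi - \<kappa> * S') / 2)"
  have "0 < \<kappa> * S'" using \<kappa>(1) \<open>S > 0\<close> S'(1) by simp
  moreover have "0 < (pi - y) / 2 \<and> (pi - y) / 2 < pi" if "0 < y" "y < pi" for y using that by auto
  ultimately have "0 < (pi - \<kappa> * S') / 2" "(pi - \<kappa> * S') / 2 < pi" using \<kappa>S' by blast+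
  then have K: "K > 0" unfolding K_def by (rule divide_pos_pos[OF \<kappa>(1) sin_gt_zero])
  define \<Delta> where "\<Delta> = 4 * \<kappa>\<^sup>2 * \<tau> - \<beta>"
  have \<Delta>: "\<Delta> > 0" using \<kappa>(2) unfolding \<Delta>_def by linarith
  \<comment> \<open>At the time of collision r will be at most 2 \<epsilon>, so four times the
    boundary term is at most 16 K \<epsilon>.\<close>
  define \<epsilon> where "\<epsilon> = \<Delta> / (32 * K)"
  have \<epsilon>: "\<epsilon> > 0" "16 * K * \<epsilon> \<le> \<Delta>" using \<Delta> K by (auto simp: \<epsilon>_def)
  have "\<forall>\<^sub>F n in sequentially. integral {0..\<tau>} (\<lambda>t. 1 / r \<epsilon> (v n t)) < S'"
    using Seps[OF \<epsilon>(1)] by (rule order_tendstoD(2)) (use S_eps_le[OF \<epsilon>(1)] S' in auto)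
  moreover have "\<forall>\<^sub>F n in sequentially. \<forall>t\<in>{0..\<tau>}. dist (v n t) (u t) < \<epsilon>"
    using uniform_limitD[OF ul \<epsilon>(1)] .
  ultimately show ?thesis
  proof eventually_elim
    case (elim n)
    have "\<kappa>\<^sup>2 * \<tau> - 2 * K * r \<epsilon> (v n t0) \<le> integral {0..\<tau>} (\<lambda>t. (cmod (v' n t))\<^sup>2) / 4"
      unfolding K_def r_def
      by (rule collision_wirtinger[OF \<tau> v.deriv v.cont' v.per v.per' \<epsilon>(1) _ \<kappa>(1) \<kappa>S'])
        (use elim(1) in \<open>auto simp: r_def\<close>)
    moreover have "r \<epsilon> (v n t0) \<le> 2 * \<epsilon>"
    proof -
      have "cmod (v n t0) < \<epsilon>" using bspec[OF elim(2) t0(1)] t0(2) by (simp add: dist_norm)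
      then have "(cmod (v n t0))\<^sup>2 \<le> \<epsilon>\<^sup>2" by (intro power_mono) auto
      moreover have "0 \<le> \<epsilon>\<^sup>2" "(2 * \<epsilon>)\<^sup>2 = 4 * \<epsilon>\<^sup>2" by (simp_all add: power_mult_distrib)
      ultimately have "(cmod (v n t0))\<^sup>2 + \<epsilon>\<^sup>2 \<le> (2 * \<epsilon>)\<^sup>2" by linarith
      then show ?thesis unfolding r_def using \<epsilon>(1) by (intro real_le_lsqrt) auto
    qed
    then have "2 * K * r \<epsilon> (v n t0) \<le> 2 * K * (2 * \<epsilon>)" using K by (intro mult_left_mono) auto
    ultimately have "4 * \<kappa>\<^sup>2 * \<tau> - 16 * K * \<epsilon> \<le> integral {0..\<tau>} (\<lambda>t. (cmod (v' n t))\<^sup>2)" by simp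
    then show ?case using \<epsilon>(2) unfolding \<Delta>_def by linarith
  qed
qed

text \<open>If the integral of 1 / |u| is infinite, so is the right side. If it has a finite value
  S, the bound 4 pi^2 \<tau> / S^2 survives the L2 limit of the velocities, and
  \<open>gordon_bound_le\<close> combines its half with \<delta> S.\<close>

lemma gordon_limit:
  fixes v v' :: "nat \<Rightarrow> real \<Rightarrow> complex" and u w :: "real \<Rightarrow> complex"
  assumes loops: "\<And>n. plane_loop \<tau> (v n) (v' n)"
    and ind: "\<And>n. ind0 \<tau> (v n) = of_int k" and odd: "odd k" and \<delta>: "\<delta> > 0"
    and ul: "uniform_limit {0..\<tau>} v u sequentially" and cu: "continuous_on UNIV u"
    and w: "w \<in> borel_measurable borel"
    and lim: "(\<lambda>n. \<integral>\<^sup>+t\<in>{0..\<tau>}. ennreal ((cmod (v' n t - w t))\<^sup>2) \<partial>lborel) \<longlonglongrightarrow> 0"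
  shows "ennreal (gordon_bound \<tau> \<delta>) \<le> (\<integral>\<^sup>+t\<in>{0..\<tau>}. ennreal ((cmod (w t))\<^sup>2 / 2)
      + (if u t = 0 then \<infinity> else ennreal (\<delta> / cmod (u t))) \<partial>lborel)"
proof -
  have \<tau>: "\<tau> > 0" using loops[of 0] by (simp add: plane_loop_def)
  have [measurable]: "u \<in> borel_measurable borel" by (rule borel_measurable_continuous_onI[OF cu])
  note w[measurable]
  define V where "V t = (if u t = 0 then \<infinity> else ennreal (1 / cmod (u t)))" for t
  have V[measurable]: "V \<in> borel_measurable borel" unfolding V_def by measurable
  define SS where "SS = (\<integral>\<^sup>+t\<in>{0..\<tau>}. V t \<partial>lborel)"
  define W where "W = (\<integral>\<^sup>+t\<in>{0..\<tau>}. ennreal ((cmod (w t))\<^sup>2) \<partial>lborel)"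
  have half: "ennreal ((cmod (w t))\<^sup>2 / 2) = ennreal (1/2) * ennreal ((cmod (w t))\<^sup>2)" for t
    by (subst ennreal_mult[symmetric]) auto
  have "(\<integral>\<^sup>+t\<in>{0..\<tau>}. ennreal ((cmod (w t))\<^sup>2 / 2) + (if u t = 0 then \<infinity> else ennreal (\<delta> / cmod (u t))) \<partial>lborel)
     = (\<integral>\<^sup>+t. ennreal (1/2) * (ennreal ((cmod (w t))\<^sup>2) * indicator {0..\<tau>} t) + ennreal \<delta> * (V t * indicator {0..\<tau>} t) \<partial>lborel)"
    unfolding half using \<delta> by (intro nn_integral_cong)
      (auto simp: V_def ennreal_mult_top ennreal_mult[symmetric] split: split_indicator)
  also have "\<dots> = ennreal (1/2) * W + ennreal \<delta> * SS"
    unfolding W_def SS_def by (subst nn_integral_add) (auto simp: nn_integral_cmult)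
  finally have eq: "(\<integral>\<^sup>+t\<in>{0..\<tau>}. ennreal ((cmod (w t))\<^sup>2 / 2) + (if u t = 0 then \<infinity> else ennreal (\<delta> / cmod (u t))) \<partial>lborel)
     = ennreal (1/2) * W + ennreal \<delta> * SS" .
  show ?thesis
  proof (cases SS)
    case top
    then show ?thesis unfolding eq using \<delta> by (simp add: ennreal_mult_top)
  next
    case (real S)
    have "ennreal (4 * pi\<^sup>2 * \<tau> / S\<^sup>2) \<le> W"
    proof (rule ennreal_le_of_lt)
      fix \<beta> :: real assume \<beta>: "0 \<le> \<beta>" "\<beta> < 4 * pi\<^sup>2 * \<tau> / S\<^sup>2"
      have "\<forall>\<^sub>F n in sequentially. \<beta> \<le> integral {0..\<tau>} (\<lambda>t. (cmod (v' n t))\<^sup>2)"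
        by (rule gordon_limit_kinetic[OF loops ind odd ul cu _ _ \<beta>(2,1)])
          (use real in \<open>auto simp: SS_def V_def\<close>)
      then have "\<forall>\<^sub>F n in sequentially. ennreal \<beta> \<le> (\<integral>\<^sup>+t\<in>{0..\<tau>}. ennreal ((cmod (v' n t))\<^sup>2) \<partial>lborel)"
      proof eventually_elim
        case (elim n)
        have "continuous_on {0..\<tau>} (v' n)"
          using plane_loop.cont'[OF loops] by (rule continuous_on_subset) simp
        then have "(\<integral>\<^sup>+t\<in>{0..\<tau>}. ennreal ((cmod (v' n t))\<^sup>2) \<partial>lborel) = ennreal (integral {0..\<tau>} (\<lambda>t. (cmod (v' n t))\<^sup>2))"
          by (intro set_nn_integral_eq_integral continuous_intros) auto
        then show ?case using elim by (simp add: ennreal_leI)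
      qed
      then show "ennreal \<beta> \<le> W" unfolding W_def
        by (intro L2_lower_limit[OF _ w _ lim]) (auto intro: borel_measurable_continuous_onI[OF plane_loop.cont'[OF loops]])
    qed
    then have le: "ennreal (1/2) * ennreal (4 * pi\<^sup>2 * \<tau> / S\<^sup>2) + ennreal \<delta> * SS \<le> ennreal (1/2) * W + ennreal \<delta> * SS"
      by (intro add_right_mono mult_left_mono) auto
    have "S \<noteq> 0"
    proof
      assume "S = 0"
      then have "(\<integral>\<^sup>+t. V t * indicator {0..\<tau>} t \<partial>lborel) = 0" using real by (simp add: SS_def)
      then have "AE t in lborel. V t * indicator {0..\<tau>} t = 0" by (subst (asm) nn_integral_0_iff_AE) auto
      then have "AE t in lborel. t \<notin> {0..\<tau>}" by eventually_elim (auto simp: V_def split: split_indicator_asm if_splits)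
      then have "emeasure lborel {0..\<tau>} = 0" by (subst (asm) AE_iff_measurable[of "{0..\<tau>}"]) auto
      then show False using \<tau> by simp
    qed
    then have "S > 0" using real by simp
    have "gordon_bound \<tau> \<delta> \<le> 2 * pi\<^sup>2 * \<tau> / S\<^sup>2 + \<delta> * S"
      by (rule gordon_bound_le(1)[OF \<tau> \<delta> \<open>S > 0\<close>])
    then have "ennreal (gordon_bound \<tau> \<delta>) \<le> ennreal ((1/2) * (4 * pi\<^sup>2 * \<tau> / S\<^sup>2) + \<delta> * S)"
      by (intro ennreal_leI) (simp add: mult_ac)
    also have "\<dots> = ennreal (1/2) * ennreal (4 * pi\<^sup>2 * \<tau> / S\<^sup>2) + ennreal \<delta> * SS"
    proof -
      have "ennreal (1/2) * ennreal (4 * pi\<^sup>2 * \<tau> / S\<^sup>2) = ennreal ((1/2) * (4 * pi\<^sup>2 * \<tau> / S\<^sup>2))"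
        using \<tau> by (intro ennreal_mult[symmetric]) auto
      moreover have "ennreal \<delta> * SS = ennreal (\<delta> * S)" using real \<delta> by (simp add: ennreal_mult)
      ultimately show ?thesis using \<tau> \<delta> \<open>S > 0\<close> by (simp only:) (intro ennreal_plus; simp)
    qed
    finally show ?thesis unfolding eq using le by (rule order_trans)
  qed
qed


section \<open>From Sobolev convergence to uniform convergence\<close>

text \<open>Bounded kinetic energy makes the p n equicontinuous. A deviation of size e from q at one
  time therefore persists, at size e / 4, on an interval whose length does not depend on n, against
  convergence in L2.\<close>

lemma sobolev_uniform_limit:
  fixes p p' :: "nat \<Rightarrow> real \<Rightarrow> complex" and q w :: "real \<Rightarrow> complex"
  assumes \<tau>: "\<tau> > 0"
    and p: "\<And>n t. (p n has_vector_derivative p' n t) (at t)" "\<And>n. continuous_on UNIV (p' n)"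
    and q: "continuous_on {0..\<tau>} q" and w: "w \<in> borel_measurable borel"
    and lim': "(\<lambda>n. \<integral>\<^sup>+t\<in>{0..\<tau>}. ennreal ((cmod (p' n t - w t))\<^sup>2) \<partial>lborel) \<longlonglongrightarrow> 0"
    and lim: "(\<lambda>n. \<integral>\<^sup>+t\<in>{0..\<tau>}. ennreal ((cmod (p n t - q t))\<^sup>2) \<partial>lborel) \<longlonglongrightarrow> 0"
  shows "uniform_limit {0..\<tau>} p q sequentially"
proof -
  have cp: "continuous_on A (p n)" for n A by (rule has_vector_derivative_imp_continuous_UNIV[OF p(1)])
  have cp': "continuous_on A (p' n)" for n A by (rule continuous_on_subset[OF p(2)]) simp
  have bp': "p' n \<in> borel_measurable borel" for n by (rule borel_measurable_continuous_onI[OF p(2)])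
  have int_p': "(\<integral>\<^sup>+t\<in>{0..\<tau>}. ennreal ((cmod (p' n t))\<^sup>2) \<partial>lborel) = ennreal (integral {0..\<tau>} (\<lambda>t. (cmod (p' n t))\<^sup>2))" for n
    by (intro set_nn_integral_eq_integral continuous_intros cp') auto
  define d where "d n = (\<integral>\<^sup>+t\<in>{0..\<tau>}. ennreal ((cmod (p' n t - w t))\<^sup>2) \<partial>lborel)" for n
  define W where "W = (\<integral>\<^sup>+t\<in>{0..\<tau>}. ennreal ((cmod (w t))\<^sup>2) \<partial>lborel)"
  have dev: "\<forall>\<^sub>F n in sequentially. d n < 1"
    using lim' unfolding d_def by (rule order_tendstoD(2)) simp
  have "W < \<infinity>"
  proof -
    obtain n where n: "d n < 1" using dev by (metis eventually_sequentially order_refl)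
    have "W \<le> ennreal (1 + 1) * ennreal (integral {0..\<tau>} (\<lambda>t. (cmod (p' n t))\<^sup>2)) + ennreal (1 + 1 / 1) * d n"
      using L2_bound[OF w bp', of "{0..\<tau>}" 1 n] unfolding W_def d_def int_p' by (simp add: norm_minus_commute)
    also have "\<dots> < \<infinity>"
    proof -
      have "d n < top" using n by (rule order.strict_trans) simp
      then show ?thesis by (simp add: ennreal_mult_less_top)
    qed
    finally show ?thesis .
  qed
  then obtain Wr where Wr: "W = ennreal Wr" "Wr \<ge> 0" by (cases W) auto
  define M where "M = 2 * Wr + 3"
  have M: "M > 0" using Wr by (simp add: M_def)
  have evM: "\<forall>\<^sub>F n in sequentially. integral {0..\<tau>} (\<lambda>t. (cmod (p' n t))\<^sup>2) \<le> M"
    using dev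
  proof eventually_elim
    case (elim n)
    have "ennreal (integral {0..\<tau>} (\<lambda>t. (cmod (p' n t))\<^sup>2)) \<le> ennreal (1 + 1) * W + ennreal (1 + 1 / 1) * d n"
      using L2_bound[OF bp' w, of "{0..\<tau>}" 1 n] unfolding W_def d_def int_p' by simp
    also have "\<dots> \<le> ennreal (1 + 1) * ennreal Wr + ennreal (1 + 1 / 1) * ennreal 1"
      unfolding Wr using elim by (intro add_left_mono mult_left_mono) auto
    also have "\<dots> = ennreal (2 * Wr + 2)" using Wr by (simp add: ennreal_mult)
    finally have "integral {0..\<tau>} (\<lambda>t. (cmod (p' n t))\<^sup>2) \<le> 2 * Wr + 2"
      using Wr by (subst (asm) ennreal_le_iff) auto
    then show ?case by (simp add: M_def)
  qed
  \<comment> \<open>The inequality |p'| <= c |p'|^2 + 1 / c with free c replaces the Cauchy-Schwarz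
    inequality: a small c handles the first term, then a short interval the second.\<close>
  have hoelder: "cmod (p n t - p n s) \<le> c * M + (t - s) / c"
    if n: "integral {0..\<tau>} (\<lambda>t. (cmod (p' n t))\<^sup>2) \<le> M" and st: "0 \<le> s" "s \<le> t" "t \<le> \<tau>" and c: "c > 0" for n s t c
  proof -
    have "(p' n has_integral (p n t - p n s)) {s..t}"
      using st by (intro fundamental_theorem_of_calculus) (auto intro: has_vector_derivative_at_within p)
    then have "cmod (p n t - p n s) \<le> integral {s..t} (\<lambda>t. c * (cmod (p' n t))\<^sup>2 + 1 / c)"
    proof (rule integral_unique[THEN subst])
      show "cmod (integral {s..t} (p' n)) \<le> integral {s..t} (\<lambda>t. c * (cmod (p' n t))\<^sup>2 + 1 / c)"
      proof (rule integral_norm_bound_integral)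
        fix x
        have "0 \<le> (c * cmod (p' n x) - 1)\<^sup>2" by simp
        then have "2 * c * cmod (p' n x) \<le> c\<^sup>2 * (cmod (p' n x))\<^sup>2 + 1"
          by (simp add: power2_eq_square algebra_simps)
        moreover have "0 \<le> c\<^sup>2 * (cmod (p' n x))\<^sup>2 + 1" by simp
        ultimately have "c * cmod (p' n x) \<le> c\<^sup>2 * (cmod (p' n x))\<^sup>2 + 1" by linarith
        then show "cmod (p' n x) \<le> c * (cmod (p' n x))\<^sup>2 + 1 / c"
          using c by (simp add: field_simps power2_eq_square)
      qed (intro integrable_continuous_real continuous_intros cp')+
    qed
    also have "\<dots> = c * integral {s..t} (\<lambda>t. (cmod (p' n t))\<^sup>2) + (t - s) / c"
      using st by (subst integral_add) (auto intro!: integrable_continuous_real continuous_intros cp')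
    also have "integral {s..t} (\<lambda>t. (cmod (p' n t))\<^sup>2) \<le> integral {0..\<tau>} (\<lambda>t. (cmod (p' n t))\<^sup>2)"
      using st by (intro integral_subset_le integrable_continuous_real continuous_intros cp') auto
    finally show ?thesis using n c by (smt (verit) mult_left_mono)
  qed
  show ?thesis
  proof (rule uniform_limitI)
    fix e :: real assume "e > 0"
    define \<epsilon> where "\<epsilon> = e / 4"
    have \<epsilon>: "\<epsilon> > 0" using \<open>e > 0\<close> by (simp add: \<epsilon>_def)
    obtain \<eta>1 where \<eta>1: "\<eta>1 > 0" "\<And>s t. s \<in> {0..\<tau>} \<Longrightarrow> t \<in> {0..\<tau>} \<Longrightarrow> dist t s < \<eta>1 \<Longrightarrow> dist (q t) (q s) < \<epsilon>"
      using compact_uniformly_continuous[OF q] \<epsilon> unfolding uniformly_continuous_on_def by (metis compact_Icc)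
    define c where "c = \<epsilon> / (2 * M)"
    have c: "c > 0" "c * M = \<epsilon> / 2" using \<epsilon> M by (auto simp: c_def)
    define \<eta> where "\<eta> = min (min (\<eta>1 / 2) (c * \<epsilon> / 2)) (\<tau> / 2)"
    have \<eta>: "\<eta> > 0" "\<eta> < \<eta>1" "\<eta> / c \<le> \<epsilon> / 2" "\<eta> \<le> \<tau> / 2"
      using \<eta>1 c \<epsilon> \<tau> by (auto simp: \<eta>_def field_simps min_def)
    have "\<forall>\<^sub>F n in sequentially. (\<integral>\<^sup>+t\<in>{0..\<tau>}. ennreal ((cmod (p n t - q t))\<^sup>2) \<partial>lborel) < ennreal (\<epsilon>\<^sup>2 * \<eta>)"
      using lim by (rule order_tendstoD(2)) (use \<epsilon> \<eta> in simp)
    with evM show "\<forall>\<^sub>F n in sequentially. \<forall>t\<in>{0..\<tau>}. dist (p n t) (q t) < e"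
    proof eventually_elim
      case (elim n)
      show ?case
      proof (rule ccontr)
        assume "\<not> (\<forall>t\<in>{0..\<tau>}. dist (p n t) (q t) < e)"
        then obtain t where t: "t \<in> {0..\<tau>}" "dist (p n t) (q t) \<ge> 4 * \<epsilon>" by (auto simp: \<epsilon>_def not_less)
        \<comment> \<open>The interval of length \<eta> is placed on the side of t where it fits
          into one period.\<close>
        define a where "a = (if t \<le> \<tau> / 2 then t else t - \<eta>)"
        have a: "{a..a+\<eta>} \<subseteq> {0..\<tau>}" "\<And>s. s \<in> {a..a+\<eta>} \<Longrightarrow> \<bar>s - t\<bar> \<le> \<eta>"
          using t \<eta> by (auto simp: a_def split: if_splits)
        have far: "\<epsilon> \<le> cmod (p n s - q s)" if s: "s \<in> {a..a+\<eta>}" for s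
        proof -
          have s': "s \<in> {0..\<tau>}" "\<bar>s - t\<bar> \<le> \<eta>" using a s by auto
          have "cmod (p n t - p n s) \<le> c * M + \<bar>t - s\<bar> / c"
          proof (cases "s \<le> t")
            case True
            then show ?thesis using hoelder[OF elim(1), of s t c] s' t c by auto
          next
            case False
            then show ?thesis using hoelder[OF elim(1), of t s c] s' t c by (auto simp: norm_minus_commute)
          qed
          also have "\<dots> \<le> \<epsilon> / 2 + \<eta> / c"
            using s' c by (intro add_mono divide_right_mono) auto
          also have "\<dots> \<le> \<epsilon>" using \<eta>(3) by linarith
          finally have 1: "dist (p n t) (p n s) \<le> \<epsilon>" by (simp add: dist_norm)
          have 2: "dist (q t) (q s) < \<epsilon>"
            by (rule \<eta>1(2)) (use s' t \<eta> in \<open>auto simp: dist_real_def\<close>)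
          have "dist (p n t) (q t) \<le> dist (p n t) (p n s) + dist (p n s) (q s) + dist (q t) (q s)"
            by (metis add.commute add_left_mono dist_commute dist_triangle dist_triangle_le)
          then show ?thesis using 1 2 t(2) \<epsilon> by (simp add: dist_norm)
        qed
        have "ennreal (\<epsilon>\<^sup>2 * \<eta>) = (\<integral>\<^sup>+s. ennreal (\<epsilon>\<^sup>2) * indicator {a..a+\<eta>} s \<partial>lborel)"
          using \<eta>(1) by (simp add: nn_integral_cmult ennreal_mult)
        also have "\<dots> \<le> (\<integral>\<^sup>+t\<in>{0..\<tau>}. ennreal ((cmod (p n t - q t))\<^sup>2) \<partial>lborel)"
        proof (rule nn_integral_mono)
          fix s
          show "ennreal (\<epsilon>\<^sup>2) * indicator {a..a+\<eta>} s \<le> ennreal ((cmod (p n s - q s))\<^sup>2) * indicator {0..\<tau>} s"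
          proof (cases "s \<in> {a..a+\<eta>}")
            case True
            then show ?thesis using a(1) far[OF True] \<epsilon>
              by (auto intro!: ennreal_leI power_mono simp: indicator_def)
          qed auto
        qed
        finally show False using elim(2) by simp
      qed
    qed
  qed
qed

definition velocity :: "(real \<Rightarrow> nat \<Rightarrow> complex) \<Rightarrow> nat \<Rightarrow> real \<Rightarrow> complex" where
  "velocity q i t = vector_derivative (\<lambda>s. q s i) (at t)"

lemma bodies_simps: "finite bodies" "1 \<in> bodies" "2 \<in> bodies" "3 \<in> bodies"
  by (auto simp: bodies_def)

lemma Omega_velocity:
  assumes "q \<in> Omega m \<tau> k" "i \<in> bodies"
  shows "((\<lambda>t. q t i) has_vector_derivative velocity q i t) (at t)" "continuous_on UNIV (velocity q i)"
    "q (t + \<tau>) i = q t i"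
proof -
  have "smooth_fun (\<lambda>t. q t i)" "periodic_path \<tau> (\<lambda>t. q t i)" using assms by (auto simp: Omega_def)
  then obtain D where D: "D 0 = (\<lambda>t. q t i)" "\<And>n t. (D n has_vector_derivative D (Suc n) t) (at t)"
    unfolding smooth_fun_def by blast
  have v: "velocity q i t = D 1 t" for t
    unfolding velocity_def using D(2)[of 0 t] D(1) by (simp add: vector_derivative_at)
  show "((\<lambda>t. q t i) has_vector_derivative velocity q i t) (at t)"
    using D(2)[of 0 t] by (simp add: v D(1))
  have "continuous_on UNIV (D 1)" by (rule has_vector_derivative_imp_continuous_UNIV[OF D(2)])
  then show "continuous_on UNIV (velocity q i)" by (simp add: v[abs_def])
  show "q (t + \<tau>) i = q t i" using \<open>periodic_path \<tau> (\<lambda>t. q t i)\<close> by (simp add: periodic_path_def)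
qed

text \<open>The Sobolev distance dominates the L2 distance of each position and each velocity. The
  Borel function \<open>w i\<close> agrees with the velocity at every time of the period, so it may
  replace it in all integrals; periodicity extends the uniform convergence to all times.\<close>

lemma Xspace_approximation:
  assumes q: "q \<in> Xspace m \<tau> k" and \<tau>: "\<tau> > 0"
  obtains p w where "\<And>n. p n \<in> Omega m \<tau> k"
    "\<And>i. i \<in> bodies \<Longrightarrow> w i \<in> borel_measurable borel"
    "\<And>i t. i \<in> bodies \<Longrightarrow> t \<in> {0..\<tau>} \<Longrightarrow> w i t = velocity q i t"
    "\<And>i. i \<in> bodies \<Longrightarrow> (\<lambda>n. \<integral>\<^sup>+t\<in>{0..\<tau>}. ennreal ((cmod (velocity (p n) i t - w i t))\<^sup>2) \<partial>lborel) \<longlonglongrightarrow> 0"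
    "\<And>i. i \<in> bodies \<Longrightarrow> uniform_limit UNIV (\<lambda>n t. p n t i) (\<lambda>t. q t i) sequentially"
proof -
  from q obtain p where W: "W12 \<tau> q" and p: "\<And>n. p n \<in> Omega m \<tau> k"
    and lim: "(\<lambda>n. W12_dist2 \<tau> (p n) q) \<longlonglongrightarrow> 0"
    by (auto simp: Xspace_def)
  have cq: "continuous_on {0..\<tau>} (\<lambda>t. q t i)" if "i \<in> bodies" for i
  proof -
    from W that obtain v where v: "v absolutely_integrable_on {0..\<tau>}"
        "\<forall>t\<in>{0..\<tau>}. q t i = q 0 i + integral {0..t} v"
      unfolding W12_def by blast
    have "continuous_on {0..\<tau>} (\<lambda>t. q 0 i + integral {0..t} v)"
      by (intro continuous_intros indefinite_integral_continuous_1 set_lebesgue_integral_eq_integral(1) v(1))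
    then show ?thesis by (rule continuous_on_eq) (rule v(2)[rule_format, symmetric])
  qed
  have "\<forall>i\<in>bodies. \<exists>g. g \<in> borel_measurable borel \<and> (\<forall>t\<in>{0..\<tau>}. g t = velocity q i t)"
  proof
    fix i assume "i \<in> bodies"
    show "\<exists>g. g \<in> borel_measurable borel \<and> (\<forall>t\<in>{0..\<tau>}. g t = velocity q i t)"
      by (rule vector_derivative_borel[OF cq[OF \<open>i \<in> bodies\<close>] \<tau>]) (auto simp: velocity_def)
  qed
  from bchoice[OF this] obtain w where
    "\<forall>i\<in>bodies. w i \<in> borel_measurable borel \<and> (\<forall>t\<in>{0..\<tau>}. w i t = velocity q i t)" ..
  then have w: "\<And>i. i \<in> bodies \<Longrightarrow> w i \<in> borel_measurable borel"
     "\<And>i t. i \<in> bodies \<Longrightarrow> t \<in> {0..\<tau>} \<Longrightarrow> w i t = velocity q i t" by blast+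
  have sum_le: "f i \<le> (\<Sum>i\<in>bodies. f i)" if "i \<in> bodies" "\<And>i. f i \<ge> 0" for f :: "nat \<Rightarrow> real" and i
    using that by (intro member_le_sum) (auto simp: bodies_simps)
  have lim': "(\<lambda>n. \<integral>\<^sup>+t\<in>{0..\<tau>}. ennreal ((cmod (velocity (p n) i t - w i t))\<^sup>2) \<partial>lborel) \<longlonglongrightarrow> 0"
    if i: "i \<in> bodies" for i
  proof (rule tendsto_sandwich[OF _ _ tendsto_const lim])
    show "\<forall>\<^sub>F n in sequentially. (\<integral>\<^sup>+t\<in>{0..\<tau>}. ennreal ((cmod (velocity (p n) i t - w i t))\<^sup>2) \<partial>lborel) \<le> W12_dist2 \<tau> (p n) q"
      unfolding W12_dist2_def velocity_def[symmetric]
    proof (intro always_eventually allI nn_integral_mono)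
      fix n t
      show "ennreal ((cmod (velocity (p n) i t - w i t))\<^sup>2) * indicator {0..\<tau>} t \<le> ennreal (\<Sum>i\<in>bodies. (cmod (p n t i - q t i))\<^sup>2
         + (cmod (velocity (p n) i t - velocity q i t))\<^sup>2) * indicator {0..\<tau>} t"
        using w(2)[OF i, of t] sum_le[OF i, of "\<lambda>i. (cmod (p n t i - q t i))\<^sup>2 + (cmod (velocity (p n) i t - velocity q i t))\<^sup>2"]
        by (auto split: split_indicator intro!: ennreal_leI simp: add_increasing)
           (smt (verit) zero_le_power2)
    qed
  qed simp
  have lim0: "(\<lambda>n. \<integral>\<^sup>+t\<in>{0..\<tau>}. ennreal ((cmod (p n t i - q t i))\<^sup>2) \<partial>lborel) \<longlonglongrightarrow> 0"
    if i: "i \<in> bodies" for i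
  proof (rule tendsto_sandwich[OF _ _ tendsto_const lim])
    show "\<forall>\<^sub>F n in sequentially. (\<integral>\<^sup>+t\<in>{0..\<tau>}. ennreal ((cmod (p n t i - q t i))\<^sup>2) \<partial>lborel) \<le> W12_dist2 \<tau> (p n) q"
      unfolding W12_dist2_def velocity_def[symmetric]
    proof (intro always_eventually allI nn_integral_mono)
      fix n t
      show "ennreal ((cmod (p n t i - q t i))\<^sup>2) * indicator {0..\<tau>} t \<le> ennreal (\<Sum>i\<in>bodies. (cmod (p n t i - q t i))\<^sup>2
         + (cmod (velocity (p n) i t - velocity q i t))\<^sup>2) * indicator {0..\<tau>} t"
        using sum_le[OF i, of "\<lambda>i. (cmod (p n t i - q t i))\<^sup>2 + (cmod (velocity (p n) i t - velocity q i t))\<^sup>2"]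
        by (auto split: split_indicator intro!: ennreal_leI)
           (smt (verit) zero_le_power2)
    qed
  qed simp
  have ul: "uniform_limit {0..\<tau>} (\<lambda>n t. p n t i) (\<lambda>t. q t i) sequentially" if i: "i \<in> bodies" for i
    by (rule sobolev_uniform_limit[OF \<tau> Omega_velocity(1)[OF p i] Omega_velocity(2)[OF p i] cq[OF i] w(1)[OF i] lim'[OF i] lim0[OF i]])
  have "uniform_limit UNIV (\<lambda>n t. p n t i) (\<lambda>t. q t i) sequentially" if i: "i \<in> bodies" for i
  proof (rule uniform_limitI)
    fix e :: real assume "e > 0"
    have perq: "q (t + \<tau>) i = q t i" for t using W i by (simp add: W12_def periodic_path_def)
    from uniform_limitD[OF ul[OF i] \<open>e > 0\<close>]
    show "\<forall>\<^sub>F n in sequentially. \<forall>t\<in>UNIV. dist (p n t i) (q t i) < e"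
    proof eventually_elim
      case (elim n)
      show ?case
      proof
        fix t :: real
        obtain l :: int where "t + of_int l * \<tau> \<in> {0..<\<tau>}" using periodic_representative[OF \<tau>] by blast
        then have "dist (p n (t + of_int l * \<tau>) i) (q (t + of_int l * \<tau>) i) < e" using elim by auto
        moreover have "p n (t + of_int l * \<tau>) i = p n t i"
          by (rule periodic_integer_shift[of "\<lambda>t. p n t i"]) (rule Omega_velocity(3)[OF p i])
        moreover have "q (t + of_int l * \<tau>) i = q t i"
          by (rule periodic_integer_shift[of "\<lambda>t. q t i"]) (rule perq)
        ultimately show "dist (p n t i) (q t i) < e" by simp
      qed
    qed
  qed
  then show thesis using that[OF p w lim'] by blast
qed

section \<open>The charged three-body problem\<close>


abbreviation diff :: "(real \<Rightarrow> nat \<Rightarrow> complex) \<Rightarrow> nat \<Rightarrow> nat \<Rightarrow> real \<Rightarrow> complex" where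
  "diff q i j t \<equiv> q t i - q t j"

definition pairs :: "(nat \<times> nat) set" where "pairs = {(1,2),(2,3),(3,1)}"

lemma pairs_bodies: "(i, j) \<in> pairs \<Longrightarrow> i \<in> bodies \<and> j \<in> bodies \<and> i \<noteq> j"
  by (auto simp: pairs_def bodies_def)

lemma sum_pairs: "(\<Sum>(i,j)\<in>pairs. f i j) = f 1 2 + f 2 3 + f 3 1"
  by (simp add: pairs_def add.assoc)

lemma sum_bodies: "(\<Sum>i\<in>bodies. f i) = f 1 + f 2 + f 3"
  by (simp add: bodies_def add.assoc)

lemma kidx_odd: "k = (1,1,1) \<or> k = (-1,-1,-1) \<Longrightarrow> kidx k i j = 1 \<or> kidx k i j = -1"
  by (auto simp: kidx_def)

lemma Omega_diff:
  assumes q: "q \<in> Omega m \<tau> k" and \<tau>: "\<tau> > 0" and ij: "(i, j) \<in> pairs"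
  shows "plane_loop \<tau> (diff q i j) (\<lambda>t. velocity q i t - velocity q j t)"
    and "ind0 \<tau> (diff q i j) = of_int (kidx k i j)"
proof -
  note b = pairs_bodies[OF ij]
  show "plane_loop \<tau> (diff q i j) (\<lambda>t. velocity q i t - velocity q j t)"
  proof
    fix t
    show "(diff q i j has_vector_derivative velocity q i t - velocity q j t) (at t)"
      by (intro has_vector_derivative_diff Omega_velocity[OF q]) (use b in auto)
    show "diff q i j (t + \<tau>) = diff q i j t" using Omega_velocity(3)[OF q] b by simp
    show "diff q i j t \<noteq> 0" using q b by (auto simp: Omega_def)
  qed (use \<tau> Omega_velocity(2)[OF q] b in \<open>auto intro!: continuous_intros\<close>)
  show "ind0 \<tau> (diff q i j) = of_int (kidx k i j)"
    using q ij by (auto simp: Omega_def pairs_def)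
qed

context
  fixes m :: "nat \<Rightarrow> real" and \<tau> :: real and k q
  assumes q: "q \<in> Xspace m \<tau> k" and \<tau>: "\<tau> > 0"
begin

lemma Xspace_periodic: "i \<in> bodies \<Longrightarrow> q (t + \<tau>) i = q t i"
  using q by (auto simp: Xspace_def W12_def periodic_path_def)

lemma Xspace_continuous: "i \<in> bodies \<Longrightarrow> continuous_on UNIV (\<lambda>t. q t i)"
proof -
  assume i: "i \<in> bodies"
  obtain p w where p: "\<And>n. p n \<in> Omega m \<tau> k"
    and ul: "\<And>i. i \<in> bodies \<Longrightarrow> uniform_limit UNIV (\<lambda>n t. p n t i) (\<lambda>t. q t i) sequentially"
    by (rule Xspace_approximation[OF q \<tau>]) blast
  show ?thesis
    by (rule uniform_limit_theorem[OF _ ul[OF i]])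
      (auto intro!: always_eventually has_vector_derivative_imp_continuous_UNIV[OF Omega_velocity(1)[OF p i]])
qed

lemma Xspace_center_of_mass: "(\<Sum>i\<in>bodies. of_real (m i) * q t i) = 0"
proof -
  obtain p w where p: "\<And>n. p n \<in> Omega m \<tau> k"
    and ul: "\<And>i. i \<in> bodies \<Longrightarrow> uniform_limit UNIV (\<lambda>n t. p n t i) (\<lambda>t. q t i) sequentially"
    by (rule Xspace_approximation[OF q \<tau>]) blast
  have "(\<lambda>n. \<Sum>i\<in>bodies. of_real (m i) * p n t i) \<longlonglongrightarrow> (\<Sum>i\<in>bodies. of_real (m i) * q t i)"
    by (intro tendsto_intros tendsto_uniform_limitI[OF ul]) auto
  moreover have "(\<Sum>i\<in>bodies. of_real (m i) * p n t i) = 0" for n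
    using p[of n] by (simp add: Omega_def)
  ultimately show ?thesis by (simp add: LIMSEQ_const_iff)
qed

text \<open>Along a collision-free path the difference keeps a positive distance from the origin
  over a period, so a uniformly close element of \<open>Omega\<close> has the same winding
  number.\<close>

lemma Xspace_index:
  assumes ij: "(i, j) \<in> pairs" and nz: "\<And>t. q t i \<noteq> q t j"
  shows "ind0 \<tau> (diff q i j) = of_int (kidx k i j)"
proof -
  note b = pairs_bodies[OF ij]
  obtain p w where p: "\<And>n. p n \<in> Omega m \<tau> k"
    and ul: "\<And>i. i \<in> bodies \<Longrightarrow> uniform_limit UNIV (\<lambda>n t. p n t i) (\<lambda>t. q t i) sequentially"
    by (rule Xspace_approximation[OF q \<tau>]) blast
  have uld: "uniform_limit UNIV (\<lambda>n. diff (p n) i j) (diff q i j) sequentially"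
    by (intro uniform_limit_intros ul) (use b in auto)
  have c: "continuous_on UNIV (diff q i j)"
    by (intro continuous_intros Xspace_continuous) (use b in auto)
  have cn: "continuous_on {0..\<tau>} (\<lambda>t. cmod (diff q i j t))"
    by (intro continuous_intros continuous_on_subset[OF c]) auto
  obtain tm where "\<forall>t\<in>{0..\<tau>}. cmod (diff q i j tm) \<le> cmod (diff q i j t)"
    using continuous_attains_inf[OF _ _ cn] \<tau> by auto
  then have tm: "\<And>t. t \<in> {0..\<tau>} \<Longrightarrow> cmod (diff q i j tm) \<le> cmod (diff q i j t)" by blast
  have "cmod (diff q i j tm) > 0" using nz by simp
  from eventually_happens'[OF sequentially_bot uniform_limitD[OF uld this]]
  obtain n where "\<forall>t\<in>UNIV. dist (diff (p n) i j t) (diff q i j t) < cmod (diff q i j tm)" ..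
  then have n: "\<And>t. dist (diff (p n) i j t) (diff q i j t) < cmod (diff q i j tm)" by blast
  interpret pl: plane_loop \<tau> "diff (p n) i j" "\<lambda>t. velocity (p n) i t - velocity (p n) j t"
    by (rule Omega_diff(1)[OF p \<tau> ij])
  have path: "path (\<lambda>s. f (\<tau> * s))" if "continuous_on UNIV f" for f :: "real \<Rightarrow> complex"
    unfolding path_def by (intro continuous_on_compose2[OF that]) (auto intro!: continuous_intros)
  have "winding_number (\<lambda>s. diff (p n) i j (\<tau> * s)) 0 = winding_number (\<lambda>s. diff q i j (\<tau> * s)) 0"
  proof (rule winding_number_nearby_loops_eq)
    show "path (\<lambda>s. diff q i j (\<tau> * s))" "path (\<lambda>s. diff (p n) i j (\<tau> * s))"
      by (rule path[OF c], rule path[OF pl.cont])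
    show "pathfinish (\<lambda>s. diff q i j (\<tau> * s)) = pathstart (\<lambda>s. diff q i j (\<tau> * s))"
      using Xspace_periodic[of i 0] Xspace_periodic[of j 0] b by (simp add: pathstart_def pathfinish_def)
    show "pathfinish (\<lambda>s. diff (p n) i j (\<tau> * s)) = pathstart (\<lambda>s. diff (p n) i j (\<tau> * s))"
      using pl.per[of 0] by (simp add: pathstart_def pathfinish_def)
    fix s :: real assume "s \<in> {0..1}"
    then have "\<tau> * s \<in> {0..\<tau>}" using \<tau> by (auto simp: mult_le_cancel_left1)
    then show "cmod (diff (p n) i j (\<tau> * s) - diff q i j (\<tau> * s)) < cmod (diff q i j (\<tau> * s) - 0)"
      using n[of "\<tau> * s"] tm[of "\<tau> * s"] by (simp add: dist_norm)
  qed
  then show ?thesis using Omega_diff(2)[OF p \<tau> ij, of n] by (simp add: ind0_def)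
qed

text \<open>A single family \<open>w\<close> serves all three pairs, so that the three bounds can be
  added under one integral.\<close>

lemma Xspace_pair_bound:
  assumes k: "k = (1,1,1) \<or> k = (-1,-1,-1)" and \<delta>: "\<And>i j. (i, j) \<in> pairs \<Longrightarrow> \<delta> i j > 0"
  obtains w where "\<And>i. i \<in> bodies \<Longrightarrow> w i \<in> borel_measurable borel"
    "\<And>i t. i \<in> bodies \<Longrightarrow> t \<in> {0..\<tau>} \<Longrightarrow> w i t = velocity q i t"
    "\<And>i j. (i, j) \<in> pairs \<Longrightarrow> ennreal (gordon_bound \<tau> (\<delta> i j)) \<le> (\<integral>\<^sup>+t\<in>{0..\<tau>}. ennreal ((cmod (w i t - w j t))\<^sup>2 / 2)
      + (if diff q i j t = 0 then \<infinity> else ennreal (\<delta> i j / cmod (diff q i j t))) \<partial>lborel)"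
proof -
  obtain p w where p: "\<And>n. p n \<in> Omega m \<tau> k"
    and w: "\<And>i. i \<in> bodies \<Longrightarrow> w i \<in> borel_measurable borel"
    "\<And>i t. i \<in> bodies \<Longrightarrow> t \<in> {0..\<tau>} \<Longrightarrow> w i t = velocity q i t"
    and lim: "\<And>i. i \<in> bodies \<Longrightarrow> (\<lambda>n. \<integral>\<^sup>+t\<in>{0..\<tau>}. ennreal ((cmod (velocity (p n) i t - w i t))\<^sup>2) \<partial>lborel) \<longlonglongrightarrow> 0"
    and ul: "\<And>i. i \<in> bodies \<Longrightarrow> uniform_limit UNIV (\<lambda>n t. p n t i) (\<lambda>t. q t i) sequentially"
    using Xspace_approximation[OF q \<tau>] by blast
  have "ennreal (gordon_bound \<tau> (\<delta> i j)) \<le> (\<integral>\<^sup>+t\<in>{0..\<tau>}. ennreal ((cmod (w i t - w j t))\<^sup>2 / 2)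
      + (if diff q i j t = 0 then \<infinity> else ennreal (\<delta> i j / cmod (diff q i j t))) \<partial>lborel)"
    if ij: "(i, j) \<in> pairs" for i j
  proof (rule gordon_limit[OF Omega_diff(1)[OF p \<tau> ij] Omega_diff(2)[OF p \<tau> ij] _ \<delta>[OF ij]])
    note b = pairs_bodies[OF ij]
    show "odd (kidx k i j)" using kidx_odd[OF k, of i j] by auto
    show "uniform_limit {0..\<tau>} (\<lambda>n. diff (p n) i j) (diff q i j) sequentially"
      by (intro uniform_limit_intros uniform_limit_on_subset[OF ul]) (use b in auto)
    show "continuous_on UNIV (diff q i j)"
      by (intro continuous_intros Xspace_continuous) (use b in auto)
    show wm: "(\<lambda>t. w i t - w j t) \<in> borel_measurable borel" using w(1) b by auto
    have pm: "velocity (p n) i \<in> borel_measurable borel" "velocity (p n) j \<in> borel_measurable borel" for n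
      using Omega_velocity(2)[OF p] b by (auto intro: borel_measurable_continuous_onI)
    let ?d = "\<lambda>n i. \<integral>\<^sup>+t\<in>{0..\<tau>}. ennreal ((cmod (velocity (p n) i t - w i t))\<^sup>2) \<partial>lborel"
    \<comment> \<open>The velocity error of a difference is controlled by the errors of the two
      bodies, by \<open>L2_bound\<close> with \<eta> = 1.\<close>
    have le: "(\<integral>\<^sup>+t\<in>{0..\<tau>}. ennreal ((cmod (velocity (p n) i t - velocity (p n) j t - (w i t - w j t)))\<^sup>2) \<partial>lborel)
        \<le> ennreal (1 + 1) * ?d n i + ennreal (1 + 1 / 1) * ?d n j" for n
    proof -
      have "(\<integral>\<^sup>+t\<in>{0..\<tau>}. ennreal ((cmod (velocity (p n) i t - velocity (p n) j t - (w i t - w j t)))\<^sup>2) \<partial>lborel)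
        \<le> ennreal (1 + 1) * ?d n i + ennreal (1 + 1 / 1) * (\<integral>\<^sup>+t\<in>{0..\<tau>}. ennreal ((cmod (velocity (p n) i t - velocity (p n) j t
            - (w i t - w j t) - (velocity (p n) i t - w i t)))\<^sup>2) \<partial>lborel)"
        by (rule L2_bound) (use pm w(1) b in auto)
      also have "(\<integral>\<^sup>+t\<in>{0..\<tau>}. ennreal ((cmod (velocity (p n) i t - velocity (p n) j t
            - (w i t - w j t) - (velocity (p n) i t - w i t)))\<^sup>2) \<partial>lborel) = ?d n j"
      proof -
        have "cmod (a - b - (c - d) - (a - c)) = cmod (b - d)" for a b c d
          by (rule trans[OF arg_cong[of _ "d - b" cmod] norm_minus_commute]) simp
        then show ?thesis by (simp only:)
      qed
      finally show ?thesis .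
    qed
    have "(\<lambda>n. ennreal (1 + 1) * ?d n i + ennreal (1 + 1 / 1) * ?d n j) \<longlonglongrightarrow> ennreal (1 + 1) * 0 + ennreal (1 + 1 / 1) * 0"
      by (intro tendsto_add ennreal_tendsto_cmult lim) (use b in auto)
    then have L: "(\<lambda>n. ennreal (1 + 1) * ?d n i + ennreal (1 + 1 / 1) * ?d n j) \<longlonglongrightarrow> 0"
      by (simp only: mult_zero_right add_0_right)
    show "(\<lambda>n. \<integral>\<^sup>+t\<in>{0..\<tau>}. ennreal ((cmod (velocity (p n) i t - velocity (p n) j t - (w i t - w j t)))\<^sup>2) \<partial>lborel) \<longlonglongrightarrow> 0"
      by (rule tendsto_sandwich[OF _ _ tendsto_const L]) (intro always_eventually allI zero_le le)+
  qed
  then show thesis using that[of w] w by blast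
qed

end

section \<open>The action as a weighted sum of pair actions\<close>

text \<open>Lagrange's identity for total mass one: kinetic energy splits into the energies of
  relative motion and that of the centre of mass.\<close>

lemma lagrange_identity:
  fixes v :: "nat \<Rightarrow> complex"
  assumes "m 1 + m 2 + m 3 = 1"
  shows "(\<Sum>i\<in>bodies. m i * (cmod (v i))\<^sup>2)
    = (\<Sum>(i,j)\<in>pairs. m i * m j * (cmod (v i - v j))\<^sup>2) + (cmod (\<Sum>i\<in>bodies. of_real (m i) * v i))\<^sup>2"
proof -
  have "(\<Sum>(i,j)\<in>pairs. m i * m j * (cmod (v i - v j))\<^sup>2) + (cmod (\<Sum>i\<in>bodies. of_real (m i) * v i))\<^sup>2
    = (m 1 + m 2 + m 3) * (\<Sum>i\<in>bodies. m i * (cmod (v i))\<^sup>2)"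
    unfolding sum_pairs sum_bodies cmod_power2 by (simp add: power2_eq_square algebra_simps)
  then show ?thesis using assms by simp
qed


lemma U_no_collision:
  assumes "\<not> (\<exists>i\<in>bodies. \<exists>j\<in>bodies. i \<noteq> j \<and> x i = x j)"
  shows "U m e x = ennreal (\<Sum>(i,j)\<in>pairs. m i * m j * delta m e i j / cmod (x i - x j))"
  unfolding U_def pairs_def using assms by (rule if_not_P)

lemma U_ge_pair:
  assumes m: "\<forall>i\<in>bodies. m i > 0" and \<delta>: "\<And>i j. (i, j) \<in> pairs \<Longrightarrow> delta m e i j > 0"
    and ij: "(i, j) \<in> pairs" and r: "cmod (x i - x j) \<le> r" "r > 0"
  shows "ennreal (m i * m j * delta m e i j / r) \<le> U m e x"
proof (cases "\<exists>i\<in>bodies. \<exists>j\<in>bodies. i \<noteq> j \<and> x i = x j")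
  case True
  then show ?thesis by (simp add: U_def)
next
  case False
  let ?f = "\<lambda>i j. m i * m j * delta m e i j / cmod (x i - x j)"
  have nn: "?f i j \<ge> 0" if "(i, j) \<in> pairs" for i j
    using m \<delta>[OF that] pairs_bodies[OF that] by (simp add: less_imp_le)
  have nz: "x i \<noteq> x j" using False pairs_bodies[OF ij] by auto
  have "m i * m j * delta m e i j / r \<le> ?f i j"
    using r nz m \<delta>[OF ij] pairs_bodies[OF ij] by (intro divide_left_mono) (auto simp: less_imp_le)
  also have "?f i j \<le> (\<Sum>(i,j)\<in>pairs. ?f i j)"
    using ij nn by (intro member_le_sum[of "(i,j)" pairs "\<lambda>(i,j). ?f i j", simplified]) (auto simp: pairs_def)
  finally show ?thesis unfolding U_no_collision[OF False] by (rule ennreal_leI)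
qed

locale charged_bodies =
  fixes m e :: "nat \<Rightarrow> real" and \<tau> :: real and k :: "int \<times> int \<times> int"
  assumes m: "\<forall>i\<in>bodies. m i > 0" and m1: "m 1 + m 2 + m 3 = 1"
    and \<delta>: "\<And>i j. (i, j) \<in> pairs \<Longrightarrow> delta m e i j > 0"
    and \<tau>: "\<tau> > 0" and k: "k = (1,1,1) \<or> k = (-1,-1,-1)"
begin

lemma mass_pos: "(i, j) \<in> pairs \<Longrightarrow> m i * m j > 0"
  using m pairs_bodies by simp

lemma mass_nonneg: "(i, j) \<in> pairs \<Longrightarrow> 0 \<le> m i \<and> 0 \<le> m j"
  using m pairs_bodies by (simp add: less_imp_le)

definition min_action :: real where
  "min_action = (\<Sum>(i,j)\<in>pairs. m i * m j * gordon_bound \<tau> (delta m e i j))"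

lemma action_lower_bound:
  assumes q: "q \<in> Xspace m \<tau> k"
  shows "ennreal min_action \<le> action m e \<tau> q"
proof -
  obtain w where w: "\<And>i. i \<in> bodies \<Longrightarrow> w i \<in> borel_measurable borel"
    "\<And>i t. i \<in> bodies \<Longrightarrow> t \<in> {0..\<tau>} \<Longrightarrow> w i t = velocity q i t"
    and gb: "\<And>i j. (i, j) \<in> pairs \<Longrightarrow> ennreal (gordon_bound \<tau> (delta m e i j)) \<le> (\<integral>\<^sup>+t\<in>{0..\<tau>}. ennreal ((cmod (w i t - w j t))\<^sup>2 / 2)
      + (if diff q i j t = 0 then \<infinity> else ennreal (delta m e i j / cmod (diff q i j t))) \<partial>lborel)"
    using Xspace_pair_bound[where \<delta> = "delta m e", OF q \<tau> k \<delta>] by blast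
  \<comment> \<open>Written with \<open>w\<close>, the pair integrands are measurable and their
    integrals may be added; within the period they are the true ones.\<close>
  define G where "G i j t = (ennreal ((cmod (w i t - w j t))\<^sup>2 / 2)
      + (if diff q i j t = 0 then \<infinity> else ennreal (delta m e i j / cmod (diff q i j t)))) * indicator {0..\<tau>} t" for i j t
  have [measurable]: "w i \<in> borel_measurable borel" "(\<lambda>t. q t i) \<in> borel_measurable borel" if "i \<in> bodies" for i
    using w(1)[OF that] borel_measurable_continuous_onI[OF Xspace_continuous[OF q \<tau> that]] by auto
  have Gm: "G i j \<in> borel_measurable lborel" if "i \<in> bodies" "j \<in> bodies" for i j
    unfolding G_def using that by measurable
  note Gm' = Gm[OF bodies_simps(2,3)] Gm[OF bodies_simps(3,4)] Gm[OF bodies_simps(4,2)]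
  have gb_pos: "gordon_bound \<tau> (delta m e i j) \<ge> 0" for i j
    using \<tau> by (simp add: gordon_bound_def)
  have "ennreal min_action = (\<Sum>(i,j)\<in>pairs. ennreal (m i * m j) * ennreal (gordon_bound \<tau> (delta m e i j)))"
    unfolding min_action_def using mass_pos gb_pos
    by (subst sum_ennreal[symmetric]) (auto simp: ennreal_mult' less_imp_le intro!: sum.cong)
  also have "\<dots> \<le> (\<Sum>(i,j)\<in>pairs. ennreal (m i * m j) * (\<integral>\<^sup>+t. G i j t \<partial>lborel))"
    using gb by (intro sum_mono) (auto simp: G_def intro!: mult_left_mono)
  also have "\<dots> = (\<integral>\<^sup>+t. (\<Sum>(i,j)\<in>pairs. ennreal (m i * m j) * G i j t) \<partial>lborel)"
    unfolding sum_pairs using Gm' by (simp add: nn_integral_add nn_integral_cmult)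
  also have "\<dots> \<le> action m e \<tau> q" unfolding action_def velocity_def[symmetric]
  proof (rule nn_integral_mono)
    fix t
    show "(\<Sum>(i,j)\<in>pairs. ennreal (m i * m j) * G i j t)
       \<le> (ennreal (1 / 2 * (\<Sum>i\<in>bodies. m i * (cmod (velocity q i t))\<^sup>2)) + U m e (q t)) * indicator {0..\<tau>} t"
    proof (cases "t \<in> {0..\<tau>}")
      case False
      then show ?thesis by (simp add: G_def sum_pairs)
    next
      case t: True
      show ?thesis
      proof (cases "\<exists>i\<in>bodies. \<exists>j\<in>bodies. i \<noteq> j \<and> q t i = q t j")
        case True
        then show ?thesis using t by (simp add: U_def)
      next
        case False
        then have nz: "diff q i j t \<noteq> 0" if "(i, j) \<in> pairs" for i j
          using pairs_bodies[OF that] by auto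
        have "(\<Sum>(i,j)\<in>pairs. ennreal (m i * m j) * G i j t)
          = (\<Sum>(i,j)\<in>pairs. ennreal (m i * m j * ((cmod (velocity q i t - velocity q j t))\<^sup>2 / 2 + delta m e i j / cmod (diff q i j t))))"
        proof (intro sum.cong refl, clarify)
          fix i j assume ij: "(i, j) \<in> pairs"
          have "G i j t = ennreal ((cmod (velocity q i t - velocity q j t))\<^sup>2 / 2 + delta m e i j / cmod (diff q i j t))"
            using t nz[OF ij] w(2)[of i t] w(2)[of j t] pairs_bodies[OF ij] \<delta>[OF ij]
            by (simp add: G_def less_imp_le)
          then show "ennreal (m i * m j) * G i j t
             = ennreal (m i * m j * ((cmod (velocity q i t - velocity q j t))\<^sup>2 / 2 + delta m e i j / cmod (diff q i j t)))"
            using mass_pos[OF ij] by (simp add: ennreal_mult')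
        qed
        also have "\<dots> = ennreal (\<Sum>(i,j)\<in>pairs. m i * m j * ((cmod (velocity q i t - velocity q j t))\<^sup>2 / 2 + delta m e i j / cmod (diff q i j t)))"
          using mass_pos \<delta> by (subst sum_ennreal[symmetric]) (auto intro!: sum.cong mult_nonneg_nonneg add_nonneg_nonneg dest: mass_nonneg simp: less_imp_le)
        also have "\<dots> \<le> ennreal (1 / 2 * (\<Sum>i\<in>bodies. m i * (cmod (velocity q i t))\<^sup>2)
            + (\<Sum>(i,j)\<in>pairs. m i * m j * delta m e i j / cmod (diff q i j t)))"
        proof (rule ennreal_leI)
          \<comment> \<open>At exceptional times \<open>velocity\<close> has arbitrary values and
            the weighted sum of velocities may be nonzero. The term of the centre of mass is
            nonnegative, so the inequality holds there as well.\<close>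
          have "(\<Sum>(i,j)\<in>pairs. m i * m j * (cmod (velocity q i t - velocity q j t))\<^sup>2) \<le> (\<Sum>i\<in>bodies. m i * (cmod (velocity q i t))\<^sup>2)"
            using lagrange_identity[where v = "\<lambda>i. velocity q i t", OF m1] by simp
          then show "(\<Sum>(i,j)\<in>pairs. m i * m j * ((cmod (velocity q i t - velocity q j t))\<^sup>2 / 2 + delta m e i j / cmod (diff q i j t)))
            \<le> 1 / 2 * (\<Sum>i\<in>bodies. m i * (cmod (velocity q i t))\<^sup>2) + (\<Sum>(i,j)\<in>pairs. m i * m j * delta m e i j / cmod (diff q i j t))"
            unfolding sum_pairs by (simp add: distrib_left)
        qed
        also have "\<dots> = ennreal (1 / 2 * (\<Sum>i\<in>bodies. m i * (cmod (velocity q i t))\<^sup>2)) + U m e (q t)"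
        proof -
          have "0 \<le> (\<Sum>(i,j)\<in>pairs. m i * m j * delta m e i j / cmod (diff q i j t))"
            using mass_pos \<delta> by (auto intro!: sum_nonneg divide_nonneg_nonneg mult_nonneg_nonneg dest: mass_nonneg simp: less_imp_le)
          moreover have "0 \<le> (\<Sum>i\<in>bodies. m i * (cmod (velocity q i t))\<^sup>2)"
            using m by (intro sum_nonneg) (simp add: less_imp_le)
          ultimately show ?thesis unfolding U_no_collision[OF False] by simp
        qed
        finally show ?thesis using t by simp
      qed
    qed
  qed
  finally show ?thesis .
qed

text \<open>Near a collision of a C^1 path the distance is at most L |t - t0|, so U is at least a
  multiple of 1 / |t - t0|, whose integral diverges.\<close>

lemma finite_action_no_collision:
  assumes q: "q \<in> Xspace m \<tau> k"
    and v: "\<And>i t. i \<in> bodies \<Longrightarrow> ((\<lambda>t. q t i) has_vector_derivative v i t) (at t)"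
      "\<And>i. i \<in> bodies \<Longrightarrow> continuous_on UNIV (v i)"
    and fin: "action m e \<tau> q < \<infinity>" and ij: "i \<in> bodies" "j \<in> bodies" "i \<noteq> j"
  shows "q t i \<noteq> q t j"
proof -
  have main: "q t i \<noteq> q t j" if ij: "(i, j) \<in> pairs" for i j t
  proof
    assume eq: "q t i = q t j"
    note b = pairs_bodies[OF ij]
    \<comment> \<open>The half-open period leaves an interval of positive length to the right of the
      collision inside \<open>{0..\<tau>}\<close>.\<close>
    obtain l :: int where l: "t + of_int l * \<tau> \<in> {0..<\<tau>}" using periodic_representative[OF \<tau>] by blast
    define t0 where "t0 = t + of_int l * \<tau>"
    have "q t0 i = q t i" "q t0 j = q t j" unfolding t0_def
      using periodic_integer_shift[of "\<lambda>t. q t i" \<tau>] periodic_integer_shift[of "\<lambda>t. q t j" \<tau>] Xspace_periodic[OF q \<tau>] b by auto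
    then have z: "diff q i j t0 = 0" using eq by simp
    have t0: "0 \<le> t0" "t0 < \<tau>" using l by (auto simp: t0_def)
    have cv: "continuous_on {0..\<tau>} (\<lambda>t. cmod (v i t - v j t))"
      by (intro continuous_intros continuous_on_subset[OF v(2)]) (use b in auto)
    obtain L0 where L0: "\<forall>t\<in>{0..\<tau>}. cmod (v i t - v j t) \<le> L0"
      using continuous_attains_sup[OF _ _ cv] \<tau> by auto
    define L where "L = \<bar>L0\<bar> + 1"
    have "L0 \<le> L" "L > 0" by (auto simp: L_def)
    with L0 have L: "L > 0" "\<And>t. t \<in> {0..\<tau>} \<Longrightarrow> cmod (v i t - v j t) \<le> L"
      by (blast intro: order_trans)+
    have lip: "cmod (diff q i j t) \<le> L * (t - t0)" if t: "t \<in> {t0..\<tau>}" for t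
    proof -
      have "((\<lambda>t. v i t - v j t) has_integral diff q i j t - diff q i j t0) {t0..t}"
        using t b by (intro fundamental_theorem_of_calculus has_vector_derivative_diff) (auto intro: has_vector_derivative_at_within v)
      from has_integral_bound_real[OF _ finite.emptyI this, of L] show ?thesis
        using t t0 L z by (auto simp: less_imp_le)
    qed
    define c0 where "c0 = m i * m j * delta m e i j"
    have c0: "c0 > 0" using mass_pos[OF ij] \<delta>[OF ij] by (simp add: c0_def)
    obtain A where A: "action m e \<tau> q = ennreal A" "A \<ge> 0" using fin by (cases "action m e \<tau> q") auto
    define h where "h = \<tau> - t0"
    have h: "h > 0" using t0 by (simp add: h_def)
    \<comment> \<open>With this \<epsilon> the logarithm that bounds the action from below is at
      least A L / c0 + 1, which makes the integral at least A + c0 / L.\<close>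
    define \<epsilon> where "\<epsilon> = L * h / exp (A * L / c0 + 1)"
    have \<epsilon>: "\<epsilon> > 0" using L h by (simp add: \<epsilon>_def)
    define f where "f t = c0 / (L * (t - t0) + \<epsilon>)" for t
    have pos: "L * (t - t0) + \<epsilon> > 0" if "t0 \<le> t" for t
      using that L \<epsilon> by (intro add_nonneg_pos) auto
    have "ennreal (integral {t0..\<tau>} f) = (\<integral>\<^sup>+t\<in>{t0..\<tau>}. ennreal (f t) \<partial>lborel)"
      unfolding f_def using pos c0
      by (intro set_nn_integral_eq_integral[symmetric] continuous_intros) (auto simp: less_imp_neq[THEN not_sym] less_imp_le)
    also have "\<dots> \<le> action m e \<tau> q" unfolding action_def
    proof (rule nn_integral_mono)
      fix t
      show "ennreal (f t) * indicator {t0..\<tau>} t \<le> (ennreal (1 / 2 * (\<Sum>i\<in>bodies. m i * (cmod (vector_derivative (\<lambda>s. q s i) (at t)))\<^sup>2))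
         + U m e (q t)) * indicator {0..\<tau>} t"
      proof (cases "t \<in> {t0..\<tau>}")
        case True
        have "ennreal (f t) \<le> U m e (q t)" unfolding f_def c0_def
          by (rule U_ge_pair[OF m \<delta> ij]) (use lip[OF True] \<epsilon> pos True in auto)
        then show ?thesis using True t0 by (simp add: add_increasing)
      qed simp
    qed
    finally have le: "integral {t0..\<tau>} f \<le> A" using A by (simp add: ennreal_le_iff)
    have "(f has_integral (c0 / L) * ln (L * (\<tau> - t0) + \<epsilon>) - (c0 / L) * ln (L * (t0 - t0) + \<epsilon>)) {t0..\<tau>}"
    proof (intro fundamental_theorem_of_calculus)
      fix t assume t: "t \<in> {t0..\<tau>}"
      have "((\<lambda>t. (c0 / L) * ln (L * (t - t0) + \<epsilon>)) has_real_derivative f t) (at t within {t0..\<tau>})"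
        unfolding f_def using pos[of t] t L by (auto intro!: derivative_eq_intros)
      then show "((\<lambda>t. (c0 / L) * ln (L * (t - t0) + \<epsilon>)) has_vector_derivative f t) (at t within {t0..\<tau>})"
        by (simp add: has_real_derivative_iff_has_vector_derivative)
    qed (use t0 in simp)
    then have "integral {t0..\<tau>} f = (c0 / L) * (ln (L * h + \<epsilon>) - ln \<epsilon>)"
      by (simp add: integral_unique h_def right_diff_distrib)
    moreover have "ln (L * h + \<epsilon>) - ln \<epsilon> \<ge> A * L / c0 + 1"
    proof -
      have "ln \<epsilon> = ln (L * h) - (A * L / c0 + 1)" using L h by (simp add: \<epsilon>_def ln_div)
      moreover have "ln (L * h) \<le> ln (L * h + \<epsilon>)" using L(1) h \<epsilon> by (intro ln_mono) auto
      ultimately show ?thesis by simp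
    qed
    ultimately have "integral {t0..\<tau>} f \<ge> (c0 / L) * (A * L / c0 + 1)"
      using c0 L(1) by (simp only:) (intro mult_left_mono; simp)
    moreover have "(c0 / L) * (A * L / c0 + 1) = A + c0 / L" using c0 L by (simp add: field_simps)
    moreover have "c0 / L > 0" using c0 L by simp
    ultimately show False using le by linarith
  qed
  have "(i, j) \<in> pairs \<or> (j, i) \<in> pairs" using ij by (auto simp: bodies_def pairs_def)
  then show ?thesis using main[of i j t] main[of j i t] by auto
qed

end

text \<open>The common setting of C^2 minimisers and of explicit solutions: here the pair actions
  are ordinary integrals and the equality case of Gordon's inequality is available.\<close>

locale regular_path = charged_bodies m e \<tau> k
  for m e :: "nat \<Rightarrow> real" and \<tau> :: real and k :: "int \<times> int \<times> int" +
  fixes q :: "real \<Rightarrow> nat \<Rightarrow> complex" and v :: "nat \<Rightarrow> real \<Rightarrow> complex"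
  assumes q: "q \<in> Xspace m \<tau> k"
    and v: "i \<in> bodies \<Longrightarrow> ((\<lambda>t. q t i) has_vector_derivative v i t) (at t)"
      "i \<in> bodies \<Longrightarrow> continuous_on UNIV (v i)"
    and nc: "i \<in> bodies \<Longrightarrow> j \<in> bodies \<Longrightarrow> i \<noteq> j \<Longrightarrow> q t i \<noteq> q t j"
begin

lemma regular_velocity: "i \<in> bodies \<Longrightarrow> velocity q i t = v i t"
  unfolding velocity_def by (rule vector_derivative_at[OF v(1)])

lemma regular_plane_loop:
  assumes "(i, j) \<in> pairs"
  shows "plane_loop \<tau> (diff q i j) (\<lambda>t. v i t - v j t)"
  using pairs_bodies[OF assms] \<tau> nc Xspace_periodic[OF q \<tau>]
  by unfold_locales (auto intro!: has_vector_derivative_diff v continuous_intros)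

lemma regular_index:
  assumes "(i, j) \<in> pairs"
  shows "ind0 \<tau> (diff q i j) = of_int (kidx k i j)"
  using Xspace_index[OF q \<tau> assms] nc pairs_bodies[OF assms] by auto

definition pair_action :: "nat \<Rightarrow> nat \<Rightarrow> real" where
  "pair_action i j = plane_loop.kin \<tau> (\<lambda>t. v i t - v j t) + delta m e i j * plane_loop.len \<tau> (diff q i j)"

text \<open>The derivative of the centre of mass vanishes at every time, so Lagrange's identity has
  no remainder and the estimate of \<open>action_lower_bound\<close> becomes an equation before
  Gordon's bounds are applied.\<close>

lemma regular_action:
  "action m e \<tau> q = ennreal (\<Sum>(i,j)\<in>pairs. m i * m j * pair_action i j)"
proof -
  have com: "(\<Sum>i\<in>bodies. of_real (m i) * v i t) = 0" for t
  proof -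
    have "((\<lambda>t. \<Sum>i\<in>bodies. of_real (m i) * q t i) has_vector_derivative (\<Sum>i\<in>bodies. of_real (m i) * v i t)) (at t)"
      by (intro has_vector_derivative_sum has_vector_derivative_mult_right v)
    then show ?thesis using Xspace_center_of_mass[OF q \<tau>]
      by (simp add: vector_derivative_unique_at[OF _ has_vector_derivative_const])
  qed
  define P where "P i j t = (cmod (v i t - v j t))\<^sup>2 / 2 + delta m e i j * (1 / cmod (diff q i j t))" for i j t
  define F where "F t = (\<Sum>(i,j)\<in>pairs. m i * m j * P i j t)" for t
  have P: "continuous_on {0..\<tau>} (P i j)" "integral {0..\<tau>} (P i j) = pair_action i j" "P i j t \<ge> 0"
    if ij: "(i, j) \<in> pairs" for i j t
  proof -
    interpret pl: plane_loop \<tau> "diff q i j" "\<lambda>t. v i t - v j t" by (rule regular_plane_loop[OF ij])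
    have c: "continuous_on {0..\<tau>} (\<lambda>t. (cmod (v i t - v j t))\<^sup>2 / 2)" "continuous_on {0..\<tau>} (\<lambda>t. delta m e i j * (1 / cmod (diff q i j t)))"
      by (intro continuous_intros continuous_on_subset[OF pl.cont'] pl.cont; simp add: pl.nz[simplified])+
    show "continuous_on {0..\<tau>} (P i j)" unfolding P_def by (intro continuous_on_add c)
    show "integral {0..\<tau>} (P i j) = pair_action i j"
      unfolding P_def[abs_def] pair_action_def pl.kin_def pl.len_def
      by (simp only: integral_add[OF integrable_continuous_real[OF c(1)] integrable_continuous_real[OF c(2)]] integral_mult_right)
    show "P i j t \<ge> 0" using \<delta>[OF ij] by (simp add: P_def less_imp_le)
  qed
  have F_eq: "(ennreal (1 / 2 * (\<Sum>i\<in>bodies. m i * (cmod (velocity q i t))\<^sup>2)) + U m e (q t)) = ennreal (F t)" for t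
  proof -
    have "1 / 2 * (\<Sum>i\<in>bodies. m i * (cmod (velocity q i t))\<^sup>2) = 1/2 * (\<Sum>(i,j)\<in>pairs. m i * m j * (cmod (v i t - v j t))\<^sup>2)"
      using lagrange_identity[where v = "\<lambda>i. v i t", OF m1] com[of t] by (simp add: regular_velocity)
    moreover have "U m e (q t) = ennreal (\<Sum>(i,j)\<in>pairs. m i * m j * delta m e i j / cmod (diff q i j t))"
      using nc by (intro U_no_collision) blast
    moreover have "0 \<le> (\<Sum>(i,j)\<in>pairs. m i * m j * delta m e i j / cmod (diff q i j t))"
      using mass_pos \<delta> by (auto intro!: sum_nonneg divide_nonneg_nonneg mult_nonneg_nonneg dest: mass_nonneg simp: less_imp_le)
    moreover have "0 \<le> (\<Sum>(i,j)\<in>pairs. m i * m j * (cmod (v i t - v j t))\<^sup>2)"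
      using mass_pos by (auto intro!: sum_nonneg mult_nonneg_nonneg dest: mass_nonneg simp: less_imp_le)
    ultimately have "ennreal (1 / 2 * (\<Sum>i\<in>bodies. m i * (cmod (velocity q i t))\<^sup>2)) + U m e (q t)
       = ennreal (1/2 * (\<Sum>(i,j)\<in>pairs. m i * m j * (cmod (v i t - v j t))\<^sup>2)
           + (\<Sum>(i,j)\<in>pairs. m i * m j * delta m e i j / cmod (diff q i j t)))" by simp
    also have "1/2 * (\<Sum>(i,j)\<in>pairs. m i * m j * (cmod (v i t - v j t))\<^sup>2)
           + (\<Sum>(i,j)\<in>pairs. m i * m j * delta m e i j / cmod (diff q i j t)) = F t"
      unfolding F_def P_def sum_pairs by (simp add: distrib_left)
    finally show ?thesis .
  qed
  have "action m e \<tau> q = (\<integral>\<^sup>+t\<in>{0..\<tau>}. ennreal (F t) \<partial>lborel)"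
    unfolding action_def velocity_def[symmetric] F_eq ..
  also have "\<dots> = ennreal (integral {0..\<tau>} F)"
    unfolding F_def using P mass_pos
    by (intro set_nn_integral_eq_integral) (auto intro!: continuous_intros sum_nonneg mult_nonneg_nonneg dest: mass_nonneg simp: less_imp_le)
  also have "integral {0..\<tau>} F = (\<Sum>(i,j)\<in>pairs. integral {0..\<tau>} (\<lambda>t. m i * m j * P i j t))"
    unfolding F_def
    by (subst integral_sum) (auto simp: pairs_def[THEN arg_cong[of _ _ finite]] case_prod_unfold intro!: sum.cong integrable_continuous_real continuous_intros P(1))
  also have "\<dots> = (\<Sum>(i,j)\<in>pairs. m i * m j * pair_action i j)"
    using P(2) by (intro sum.cong) auto
  finally show ?thesis .
qed

end


section \<open>Geometry of balanced triangles\<close>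

lemma real_combination_zero:
  fixes b c :: complex and x y :: real
  assumes "of_real x * b + of_real y * c = 0" "Im (b * cnj c) \<noteq> 0"
  shows "x = 0" "y = 0"
proof -
  have "Im ((of_real x * b + of_real y * c) * cnj c) = x * Im (b * cnj c)"
    by (simp add: algebra_simps)
  then show x: "x = 0" using assms by auto
  have "c \<noteq> 0" using assms(2) by auto
  then show "y = 0" using assms(1) x by simp
qed

text \<open>The function D^3 / w^2 is convex and homogeneous of degree one, so its value at (A + B,
  x + y) is at most the sum of its values. \<open>tangent\<close> is its supporting plane along the
  ray D = c w through that point; A + B > C makes the result strict.\<close>

lemma inverse_square_superadditive:
  fixes A B C x y :: real
  assumes "A > 0" "B > 0" "C > 0" "A + B > C" "x > 0" "y > 0"
  shows "A ^ 3 / x\<^sup>2 + B ^ 3 / y\<^sup>2 > C ^ 3 / (x + y)\<^sup>2"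
proof -
  define c where "c = (A + B) / (x + y)"
  have c: "c > 0" "c * (x + y) = A + B" using assms by (auto simp: c_def)
  have tangent: "3 * D * c\<^sup>2 - 2 * c ^ 3 * w \<le> D ^ 3 / w\<^sup>2" if "D > 0" "w > 0" for D w
  proof -
    have "D ^ 3 / w\<^sup>2 - (3 * D * c\<^sup>2 - 2 * c ^ 3 * w) = w * ((D / w - c)\<^sup>2 * (D / w + 2 * c))"
      using that by (simp add: field_simps power2_eq_square power3_eq_cube)
    moreover have "w * ((D / w - c)\<^sup>2 * (D / w + 2 * c)) \<ge> 0"
      using that c by (intro mult_nonneg_nonneg add_nonneg_nonneg) auto
    ultimately show ?thesis by linarith
  qed
  have "C ^ 3 / (x + y)\<^sup>2 < (A + B) ^ 3 / (x + y)\<^sup>2"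
    using assms by (intro divide_strict_right_mono power_strict_mono) auto
  also have "\<dots> = c\<^sup>2 * (A + B)" by (simp add: c_def power_divide power2_eq_square power3_eq_cube)
  also have "\<dots> = 3 * (A + B) * c\<^sup>2 - 2 * c\<^sup>2 * (c * (x + y))" unfolding c(2) by simp
  also have "\<dots> = (3 * A * c\<^sup>2 - 2 * c ^ 3 * x) + (3 * B * c\<^sup>2 - 2 * c ^ 3 * y)"
    by (simp add: algebra_simps power2_eq_square power3_eq_cube)
  also have "\<dots> \<le> A ^ 3 / x\<^sup>2 + B ^ 3 / y\<^sup>2" using tangent assms by (intro add_mono) auto
  finally show ?thesis .
qed

text \<open>Three charged bodies on a line: the two adjacent ones attract each other too much for the accelerations to
  be compatible.\<close>
lemma collinear_balance_impossible:
  fixes A B C s :: real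
  assumes pos: "A > 0" "B > 0" "C > 0" and tri: "A + B > C" "B + C > A" "C + A > B"
    and s: "s \<noteq> 0" "1 + s \<noteq> 0"
  shows "A ^ 3 + B ^ 3 * (s / \<bar>s\<bar> ^ 3) - C ^ 3 * ((1 + s) / \<bar>1 + s\<bar> ^ 3) \<noteq> 0"
proof -
  have p: "x / \<bar>x\<bar> ^ 3 = 1 / x\<^sup>2" if "x > 0" for x :: real
    using that by (simp add: power2_eq_square power3_eq_cube)
  have n: "x / \<bar>x\<bar> ^ 3 = - (1 / x\<^sup>2)" if "x < 0" for x :: real
    using that by (simp add: power2_eq_square power3_eq_cube)
  \<comment> \<open>The three vectors are 1, s and - (1 + s) times a common one. The cases tell
    which is the longest, namely the third, the first or the second; it is the sum of the lengths of
    the others.\<close>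
  consider "s > 0" | "s < 0" "1 + s > 0" | "1 + s < 0" using s by linarith
  then show ?thesis
  proof cases
    case 1
    then show ?thesis using inverse_square_superadditive[OF pos tri(1), of 1 s] p[of s] p[of "1 + s"] by simp
  next
    case 2
    then show ?thesis using inverse_square_superadditive[OF pos(2,3,1) tri(2), of "-s" "1+s"] n[of s] p[of "1 + s"] by simp
  next
    case 3
    have "(- (1 + s) + 1)\<^sup>2 = s\<^sup>2" by (simp add: power2_eq_square)
    then show ?thesis using 3 inverse_square_superadditive[OF pos(3,1,2) tri(3), of "-(1+s)" 1] n[of s] n[of "1 + s"]
      by (simp add: power2_commute[of "-1" s] power2_eq_square algebra_simps)
  qed
qed

text \<open>Once collinear positions are excluded, b1 and b2 are independent over the reals. After
  b3 = - b1 - b2 is inserted into the balance, both coefficients vanish, so the three force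
  coefficients agree; cube roots are taken at the end.\<close>

lemma balanced_triangle:
  fixes b1 b2 b3 :: complex and A B C :: real
  assumes pos: "A > 0" "B > 0" "C > 0" and tri: "A + B > C" "B + C > A" "C + A > B"
    and nz: "b1 \<noteq> 0" "b2 \<noteq> 0" "b3 \<noteq> 0" and sum: "b1 + b2 + b3 = 0"
    and bal: "of_real (A ^ 3 / cmod b1 ^ 3) * b1 + of_real (B ^ 3 / cmod b2 ^ 3) * b2 + of_real (C ^ 3 / cmod b3 ^ 3) * b3 = 0"
  shows "Im (b1 * cnj b2) \<noteq> 0" "B / cmod b2 = A / cmod b1" "C / cmod b3 = A / cmod b1"
proof -
  have b3: "b3 = - b1 - b2" using sum by (simp add: eq_neg_iff_add_eq_0 add.assoc algebra_simps)
  show im: "Im (b1 * cnj b2) \<noteq> 0"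
  proof
    assume im: "Im (b1 * cnj b2) = 0"
    define s where "s = Re (b2 / b1)"
    have "Im (b2 / b1) = 0" using im nz by (simp add: Im_divide algebra_simps)
    then have "b2 / b1 = of_real s" by (simp add: s_def complex_eq_iff)
    then have b2: "b2 = of_real s * b1" using nz by (simp add: field_simps)
    have b3': "b3 = - (of_real (1 + s) * b1)" by (simp add: b3 b2 algebra_simps)
    have s: "s \<noteq> 0" "1 + s \<noteq> 0"
      using nz(2) b2 nz(3) b3' by (auto, metis minus_zero mult_zero_left of_real_0)
    define K where "K = A ^ 3 + B ^ 3 * (s / \<bar>s\<bar> ^ 3) - C ^ 3 * ((1 + s) / \<bar>1 + s\<bar> ^ 3)"
    have "of_real (A ^ 3 / cmod b1 ^ 3) * b1 + of_real (B ^ 3 / cmod b2 ^ 3) * b2 + of_real (C ^ 3 / cmod b3 ^ 3) * b3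
      = of_real K * (b1 / of_real (cmod b1 ^ 3))"
      unfolding K_def b2 b3' norm_mult norm_minus_cancel norm_of_real power_mult_distrib
      using nz s by (simp add: field_simps)
    from trans[OF this[symmetric] bal] have "K = 0" using nz by simp
    then show False using collinear_balance_impossible[OF pos tri s] by (simp add: K_def)
  qed
  have "of_real (A ^ 3 / cmod b1 ^ 3 - C ^ 3 / cmod b3 ^ 3) * b1 + of_real (B ^ 3 / cmod b2 ^ 3 - C ^ 3 / cmod b3 ^ 3) * b2 = 0"
  proof -
    have "(x - w) * b1 + (y - w) * b2 = x * b1 + y * b2 + w * b3" for x y w
      by (simp add: b3 algebra_simps)
    then show ?thesis unfolding of_real_diff using bal by (simp only:)
  qed
  from real_combination_zero[OF this im]
  have "(A / cmod b1) ^ 3 = (C / cmod b3) ^ 3" "(B / cmod b2) ^ 3 = (C / cmod b3) ^ 3"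
    by (simp_all add: power_divide)
  then have "A / cmod b1 = C / cmod b3" "B / cmod b2 = C / cmod b3"
    using pos by (auto intro: power_eq_imp_eq_base[of _ 3])
  then show "B / cmod b2 = A / cmod b1" "C / cmod b3 = A / cmod b1" by auto
qed

lemma triangle_exists:
  fixes d1 d2 d3 :: real
  assumes pos: "d1 > 0" "d2 > 0" "d3 > 0" and tri: "d1 + d2 > d3" "d2 + d3 > d1" "d3 + d1 > d2"
  obtains b :: "nat \<Rightarrow> complex" where "cmod (b 1 - b 2) = d1" "cmod (b 2 - b 3) = d2" "cmod (b 3 - b 1) = d3"
proof -
  \<comment> \<open>The vertices are 0, d1 and c; the law of cosines gives the real part of
    c.\<close>
  define x where "x = (d1\<^sup>2 + d3\<^sup>2 - d2\<^sup>2) / (2 * d1)"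
  have x: "2 * d1 * x = d1\<^sup>2 + d3\<^sup>2 - d2\<^sup>2" using pos by (simp add: x_def)
  have "(d1 - d3)\<^sup>2 \<le> d2\<^sup>2" using tri by (intro abs_le_square_iff[THEN iffD1]) auto
  then have "2 * d1 * x \<le> 2 * d1 * d3" unfolding x by (simp add: power2_eq_square algebra_simps)
  then have 1: "x \<le> d3" using pos by simp
  have "d2\<^sup>2 \<le> (d1 + d3)\<^sup>2" using tri pos by (intro power_mono) auto
  then have "2 * d1 * (- d3) \<le> 2 * d1 * x" unfolding x by (simp add: power2_eq_square algebra_simps)
  then have 2: "- d3 \<le> x" by (rule mult_left_le_imp_le) (use pos in simp)
  have y: "d3\<^sup>2 - x\<^sup>2 \<ge> 0" using 1 2 by (simp add: abs_le_square_iff[symmetric])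
  define c where "c = Complex x (sqrt (d3\<^sup>2 - x\<^sup>2))"
  have "cmod c = d3" using y pos by (simp add: c_def cmod_def)
  moreover have "cmod (of_real d1 - c) = d2"
  proof -
    have "(d1 - x)\<^sup>2 + (d3\<^sup>2 - x\<^sup>2) = d2\<^sup>2" using x by (simp add: power2_eq_square algebra_simps)
    then show ?thesis using y pos by (simp add: c_def cmod_def)
  qed
  ultimately show thesis
    using that[of "\<lambda>i. if i = 1 then 0 else if i = 2 then of_real d1 else c"] pos by simp
qed

lemma delta_commute: "delta m e i j = delta m e j i"
  by (simp add: delta_def mult.commute)

lemma sum_other_bodies:
  fixes f :: "nat \<Rightarrow> 'a::comm_monoid_add"
  shows "(\<Sum>j\<in>bodies - {1}. f j) = f 2 + f 3" "(\<Sum>j\<in>bodies - {2}. f j) = f 3 + f 1" "(\<Sum>j\<in>bodies - {3}. f j) = f 1 + f 2"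
proof -
  have "bodies - {1} = {2,3}" "bodies - {2} = {3,1}" "bodies - {3} = {1,2}" by (auto simp: bodies_def)
  then show "(\<Sum>j\<in>bodies - {1}. f j) = f 2 + f 3" "(\<Sum>j\<in>bodies - {2}. f j) = f 3 + f 1" "(\<Sum>j\<in>bodies - {3}. f j) = f 1 + f 2"
    by simp_all
qed

text \<open>The weights add up to one and the weighted mean of the positions is 0. This expresses
  positions by differences, in which the forces and the pair equations are formulated.\<close>

lemma center_of_mass_differences:
  fixes x :: "nat \<Rightarrow> complex" and m :: "nat \<Rightarrow> real"
  assumes "m 1 + m 2 + m 3 = 1" "(\<Sum>i\<in>bodies. of_real (m i) * x i) = 0" "i \<in> bodies"
  shows "x i = (\<Sum>j\<in>bodies - {i}. of_real (m j) * (x i - x j))"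
proof -
  have "(\<Sum>j\<in>bodies - {i}. of_real (m j) * (x i - x j)) = (\<Sum>j\<in>bodies. of_real (m j) * (x i - x j))"
    using assms(3) bodies_simps(1) by (subst sum.remove[of bodies i]) auto
  also have "\<dots> = (\<Sum>j\<in>bodies. of_real (m j)) * x i - (\<Sum>j\<in>bodies. of_real (m j) * x j)"
    by (simp add: right_diff_distrib sum_subtractf sum_distrib_right)
  also have "(\<Sum>j\<in>bodies. of_real (m j)) = (1 :: complex)"
    by (simp only: sum_bodies of_real_add[symmetric] assms(1) of_real_1)
  finally show ?thesis using assms(2) by simp
qed


section \<open>Kepler's equation for the differences and the constant shape of the triangle\<close>

context regular_path
begin

definition kepler_pairs :: bool where
  "kepler_pairs \<longleftrightarrow> (\<forall>i j t. (i, j) \<in> pairs \<longrightarrow>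
     ((\<lambda>t. v i t - v j t) has_vector_derivative - (delta m e i j / cmod (diff q i j t) ^ 3) *\<^sub>R diff q i j t) (at t))"

lemma kepler_pairs_action:
  assumes kepler_pairs
  shows "action m e \<tau> q = ennreal min_action"
proof -
  have "pair_action i j = gordon_bound \<tau> (delta m e i j)" if ij: "(i, j) \<in> pairs" for i j
    unfolding pair_action_def
    by (rule plane_loop.kepler_gordon[OF regular_plane_loop[OF ij] kidx_odd[OF k] regular_index[OF ij] \<delta>[OF ij]])
      (use assms ij in \<open>auto simp: kepler_pairs_def\<close>)
  then show ?thesis
    unfolding regular_action min_action_def by (intro arg_cong[of _ _ ennreal] sum.cong) auto
qed

text \<open>Each pair action is at least its Gordon bound and the weighted sums agree, so every
  single defect vanishes and \<open>gordon_equality\<close> applies pair by pair.\<close>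

lemma minimizer_kepler_pairs:
  assumes min: "action m e \<tau> q = ennreal min_action"
  shows kepler_pairs
proof -
  have odd: "odd (kidx k i j)" for i j using kidx_odd[OF k, of i j] by auto
  have ge: "m i * m j * gordon_bound \<tau> (delta m e i j) \<le> m i * m j * pair_action i j" if ij: "(i, j) \<in> pairs" for i j
  proof -
    have "gordon_bound \<tau> (delta m e i j) \<le> pair_action i j"
      unfolding pair_action_def
      by (rule plane_loop.gordon[OF regular_plane_loop[OF ij] regular_index[OF ij] odd \<delta>[OF ij]])
    then show ?thesis using mass_pos[OF ij] by (intro mult_left_mono) auto
  qed
  have nn: "0 \<le> m i * m j * gordon_bound \<tau> (delta m e i j)" if ij: "(i, j) \<in> pairs" for i j
    using mass_pos[OF ij] \<tau> by (intro mult_nonneg_nonneg[of "m i * m j"]) (auto simp: gordon_bound_def)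
  have mn: "0 \<le> min_action" unfolding min_action_def using nn by (intro sum_nonneg) auto
  have "0 \<le> (\<Sum>(i,j)\<in>pairs. m i * m j * pair_action i j)"
    using order_trans[OF nn ge] by (intro sum_nonneg) auto
  then have "min_action = (\<Sum>(i,j)\<in>pairs. m i * m j * pair_action i j)"
    using min mn unfolding regular_action by simp
  then have "(\<Sum>x\<in>pairs. (\<lambda>(i,j). m i * m j * pair_action i j - m i * m j * gordon_bound \<tau> (delta m e i j)) x) = 0"
    unfolding min_action_def by (simp add: sum_subtractf case_prod_unfold)
  moreover have "finite pairs" by (simp add: pairs_def)
  ultimately have eq: "\<forall>x\<in>pairs. (\<lambda>(i,j). m i * m j * pair_action i j - m i * m j * gordon_bound \<tau> (delta m e i j)) x = 0"
    using ge by (subst (asm) sum_nonneg_eq_0_iff) auto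
  have "pair_action i j = gordon_bound \<tau> (delta m e i j)" if ij: "(i, j) \<in> pairs" for i j
    using bspec[OF eq ij] mass_pos[OF ij] by (auto simp flip: right_diff_distrib)
  then show ?thesis
    unfolding pair_action_def kepler_pairs_def
    by (intro allI impI plane_loop.gordon_equality[OF regular_plane_loop regular_index odd \<delta>])
qed

end

text \<open>Since the masses add up to one and the centre of mass is at rest, Kepler's equation for the three mutual
  differences is equivalent to the equations of motion.\<close>
lemma (in regular_path) kepler_pairs_charged_solution:
  assumes kepler_pairs
  shows "charged_solution m e q"
proof -
  note com = Xspace_center_of_mass[OF q \<tau>]
  have kepler: "((\<lambda>t. v i t - v j t) has_vector_derivative - (delta m e i j / cmod (diff q i j t) ^ 3) *\<^sub>R diff q i j t) (at t)"
    if "(i, j) \<in> pairs" for i j t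
    using assms that by (simp add: kepler_pairs_def)
  have comv: "(\<Sum>i\<in>bodies. of_real (m i) * v i t) = 0" for t
  proof -
    have "((\<lambda>t. \<Sum>i\<in>bodies. of_real (m i) * q t i) has_vector_derivative (\<Sum>i\<in>bodies. of_real (m i) * v i t)) (at t)"
      by (intro has_vector_derivative_sum has_vector_derivative_mult_right v)
    then show ?thesis using com
      by (simp add: vector_derivative_unique_at[OF _ has_vector_derivative_const])
  qed
  let ?F = "\<lambda>i j t. (delta m e i j / cmod (q t i - q t j) ^ 3) *\<^sub>R (q t j - q t i)"
  have kepler': "((\<lambda>t. v i t - v j t) has_vector_derivative ?F i j t) (at t)"
    if ij: "i \<in> bodies" "j \<in> bodies" "i \<noteq> j" for i j t
  proof -
    have "(i, j) \<in> pairs \<or> (j, i) \<in> pairs" using ij by (auto simp: bodies_def pairs_def)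
    then show ?thesis
    proof
      assume "(i, j) \<in> pairs"
      from kepler[OF this, of t] show ?thesis by (simp add: scaleR_diff_right)
    next
      assume "(j, i) \<in> pairs"
      from has_vector_derivative_minus[OF kepler[OF this, of t]] show ?thesis
        by (simp add: delta_commute[of m e i] norm_minus_commute[of "q t i"])
    qed
  qed
  have vd: "((v i) has_vector_derivative (\<Sum>j\<in>bodies - {i}. of_real (m j) * ?F i j t)) (at t)" if i: "i \<in> bodies" for i t
  proof -
    have "((\<lambda>t. \<Sum>j\<in>bodies - {i}. of_real (m j) * (v i t - v j t)) has_vector_derivative (\<Sum>j\<in>bodies - {i}. of_real (m j) * ?F i j t)) (at t)"
      by (intro has_vector_derivative_sum has_vector_derivative_mult_right kepler') (use i in auto)
    also have "(\<lambda>t. \<Sum>j\<in>bodies - {i}. of_real (m j) * (v i t - v j t)) = v i"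
      using center_of_mass_differences[where x = "\<lambda>i. v i _", OF m1 comv i] by (intro ext) (rule sym)
    finally show ?thesis .
  qed
  have ma: "of_real (m i) * (\<Sum>j\<in>bodies - {i}. of_real (m j) * ?F i j t)
      = (\<Sum>j\<in>bodies - {i}. of_real (m i * m j * delta m e i j / (cmod (q t i - q t j)) ^ 3) * (q t j - q t i))" for i t
    by (simp add: sum_distrib_left scaleR_conv_of_real mult_ac)
  show ?thesis unfolding charged_solution_def
  proof (intro conjI ballI)
    show "\<forall>t. \<forall>i\<in>bodies. \<forall>j\<in>bodies. i \<noteq> j \<longrightarrow> q t i \<noteq> q t j" using nc by blast
    fix i assume i: "i \<in> bodies"
    show "\<exists>v a. (\<forall>t. ((\<lambda>s. q s i) has_vector_derivative v t) (at t)) \<and> (\<forall>t. (v has_vector_derivative a t) (at t)) \<and>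
        (\<forall>t. of_real (m i) * a t = (\<Sum>j\<in>bodies - {i}.
            of_real (m i * m j * delta m e i j / (cmod (q t i - q t j)) ^ 3) * (q t j - q t i)))"
      using v(1)[OF i] vd[OF i] ma[of i] by (intro exI conjI allI)
  qed
qed

lemma (in regular_path) kepler_pairs_elliptic_triangle:
  assumes tri: "delta m e 1 2 powr (1/3) + delta m e 2 3 powr (1/3) > delta m e 3 1 powr (1/3)"
    "delta m e 2 3 powr (1/3) + delta m e 3 1 powr (1/3) > delta m e 1 2 powr (1/3)"
    "delta m e 3 1 powr (1/3) + delta m e 1 2 powr (1/3) > delta m e 2 3 powr (1/3)"
    and kp: kepler_pairs
  shows "elliptic_triangle m e \<tau> q"
proof -
  note com = Xspace_center_of_mass[OF q \<tau>]
  note per = Xspace_periodic[OF q \<tau>]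
  have kepler: "((\<lambda>t. v i t - v j t) has_vector_derivative - (delta m e i j / cmod (diff q i j t) ^ 3) *\<^sub>R diff q i j t) (at t)"
    if "(i, j) \<in> pairs" for i j t
    using kp that by (simp add: kepler_pairs_def)
  define D where "D i j = delta m e i j powr (1/3)" for i j
  have p: "(1,2) \<in> pairs" "(2,3) \<in> pairs" "(3,1) \<in> pairs" by (auto simp: pairs_def)
  have D: "D i j > 0" "D i j ^ 3 = delta m e i j" if "(i, j) \<in> pairs" for i j
  proof -
    show "D i j > 0" using \<delta>[OF that] by (simp add: D_def)
    then have "D i j ^ 3 = D i j powr 3" by simp
    also have "\<dots> = delta m e i j" using \<delta>[OF that] by (simp add: D_def powr_powr)
    finally show "D i j ^ 3 = delta m e i j" .
  qed
  have nz: "diff q i j t \<noteq> 0" if "(i, j) \<in> pairs" for i j t using nc pairs_bodies[OF that] by simp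
  have bal: "of_real (D 1 2 ^ 3 / cmod (diff q 1 2 t) ^ 3) * diff q 1 2 t + of_real (D 2 3 ^ 3 / cmod (diff q 2 3 t) ^ 3) * diff q 2 3 t
     + of_real (D 3 1 ^ 3 / cmod (diff q 3 1 t) ^ 3) * diff q 3 1 t = 0" for t
  proof -
    have "((\<lambda>t. (v 1 t - v 2 t) + (v 2 t - v 3 t) + (v 3 t - v 1 t)) has_vector_derivative
       (- (delta m e 1 2 / cmod (diff q 1 2 t) ^ 3) *\<^sub>R diff q 1 2 t) + (- (delta m e 2 3 / cmod (diff q 2 3 t) ^ 3) *\<^sub>R diff q 2 3 t)
       + (- (delta m e 3 1 / cmod (diff q 3 1 t) ^ 3) *\<^sub>R diff q 3 1 t)) (at t)"
      by (intro has_vector_derivative_add kepler p)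
    then have "((\<lambda>t. 0) has_vector_derivative
       - ((delta m e 1 2 / cmod (diff q 1 2 t) ^ 3) *\<^sub>R diff q 1 2 t + (delta m e 2 3 / cmod (diff q 2 3 t) ^ 3) *\<^sub>R diff q 2 3 t
       + (delta m e 3 1 / cmod (diff q 3 1 t) ^ 3) *\<^sub>R diff q 3 1 t)) (at t)"
      by (simp add: algebra_simps)
    from vector_derivative_unique_at[OF this has_vector_derivative_const] show ?thesis
      unfolding D(2)[OF p(1)] D(2)[OF p(2)] D(2)[OF p(3)] scaleR_conv_of_real by (simp only: neg_equal_0_iff_equal)
  qed
  note geo = balanced_triangle[OF D(1)[OF p(1)] D(1)[OF p(2)] D(1)[OF p(3)] tri[folded D_def]
      nz[OF p(1)] nz[OF p(2)] nz[OF p(3)] _ bal]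
  have im: "Im (diff q 1 2 t * cnj (diff q 2 3 t)) \<noteq> 0"
    and r23: "D 2 3 / cmod (diff q 2 3 t) = D 1 2 / cmod (diff q 1 2 t)"
    and r31: "D 3 1 / cmod (diff q 3 1 t) = D 1 2 / cmod (diff q 1 2 t)" for t
    by (rule geo; simp)+
  define z where "z = diff q 1 2"
  have z0: "z t \<noteq> 0" for t using nz[OF p(1)] by (simp add: z_def)
  \<comment> \<open>The shape of the triangle: the sides are z, c z and - (1 + c) z.\<close>
  define c where "c t = diff q 2 3 t / z t" for t
  define A where "A = (D 2 3 / D 1 2)\<^sup>2"
  define B where "B = (D 3 1 / D 1 2)\<^sup>2"
  have cA: "(Re (c t))\<^sup>2 + (Im (c t))\<^sup>2 = A" for t
  proof -
    have "cmod (c t) = D 2 3 / D 1 2" using r23[of t] D(1)[OF p(1)] nz[OF p(2), of t] z0[of t]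
      by (simp add: c_def norm_divide z_def field_simps)
    then show ?thesis by (simp add: A_def flip: cmod_power2)
  qed
  have q31: "diff q 3 1 t = - ((1 + c t) * z t)" for t using z0[of t] by (simp add: c_def z_def field_simps)
  have cB: "(1 + Re (c t))\<^sup>2 + (Im (c t))\<^sup>2 = B" for t
  proof -
    have "cmod (1 + c t) = cmod (diff q 3 1 t) / cmod (z t)" using z0[of t] unfolding q31 by (simp add: norm_mult)
    also have "\<dots> = D 3 1 / D 1 2" using r31[of t] D(1)[OF p(1)] nz[OF p(3), of t] z0[of t]
      by (simp add: z_def field_simps)
    finally have "(cmod (1 + c t))\<^sup>2 = B" by (simp add: B_def)
    then show ?thesis using cmod_power2[of "1 + c t"] by simp
  qed
  \<comment> \<open>The moduli of c and 1 + c are fixed. Subtracting the two circle equations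
    determines Re c, and Im c up to sign, so c takes at most two mirror-image values and is constant
    by continuity.\<close>
  define X where "X = (B - A - 1) / 2"
  have cX: "Re (c t) = X" for t using cA[of t] cB[of t] by (simp add: X_def power2_eq_square algebra_simps)
  have cY: "Im (c t) = sqrt (A - X\<^sup>2) \<or> Im (c t) = - sqrt (A - X\<^sup>2)" for t
  proof -
    have "\<bar>Im (c t)\<bar> = sqrt (A - X\<^sup>2)" using cA[of t] cX[of t] by (metis add_diff_cancel_left' real_sqrt_abs)
    then show ?thesis by linarith
  qed
  have cont: "continuous_on UNIV (\<lambda>t. q t i)" if "i \<in> bodies" for i
    by (rule has_vector_derivative_imp_continuous_UNIV[OF v(1)[OF that]])
  have "continuous_on UNIV c" unfolding c_def z_def
    by (intro continuous_intros cont) (use bodies_simps z0 in \<open>auto simp: z_def\<close>)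
  moreover have "c t = Complex X (sqrt (A - X\<^sup>2)) \<or> c t = Complex X (- sqrt (A - X\<^sup>2))" for t
    using cX[of t] cY[of t] by (auto simp: complex_eq_iff)
  then have "range c \<subseteq> {Complex X (sqrt (A - X\<^sup>2)), Complex X (- sqrt (A - X\<^sup>2))}" by blast
  then have "finite (range c)" by (rule finite_subset) simp
  ultimately have "c constant_on UNIV"
    by (intro continuous_finite_range_constant) auto
  then obtain c0 where c0: "\<And>t. c t = c0" by (auto simp: constant_on_def)
  \<comment> \<open>The triangle 0, 1, 1 + c0, reflected in the origin and shifted to have its
    centre of mass at 0. Then a 1 - a 2 = 1, which fits z = q 1 - q 2.\<close>
  define a where "a i = (of_real (m 2) + of_real (m 3) * (1 + c0)) - (if i = 1 then 0 else if i = 2 then 1 else 1 + c0)" for i :: nat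
  have q23: "diff q 2 3 t = c0 * z t" for t using c0[of t] z0[of t] by (simp add: c_def field_simps)
  have qa: "q t i = z t * a i" if i: "i \<in> bodies" for t i
  proof -
    have "q t 1 = of_real (m 2) * diff q 1 2 t + of_real (m 3) * (q t 1 - q t 3)"
      using center_of_mass_differences[where x = "q t", OF m1 com, of 1] bodies_simps by (simp add: sum_other_bodies(1)[simplified])
    also have "q t 1 - q t 3 = (1 + c0) * z t" using q31[of t] c0[of t] by (simp add: algebra_simps)
    finally have "q t 1 = z t * a 1" by (simp add: a_def z_def algebra_simps)
    moreover have "q t 2 = q t 1 - z t" "q t 3 = q t 1 - (z t + c0 * z t)" using q23[of t] by (simp_all add: z_def algebra_simps)
    ultimately show ?thesis using i by (auto simp: bodies_def a_def algebra_simps)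
  qed
  have adist: "a i \<noteq> a j" if "i \<in> bodies" "j \<in> bodies" "i \<noteq> j" for i j
    using nc[OF that, of 0] qa[of i 0] qa[of j 0] that by auto
  have acom: "(\<Sum>i\<in>bodies. of_real (m i) * a i) = 0"
  proof -
    have "z 0 * (\<Sum>i\<in>bodies. of_real (m i) * a i) = (\<Sum>i\<in>bodies. of_real (m i) * q 0 i)"
      unfolding sum_distrib_left by (intro sum.cong refl) (simp add: qa mult_ac)
    then show ?thesis using com z0 by simp
  qed
  \<comment> \<open>As |a 1 - a 2| = 1, the common ratio is \<open>delta m e 1 2\<close>. It will be
    both the multiplier of the central configuration and the attraction constant of the Kepler orbit
    z.\<close>
  have ratio: "delta m e i j / cmod (a i - a j) ^ 3 = delta m e 1 2" if ij: "(i, j) \<in> pairs" for i j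
  proof -
    note b = pairs_bodies[OF ij]
    have "D i j / cmod (diff q i j 0) = D 1 2 / cmod (z 0)"
      using ij r23[of 0] r31[of 0] unfolding pairs_def z_def by auto
    moreover have "cmod (diff q i j 0) = cmod (z 0) * cmod (a i - a j)"
      using qa[of i 0] qa[of j 0] b by (simp add: norm_mult flip: right_diff_distrib)
    ultimately have "D i j / cmod (a i - a j) = D 1 2" using z0[of 0] adist[of i j] b by (simp add: field_simps)
    then have "(D i j / cmod (a i - a j)) ^ 3 = D 1 2 ^ 3" by (rule arg_cong)
    then show ?thesis unfolding power_divide D(2)[OF ij] D(2)[OF p(1)] .
  qed
  have ratio': "delta m e i j / cmod (a i - a j) ^ 3 = delta m e 1 2" if ij: "i \<in> bodies" "j \<in> bodies" "i \<noteq> j" for i j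
  proof -
    have "(i, j) \<in> pairs \<or> (j, i) \<in> pairs" using ij by (auto simp: bodies_def pairs_def)
    then show ?thesis using ratio[of i j] ratio[of j i] delta_commute[of m e i j] norm_minus_commute[of "a i" "a j"] by auto
  qed
  have "noncollinear_cc m e a"
    unfolding noncollinear_cc_def
  proof (intro conjI exI[of _ "delta m e 1 2"] ballI impI)
    show "Im ((a 2 - a 1) * cnj (a 3 - a 1)) \<noteq> 0"
    proof -
      have "diff q 1 2 0 = z 0" by (simp add: z_def)
      then have "Im (z 0 * cnj (c0 * z 0)) \<noteq> 0" using im[of 0] unfolding q23 by metis
      moreover have "Im (z 0 * cnj (c0 * z 0)) = - Im c0 * ((Re (z 0))\<^sup>2 + (Im (z 0))\<^sup>2)"
        by (simp add: power2_eq_square algebra_simps)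
      ultimately have "Im c0 \<noteq> 0" by auto
      then show ?thesis by (simp add: a_def)
    qed
    fix i assume i: "i \<in> bodies"
    have "(\<Sum>j\<in>bodies - {i}. of_real (m i * m j * delta m e i j / cmod (a i - a j) ^ 3) * (a i - a j))
      = (\<Sum>j\<in>bodies - {i}. of_real (delta m e 1 2 * m i) * (of_real (m j) * (a i - a j)))"
    proof (intro sum.cong refl)
      fix j assume "j \<in> bodies - {i}"
      then have "m i * m j * delta m e i j / cmod (a i - a j) ^ 3 = delta m e 1 2 * m i * m j"
        using ratio'[of i j] i by (simp flip: times_divide_eq_right)
      then show "of_real (m i * m j * delta m e i j / cmod (a i - a j) ^ 3) * (a i - a j)
         = of_real (delta m e 1 2 * m i) * (of_real (m j) * (a i - a j))" by (simp only: of_real_mult mult.assoc)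
    qed
    also have "\<dots> = of_real (delta m e 1 2 * m i) * a i"
      unfolding sum_distrib_left[symmetric] center_of_mass_differences[OF m1 acom i, symmetric] ..
    finally show "of_real (delta m e 1 2 * m i) * a i
      - (\<Sum>j\<in>bodies - {i}. of_real (m i * m j * delta m e i j / cmod (a i - a j) ^ 3) * (a i - a j)) = 0" by simp
  qed (use adist in auto)
  moreover have "elliptic_kepler \<tau> z"
    unfolding elliptic_kepler_def periodic_path_def
  proof (intro conjI allI)
    show "\<exists>\<mu>>0. \<exists>v a. (\<forall>t. (z has_vector_derivative v t) (at t)) \<and> (\<forall>t. (v has_vector_derivative a t) (at t)) \<and>
        (\<forall>t. a t = - of_real (\<mu> / cmod (z t) ^ 3) * z t)"
    proof (rule exI[of _ "delta m e 1 2"], rule conjI[OF \<delta>[OF p(1)]], rule exI[of _ "\<lambda>t. v 1 t - v 2 t"],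
        rule exI[of _ "\<lambda>t. - of_real (delta m e 1 2 / cmod (z t) ^ 3) * z t"], intro conjI allI refl)
      show "(z has_vector_derivative v 1 t - v 2 t) (at t)" for t
        unfolding z_def by (intro has_vector_derivative_diff v(1) bodies_simps)
      show "((\<lambda>t. v 1 t - v 2 t) has_vector_derivative - of_real (delta m e 1 2 / cmod (z t) ^ 3) * z t) (at t)" for t
        using kepler[OF p(1), of t] by (simp add: z_def scaleR_conv_of_real)
    qed
  qed (use z0 per bodies_simps in \<open>auto simp: z_def\<close>)
  moreover have "charged_solution m e q"
    by (rule kepler_pairs_charged_solution[OF kp])
  ultimately show ?thesis unfolding elliptic_triangle_def using qa by blast
qed


section \<open>Elliptic triangles: minimal action and existence\<close>

text \<open>By \<open>center_of_mass_differences\<close> the term \<lambda> a_i is a combination of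
  the differences a_i - a_j. Each equation becomes a real relation between two differences, which
  are independent for a non-collinear configuration; bodies 1 and 2 yield all three ratios.\<close>

lemma noncollinear_cc_ratio:
  assumes m: "\<forall>i\<in>bodies. m i > 0" and m1: "m 1 + m 2 + m 3 = 1"
    and com: "(\<Sum>i\<in>bodies. of_real (m i) * a i) = 0" and cc: "noncollinear_cc m e a"
  obtains lam where "\<And>i j. (i, j) \<in> pairs \<Longrightarrow> delta m e i j / cmod (a i - a j) ^ 3 = lam"
proof -
  from cc obtain lam :: real where lam: "\<And>i. i \<in> bodies \<Longrightarrow> of_real (lam * m i) * a i
        - (\<Sum>j\<in>bodies - {i}. of_real (m i * m j * delta m e i j / (cmod (a i - a j)) ^ 3) * (a i - a j)) = 0"
    and im: "Im ((a 2 - a 1) * cnj (a 3 - a 1)) \<noteq> 0"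
    unfolding noncollinear_cc_def by blast
  define w where "w i j = delta m e i j / cmod (a i - a j) ^ 3" for i j
  have w_sym: "w i j = w j i" for i j by (simp add: w_def delta_commute[of m e i] norm_minus_commute[of "a i"])
  have eq: "(\<Sum>j\<in>bodies - {i}. of_real (m j * (w i j - lam)) * (a i - a j)) = 0" if i: "i \<in> bodies" for i
  proof -
    have mi: "m i \<noteq> 0" using m i by force
    have "0 = of_real (lam * m i) * a i - (\<Sum>j\<in>bodies - {i}. of_real (m i) * (of_real (m j * w i j) * (a i - a j)))"
      using lam[OF i] by (simp add: w_def mult.assoc)
    also have "\<dots> = of_real (m i) * (of_real lam * a i - (\<Sum>j\<in>bodies - {i}. of_real (m j * w i j) * (a i - a j)))"
      by (simp add: sum_distrib_left right_diff_distrib mult_ac)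
    finally have "(\<Sum>j\<in>bodies - {i}. of_real (m j * w i j) * (a i - a j)) = of_real lam * a i" using mi by simp
    then have w: "(\<Sum>j\<in>bodies - {i}. of_real (m j * w i j) * (a i - a j))
        - of_real lam * (\<Sum>j\<in>bodies - {i}. of_real (m j) * (a i - a j)) = 0"
      by (simp only: center_of_mass_differences[OF m1 com i, symmetric] diff_self)
    have "(\<Sum>j\<in>bodies - {i}. of_real (m j * (w i j - lam)) * (a i - a j))
        = (\<Sum>j\<in>bodies - {i}. of_real (m j * w i j) * (a i - a j))
        - of_real lam * (\<Sum>j\<in>bodies - {i}. of_real (m j) * (a i - a j))"
      unfolding sum_distrib_left sum_subtractf[symmetric] by (intro sum.cong refl) (simp add: algebra_simps)
    then show ?thesis using w by (rule trans)
  qed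
  have m0: "m 1 > 0" "m 2 > 0" "m 3 > 0" using m bodies_simps by auto
  have "of_real (m 2 * (w 1 2 - lam)) * (a 1 - a 2) + of_real (m 3 * (w 1 3 - lam)) * (a 1 - a 3) = 0"
    using eq[OF bodies_simps(2)] unfolding sum_other_bodies(1) .
  moreover have "Im ((a 1 - a 2) * cnj (a 1 - a 3)) \<noteq> 0" using im by (simp add: algebra_simps)
  ultimately have "m 2 * (w 1 2 - lam) = 0" "m 3 * (w 1 3 - lam) = 0" by (rule real_combination_zero)+
  then have 1: "w 1 2 = lam" "w 3 1 = lam" using m0 w_sym[of 3 1] by auto
  have "of_real (m 3 * (w 2 3 - lam)) * (a 2 - a 3) + of_real (m 1 * (w 2 1 - lam)) * (a 2 - a 1) = 0"
    using eq[OF bodies_simps(3)] unfolding sum_other_bodies(2) .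
  moreover have "Im ((a 2 - a 3) * cnj (a 2 - a 1)) \<noteq> 0" using im by (simp add: algebra_simps)
  ultimately have "m 3 * (w 2 3 - lam) = 0" by (rule real_combination_zero)
  then have 2: "w 2 3 = lam" using m0 by auto
  show thesis by (rule that[of lam]) (use 1 2 in \<open>auto simp: pairs_def w_def\<close>)
qed

context charged_bodies
begin

text \<open>Every mutual difference is a constant multiple of z, and the equal ratios of the central
  configuration give it its own attraction \<delta>_ij. So the three pairs satisfy Kepler's equation
  and have minimal pair action.\<close>

lemma elliptic_triangle_action:
  assumes q: "q \<in> Xspace m \<tau> k" and ell: "elliptic_triangle m e \<tau> q"
  shows "action m e \<tau> q = ennreal min_action"
proof -
  from ell obtain a z where cs: "charged_solution m e q" and cc: "noncollinear_cc m e a"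
    and ek: "elliptic_kepler \<tau> z" and qa: "\<And>t i. i \<in> bodies \<Longrightarrow> q t i = z t * a i"
    unfolding elliptic_triangle_def by blast
  from ek obtain \<mu> z' z'' where z0: "\<And>t. z t \<noteq> 0" and \<mu>: "\<mu> > 0"
    and z': "\<And>t. (z has_vector_derivative z' t) (at t)" and z'': "\<And>t. (z' has_vector_derivative z'' t) (at t)"
    and z''_eq: "\<And>t. z'' t = - of_real (\<mu> / cmod (z t) ^ 3) * z t"
    unfolding elliptic_kepler_def by blast
  define v where "v i t = z' t * a i" for i t
  have qf: "(\<lambda>t. q t i) = (\<lambda>t. z t * a i)" if "i \<in> bodies" for i using qa[OF that] by auto
  have vd: "(v i has_vector_derivative z'' t * a i) (at t)" for i t
    unfolding v_def[abs_def] by (rule has_vector_derivative_mult_left[OF z''])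
  interpret regular_path m e \<tau> k q v
  proof
    show "((\<lambda>t. q t i) has_vector_derivative v i t) (at t)" if "i \<in> bodies" for i t
      unfolding qf[OF that] v_def by (rule has_vector_derivative_mult_left[OF z'])
    show "continuous_on UNIV (v i)" for i
      by (rule has_vector_derivative_imp_continuous_UNIV[OF vd])
    show "q t i \<noteq> q t j" if "i \<in> bodies" "j \<in> bodies" "i \<noteq> j" for i j t
      using cs that unfolding charged_solution_def by blast
  qed (rule q)
  have acom: "(\<Sum>i\<in>bodies. of_real (m i) * a i) = 0"
  proof -
    have "z 0 * (\<Sum>i\<in>bodies. of_real (m i) * a i) = (\<Sum>i\<in>bodies. of_real (m i) * q 0 i)"
      unfolding sum_distrib_left by (intro sum.cong refl) (simp add: qa mult_ac)
    then show ?thesis using Xspace_center_of_mass[OF q \<tau>] z0 by simp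
  qed
  obtain lam where lam: "\<And>i j. (i, j) \<in> pairs \<Longrightarrow> delta m e i j / cmod (a i - a j) ^ 3 = lam"
    using noncollinear_cc_ratio[OF m m1 acom cc] by blast
  have adist: "a i \<noteq> a j" if "i \<in> bodies" "j \<in> bodies" "i \<noteq> j" for i j
    using cc that unfolding noncollinear_cc_def by blast
  have lam': "delta m e i j / cmod (a i - a j) ^ 3 = lam" if ij: "i \<in> bodies" "j \<in> bodies" "i \<noteq> j" for i j
  proof -
    have "(i, j) \<in> pairs \<or> (j, i) \<in> pairs" using ij by (auto simp: bodies_def pairs_def)
    then show ?thesis using lam[of i j] lam[of j i] delta_commute[of m e i j] norm_minus_commute[of "a i" "a j"] by auto
  qed
  \<comment> \<open>\<open>elliptic_kepler\<close> leaves the attraction constant \<mu> free.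
    Comparing the accelerations of a body away from the origin at time 0, one from z and one from
    the equations of motion, identifies it with the common ratio.\<close>
  have "\<mu> = lam"
  proof -
    have "a 1 \<noteq> 0 \<or> a 2 \<noteq> 0" using adist[of 1 2] bodies_simps by auto
    then obtain i where i: "i \<in> bodies" "a i \<noteq> 0" using bodies_simps by blast
    from cs i(1) obtain v1 a1 where v1: "\<And>t. ((\<lambda>s. q s i) has_vector_derivative v1 t) (at t)"
      and a1: "\<And>t. (v1 has_vector_derivative a1 t) (at t)"
      and eq: "\<And>t. of_real (m i) * a1 t = (\<Sum>j\<in>bodies - {i}.
            of_real (m i * m j * delta m e i j / (cmod (q t i - q t j)) ^ 3) * (q t j - q t i))"
      unfolding charged_solution_def by blast
    have "v1 t = v i t" for t by (rule vector_derivative_unique_at[OF v1 v(1)[OF i(1)]])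
    then have "v1 = v i" by auto
    then have "a1 0 = z'' 0 * a i" using vector_derivative_unique_at[OF a1[of 0]] vd by blast
    then have "of_real (m i) * (z'' 0 * a i) = (\<Sum>j\<in>bodies - {i}.
            of_real (m i * m j * delta m e i j / (cmod (q 0 i - q 0 j)) ^ 3) * (q 0 j - q 0 i))"
      using eq[of 0] by simp
    also have "\<dots> = (\<Sum>j\<in>bodies - {i}. - (of_real (m i) * of_real (lam / cmod (z 0) ^ 3) * z 0) * (of_real (m j) * (a i - a j)))"
    proof (intro sum.cong refl)
      fix j assume j: "j \<in> bodies - {i}"
      have d: "q 0 i - q 0 j = z 0 * (a i - a j)" using qa i(1) j by (simp add: right_diff_distrib)
      then have d': "q 0 j - q 0 i = - (z 0 * (a i - a j))" by (simp add: algebra_simps)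
      have "m i * m j * delta m e i j / (cmod (q 0 i - q 0 j)) ^ 3 = m i * m j * (delta m e i j / cmod (a i - a j) ^ 3) / cmod (z 0) ^ 3"
        unfolding d norm_mult power_mult_distrib by simp
      also have "delta m e i j / cmod (a i - a j) ^ 3 = lam" using lam'[of i j] i(1) j by simp
      finally show "of_real (m i * m j * delta m e i j / (cmod (q 0 i - q 0 j)) ^ 3) * (q 0 j - q 0 i)
        = - (of_real (m i) * of_real (lam / cmod (z 0) ^ 3) * z 0) * (of_real (m j) * (a i - a j))"
        unfolding d' by simp
    qed
    also have "\<dots> = - (of_real (m i) * of_real (lam / cmod (z 0) ^ 3) * z 0) * a i"
      unfolding sum_distrib_left[symmetric] center_of_mass_differences[OF m1 acom i(1), symmetric] ..
    finally have "of_real (m i) * (z 0 * a i) * of_real (\<mu> / cmod (z 0) ^ 3) = of_real (m i) * (z 0 * a i) * of_real (lam / cmod (z 0) ^ 3)"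
      unfolding z''_eq by (simp add: mult_ac)
    moreover have "of_real (m i) * (z 0 * a i) \<noteq> 0" using m i z0 by (auto simp: less_imp_neq[THEN not_sym])
    ultimately have "\<mu> / cmod (z 0) ^ 3 = lam / cmod (z 0) ^ 3" by (metis mult_left_cancel of_real_eq_iff)
    then show ?thesis using z0[of 0] by simp
  qed
  have kepler_pairs unfolding kepler_pairs_def
  proof (intro allI impI)
    fix i j t assume ij: "(i, j) \<in> pairs"
    note b = pairs_bodies[OF ij]
    have d: "diff q i j t = z t * (a i - a j)" using qa b by (simp add: right_diff_distrib)
    have "((\<lambda>t. v i t - v j t) has_vector_derivative z'' t * a i - z'' t * a j) (at t)"
      by (intro has_vector_derivative_diff vd)
    also have "z'' t * a i - z'' t * a j = - (\<mu> / cmod (z t) ^ 3) *\<^sub>R diff q i j t"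
      unfolding z''_eq d by (simp add: scaleR_conv_of_real right_diff_distrib mult.assoc)
    also have "\<mu> / cmod (z t) ^ 3 = delta m e i j / cmod (diff q i j t) ^ 3"
      unfolding d norm_mult power_mult_distrib \<open>\<mu> = lam\<close> lam[OF ij, symmetric] by simp
    finally show "((\<lambda>t. v i t - v j t) has_vector_derivative - (delta m e i j / cmod (diff q i j t) ^ 3) *\<^sub>R diff q i j t) (at t)" .
  qed
  then show ?thesis by (rule kepler_pairs_action)
qed

end

lemma Omega_subset_Xspace:
  assumes "\<tau> > 0"
  shows "Omega m \<tau> k \<subseteq> Xspace m \<tau> k"
proof
  fix q assume q: "q \<in> Omega m \<tau> k"
  have "W12 \<tau> q" unfolding W12_def periodic_path_def
  proof (intro ballI conjI exI)
    fix i assume i: "i \<in> bodies"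
    show "\<forall>t. q (t + \<tau>) i = q t i" using Omega_velocity(3)[OF q i] by blast
    have c: "continuous_on {0..\<tau>} (velocity q i)" by (rule continuous_on_subset[OF Omega_velocity(2)[OF q i]]) simp
    show "velocity q i absolutely_integrable_on {0..\<tau>}" by (rule absolutely_integrable_continuous_real[OF c])
    show "(\<lambda>t. (cmod (velocity q i t))\<^sup>2) integrable_on {0..\<tau>}" by (intro integrable_continuous_real continuous_intros c)
    fix t assume "t \<in> {0..\<tau>}"
    then have "(velocity q i has_integral q t i - q 0 i) {0..t}"
      by (intro fundamental_theorem_of_calculus) (auto intro: has_vector_derivative_at_within Omega_velocity(1)[OF q i])
    then show "q t i = q 0 i + integral {0..t} (velocity q i)" by (simp add: integral_unique)
  qed
  moreover have "W12_dist2 \<tau> q q = 0" by (simp add: W12_dist2_def)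
  ultimately show "q \<in> Xspace m \<tau> k" unfolding Xspace_def using q by (auto intro!: exI[of _ "\<lambda>n. q"])
qed

lemma ind0_circle:
  fixes b :: complex and s :: int
  assumes "b \<noteq> 0" "\<tau> > 0"
  shows "ind0 \<tau> (\<lambda>t. exp (\<i> * of_real (of_int s * (2 * pi / \<tau>)) * of_real t) * b) = of_int s"
proof -
  let ?g = "\<lambda>t. \<i> * of_real (of_int s * (2 * pi / \<tau>)) * of_real t + Ln b"
  have "ind0 \<tau> (\<lambda>t. exp (\<i> * of_real (of_int s * (2 * pi / \<tau>)) * of_real t) * b) = (?g \<tau> - ?g 0) / (2 * of_real pi * \<i>)"
    by (rule ind0_exp) (use assms in \<open>auto intro!: continuous_intros simp: exp_add\<close>)
  also have "\<dots> = of_int s" using assms by simp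
  finally show ?thesis .
qed

context charged_bodies
begin

text \<open>A circular solution: a triangle that rotates rigidly once per period satisfies the pair
  equations if \<omega>^2 d_ij^3 = \<delta>_ij. Sides proportional to the cube roots of the
  \<delta>_ij form a triangle by the assumption. The path is smooth, so it lies in
  \<open>Omega\<close>, and the sense of rotation gives all three differences the same
  index.\<close>

lemma elliptic_triangle_exists:
  assumes tri: "delta m e 1 2 powr (1/3) + delta m e 2 3 powr (1/3) > delta m e 3 1 powr (1/3)"
    "delta m e 2 3 powr (1/3) + delta m e 3 1 powr (1/3) > delta m e 1 2 powr (1/3)"
    "delta m e 3 1 powr (1/3) + delta m e 1 2 powr (1/3) > delta m e 2 3 powr (1/3)"
  shows "\<exists>q\<in>Xspace m \<tau> k. elliptic_triangle m e \<tau> q"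
proof -
  obtain s :: int where s: "k = (s, s, s)" "s = 1 \<or> s = -1" using k by auto
  define \<omega> where "\<omega> = of_int s * (2 * pi / \<tau>)"
  have \<omega>: "\<omega>\<^sup>2 > 0" using s \<tau> by (auto simp: \<omega>_def)
  define r where "r = (1 / \<omega>\<^sup>2) powr (1/3)"
  have r: "r > 0" "r ^ 3 = 1 / \<omega>\<^sup>2"
  proof -
    show "r > 0" using \<omega> by (simp add: r_def)
    then have "r ^ 3 = r powr 3" by simp
    also have "\<dots> = 1 / \<omega>\<^sup>2" using \<omega> by (simp add: r_def powr_powr)
    finally show "r ^ 3 = 1 / \<omega>\<^sup>2" .
  qed
  have p: "(1,2) \<in> pairs" "(2,3) \<in> pairs" "(3,1) \<in> pairs" by (auto simp: pairs_def)
  define d where "d i j = r * delta m e i j powr (1/3)" for i j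
  have d: "d i j > 0" "\<omega>\<^sup>2 * d i j ^ 3 = delta m e i j" if "(i, j) \<in> pairs" for i j
  proof -
    show "d i j > 0" using r \<delta>[OF that] by (simp add: d_def)
    have "(delta m e i j powr (1/3)) ^ 3 = (delta m e i j powr (1/3)) powr 3" using \<delta>[OF that] by simp
    also have "\<dots> = delta m e i j" using \<delta>[OF that] by (simp add: powr_powr)
    finally show "\<omega>\<^sup>2 * d i j ^ 3 = delta m e i j" using \<omega> by (simp add: d_def power_mult_distrib r(2))
  qed
  obtain b :: "nat \<Rightarrow> complex" where b: "cmod (b 1 - b 2) = d 1 2" "cmod (b 2 - b 3) = d 2 3" "cmod (b 3 - b 1) = d 3 1"
  proof (rule triangle_exists[OF d(1)[OF p(1)] d(1)[OF p(2)] d(1)[OF p(3)]])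
    show "d 3 1 < d 1 2 + d 2 3" "d 1 2 < d 2 3 + d 3 1" "d 2 3 < d 3 1 + d 1 2"
      using tri r(1) by (simp_all add: d_def flip: distrib_left)
  qed blast
  define g where "g = (\<Sum>i\<in>bodies. of_real (m i) * b i)"
  define a where "a i = b i - g" for i
  have ad: "cmod (a i - a j) = d i j" if "(i, j) \<in> pairs" for i j
    using that b by (auto simp: a_def pairs_def)
  have acom: "(\<Sum>i\<in>bodies. of_real (m i) * a i) = 0"
  proof -
    have "(\<Sum>i\<in>bodies. of_real (m i) * a i) = g - (\<Sum>i\<in>bodies. of_real (m i)) * g"
      by (simp add: a_def right_diff_distrib sum_subtractf sum_distrib_right g_def)
    also have "(\<Sum>i\<in>bodies. of_real (m i)) = (1 :: complex)"
      by (simp only: sum_bodies of_real_add[symmetric] m1 of_real_1)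
    finally show ?thesis by simp
  qed
  have adist: "a i \<noteq> a j" if ij: "i \<in> bodies" "j \<in> bodies" "i \<noteq> j" for i j
  proof -
    have "(i, j) \<in> pairs \<or> (j, i) \<in> pairs" using ij by (auto simp: bodies_def pairs_def)
    then show ?thesis using ad[of i j] ad[of j i] d(1)[of i j] d(1)[of j i] by auto
  qed
  define E where "E t = exp (\<i> * of_real \<omega> * of_real t)" for t :: real
  have E0: "E t \<noteq> 0" "cmod (E t) = 1" for t by (auto simp: E_def norm_exp_eq_Re)
  have E': "(E has_vector_derivative \<i> * of_real \<omega> * E t) (at t)" for t
  proof -
    have "((\<lambda>t. \<i> * of_real \<omega> * of_real t) has_vector_derivative \<i> * of_real \<omega> * 1) (at t)"
      using bounded_linear.has_vector_derivative[OF bounded_linear_of_real[where 'a=complex] has_vector_derivative_id[of "at t"]]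
      by (intro has_vector_derivative_mult_right) simp
    from field_vector_diff_chain_at[OF this DERIV_exp] show ?thesis by (simp add: E_def[abs_def] o_def)
  qed
  have Eper: "E (t + \<tau>) = E t" for t
  proof -
    have "\<omega> * \<tau> = 2 * pi * of_int s" using \<tau> by (simp add: \<omega>_def)
    then have "E (t + \<tau>) = E t * exp (\<i> * of_real (2 * pi * of_int s))"
      by (simp add: E_def distrib_left exp_add mult.assoc flip: of_real_mult)
    also have "exp (\<i> * of_real (2 * pi * of_int s)) = 1"
      using exp_2pi_1_int[of s] by (simp add: mult_ac)
    finally show ?thesis by simp
  qed
  define q where "q t i = E t * a i" for t i
  have "q \<in> Omega m \<tau> k"
    unfolding Omega_def
  proof (intro CollectI conjI ballI allI impI)
    show "smooth_fun (\<lambda>t. q t i)" for i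
      unfolding smooth_fun_def
    proof (intro exI[of _ "\<lambda>n t. (\<i> * of_real \<omega>) ^ n * (E t * a i)"] conjI allI)
      show "((\<lambda>t. (\<i> * of_real \<omega>) ^ n * (E t * a i)) has_vector_derivative (\<i> * of_real \<omega>) ^ Suc n * (E t * a i)) (at t)" for n t
        using has_vector_derivative_mult_right[OF has_vector_derivative_mult_left[OF E'[of t], of "a i"], of "(\<i> * of_real \<omega>) ^ n"]
        by (simp add: mult_ac)
    qed (simp add: q_def)
    show "periodic_path \<tau> (\<lambda>t. q t i)" for i by (simp add: periodic_path_def q_def Eper)
    show "(\<Sum>i\<in>bodies. of_real (m i) * q t i) = 0" for t
    proof -
      have "(\<Sum>i\<in>bodies. of_real (m i) * q t i) = E t * (\<Sum>i\<in>bodies. of_real (m i) * a i)"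
        by (simp add: q_def sum_distrib_left mult_ac)
      then show ?thesis by (simp add: acom)
    qed
    show "q t i \<noteq> q t j" if "i \<in> bodies" "j \<in> bodies" "i \<noteq> j" for i j t
      using adist[OF that] E0 by (simp add: q_def)
    have "ind0 \<tau> (diff q i j) = of_int (kidx k i j)" if ij: "(i, j) \<in> pairs" for i j
    proof -
      have "diff q i j = (\<lambda>t. exp (\<i> * of_real (of_int s * (2 * pi / \<tau>)) * of_real t) * (a i - a j))"
        by (simp add: q_def E_def \<omega>_def right_diff_distrib fun_eq_iff)
      moreover have "a i - a j \<noteq> 0" using adist pairs_bodies[OF ij] by simp
      ultimately have "ind0 \<tau> (diff q i j) = of_int s" using ind0_circle[OF _ \<tau>] by simp
      then show ?thesis by (simp add: s(1) kidx_def)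
    qed
    then show "case ij of (i, j) \<Rightarrow> ind0 \<tau> (diff q i j) = of_int (kidx k i j)" if "ij \<in> {(1, 2), (2, 3), (3, 1)}" for ij
      using that by (auto simp: pairs_def)
  qed
  then have q: "q \<in> Xspace m \<tau> k" using Omega_subset_Xspace[OF \<tau>] by blast
  define v where "v i t = \<i> * of_real \<omega> * E t * a i" for i t
  have vd: "(v i has_vector_derivative - of_real (\<omega>\<^sup>2) * (E t * a i)) (at t)" for i t
    using has_vector_derivative_mult_left[OF has_vector_derivative_mult_right[OF E'[of t], of "\<i> * of_real \<omega>"], of "a i"]
    by (simp add: v_def[abs_def] power2_eq_square mult_ac)
  interpret regular_path m e \<tau> k q v
  proof
    show "((\<lambda>t. q t i) has_vector_derivative v i t) (at t)" for i t
      unfolding q_def v_def by (rule has_vector_derivative_mult_left[OF E'])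
    show "continuous_on UNIV (v i)" for i by (rule has_vector_derivative_imp_continuous_UNIV[OF vd])
    show "q t i \<noteq> q t j" if "i \<in> bodies" "j \<in> bodies" "i \<noteq> j" for i j t
      using adist[OF that] E0 by (simp add: q_def)
  qed (rule q)
  have kepler_pairs unfolding kepler_pairs_def
  proof (intro allI impI)
    fix i j t assume ij: "(i, j) \<in> pairs"
    have "cmod (diff q i j t) = d i j" using ad[OF ij] E0 by (simp add: q_def norm_mult flip: right_diff_distrib)
    then have "delta m e i j / cmod (diff q i j t) ^ 3 = \<omega>\<^sup>2" using d[OF ij] by (simp add: field_simps)
    moreover have "((\<lambda>t. v i t - v j t) has_vector_derivative - of_real (\<omega>\<^sup>2) * (E t * a i) - (- of_real (\<omega>\<^sup>2) * (E t * a j))) (at t)"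
      by (intro has_vector_derivative_diff vd)
    ultimately show "((\<lambda>t. v i t - v j t) has_vector_derivative - (delta m e i j / cmod (diff q i j t) ^ 3) *\<^sub>R diff q i j t) (at t)"
      by (simp add: scaleR_conv_of_real q_def algebra_simps)
  qed
  then show ?thesis using kepler_pairs_elliptic_triangle[OF tri] q by blast
qed

text \<open>The action of the minimiser is finite, which rules out collisions; only then is the path
  a \<open>regular_path\<close>, to which the equality case applies.\<close>

lemma regular_minimizer_elliptic:
  assumes tri: "delta m e 1 2 powr (1/3) + delta m e 2 3 powr (1/3) > delta m e 3 1 powr (1/3)"
    "delta m e 2 3 powr (1/3) + delta m e 3 1 powr (1/3) > delta m e 1 2 powr (1/3)"
    "delta m e 3 1 powr (1/3) + delta m e 1 2 powr (1/3) > delta m e 2 3 powr (1/3)"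
    and q: "q \<in> Xspace m \<tau> k" and C2: "\<forall>i\<in>bodies. C2_fun (\<lambda>t. q t i)"
    and min: "action m e \<tau> q = ennreal min_action"
  shows "elliptic_triangle m e \<tau> q"
proof -
  have d: "((\<lambda>t. q t i) has_vector_derivative velocity q i t) (at t)" "continuous_on UNIV (velocity q i)"
    if i: "i \<in> bodies" for i t
  proof -
    obtain v a where v: "\<And>t. ((\<lambda>t. q t i) has_vector_derivative v t) (at t)" "\<And>t. (v has_vector_derivative a t) (at t)"
      using C2 i unfolding C2_fun_def by blast
    have eq: "velocity q i = v" unfolding velocity_def by (rule ext) (rule vector_derivative_at[OF v(1)])
    show "((\<lambda>t. q t i) has_vector_derivative velocity q i t) (at t)" unfolding eq by (rule v(1))
    show "continuous_on UNIV (velocity q i)" unfolding eq by (rule has_vector_derivative_imp_continuous_UNIV[OF v(2)])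
  qed
  interpret regular_path m e \<tau> k q "velocity q"
  proof
    show "q t i \<noteq> q t j" if "i \<in> bodies" "j \<in> bodies" "i \<noteq> j" for i j t
      by (rule finite_action_no_collision[where v = "velocity q", OF q d _ that]) (auto simp: min)
  qed (use q d in auto)
  show ?thesis by (rule kepler_pairs_elliptic_triangle[OF tri minimizer_kepler_pairs[OF min]])
qed

end

theorem theorem2p3:
  fixes m e :: "nat \<Rightarrow> real" and \<tau> :: real and k :: "int \<times> int \<times> int"
  assumes "\<forall>i\<in>bodies. m i > 0"
    and "m 1 + m 2 + m 3 = 1"
    and "delta m e 1 2 > 0" and "delta m e 2 3 > 0" and "delta m e 3 1 > 0"
    and "delta m e 1 2 powr (1/3) + delta m e 2 3 powr (1/3) > delta m e 3 1 powr (1/3)"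
    and "delta m e 2 3 powr (1/3) + delta m e 3 1 powr (1/3) > delta m e 1 2 powr (1/3)"
    and "delta m e 3 1 powr (1/3) + delta m e 1 2 powr (1/3) > delta m e 2 3 powr (1/3)"
    and "\<tau> > 0"
    and "k = (1,1,1) \<or> k = (-1,-1,-1)"
  shows "(INF q\<in>Xspace m \<tau> k. action m e \<tau> q) =
           ennreal ((\<Sum>(i,j)\<in>{(1,2),(2,3),(3,1)}. m i * m j * delta m e i j powr (2/3))
                    * 3 * 2 powr (-1/3) * pi powr (2/3) * \<tau> powr (1/3))
      \<and> (\<exists>q\<in>Xspace m \<tau> k. elliptic_triangle m e \<tau> q)
      \<and> (\<forall>q\<in>Xspace m \<tau> k. elliptic_triangle m e \<tau> q \<longrightarrow>
            action m e \<tau> q = (INF p\<in>Xspace m \<tau> k. action m e \<tau> p))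
      \<and> (\<forall>q\<in>Xspace m \<tau> k. (\<forall>i\<in>bodies. C2_fun (\<lambda>t. q t i)) \<and>
            action m e \<tau> q = (INF p\<in>Xspace m \<tau> k. action m e \<tau> p) \<longrightarrow>
            elliptic_triangle m e \<tau> q)"
proof -
  interpret charged_bodies m e \<tau> k
    by unfold_locales (use assms in \<open>auto simp: pairs_def\<close>)
  note tri = assms(6-8)
  obtain q0 where q0: "q0 \<in> Xspace m \<tau> k" "elliptic_triangle m e \<tau> q0"
    using elliptic_triangle_exists[OF tri] by blast
  have inf: "(INF q\<in>Xspace m \<tau> k. action m e \<tau> q) = ennreal min_action"
  proof (rule antisym)
    show "(INF q\<in>Xspace m \<tau> k. action m e \<tau> q) \<le> ennreal min_action"
      using INF_lower[OF q0(1), of "action m e \<tau>"] elliptic_triangle_action[OF q0] by simp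
    show "ennreal min_action \<le> (INF q\<in>Xspace m \<tau> k. action m e \<tau> q)"
      by (intro INF_greatest action_lower_bound)
  qed
  have "min_action = (\<Sum>(i,j)\<in>{(1,2),(2,3),(3,1)}. m i * m j * delta m e i j powr (2/3))
                    * 3 * 2 powr (-1/3) * pi powr (2/3) * \<tau> powr (1/3)"
    unfolding min_action_def pairs_def gordon_bound_def sum_distrib_right
    by (intro sum.cong) (auto simp: mult_ac)
  then show ?thesis
    using inf elliptic_triangle_exists[OF tri] elliptic_triangle_action regular_minimizer_elliptic[OF tri] by auto
qed

end
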